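(* Let $w\in T$ (Thompson's group $T$) have normal form $$w=x_{i_1}^{r_1}x_{i_2}^{r_2}\cdots x_{i_n}^{r_n}\,c_i^j\,x_{j_m}^{-s_m}\cdots x_{j_2}^{-s_2}x_{j_1}^{-s_1}.$$ Define $$D(w)=\sum_{k=1}^n r_k+\sum_{l=1}^m s_l+i_n+j_m+i.$$ Let $|w|$ denote the word length of $w$ in $T$ with respect to the generating set $\{x_0,x_1,c_1\}$. There exists a constant $C>0$ such that for every $w\in T$, $$\frac{D(w)}{C}\le |w|\le C\,D(w),$$ and similarly, for $N(w)$ the number of carets in either tree of the reduced tree pair diagram representing $w$, $$\frac{N(w)}{C}\le |w|\le C\,N(w).$$
   Context: Thompson's group $T$ is the group of orientation-preserving piecewise-linear homeomorphisms of $S^1=[0,1]/(0\sim 1)$ with finitely many breakpoints, all slopes powers of $2$, and dyadic breakpoints, mapping dyadic rationals to dyadic rationals. $F\subset T$ is the subgroup of elements that are such homeomorphisms of $[0,1]$ (fixing $0$). Product convention: $vu=v\circ u$ (apply $u$ first). Generators: $x_0(t)=t/2$ on $[0,\frac12]$, $t-\frac14$ on $[\frac12,\frac34]$, $2t-1$ on $[\frac34,1]$; for $n\ge1$, $x_n$ is the identity on $[0,1-2^{-n}]$ and $x_n(t)=1-2^{-n}+2^{-n}x_0(2^n(t-1+2^{-n}))$ on $[1-2^{-n},1]$. For $n\ge 0$ let $I_k=[1-2^{-k},1-2^{-k-1}]$ ($0\le k\le n$) and $I_{n+1}=[1-2^{-n-1},1]$; $c_n\in T$ maps $I_0$ affinely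 onto $I_{n+1}$ and $I_k$ affinely onto $I_{k-1}$ for $1\le k\le n+1$; it has order $n+2$. Tree pair diagrams: a caret is an interior node of a finite rooted binary tree together with its two downward edges; such a tree encodes a dyadic subdivision of $[0,1]$, its leaves (numbered $0,1,\dots$ from left to right) being the subintervals. A marked tree pair diagram $(T_-,T_+)$ for $g\in T$ is a pair of such trees with the same number of leaves together with a mark $0$ on one leaf of the target tree $T_+$; $g$ maps leaf $0$ of the source tree $T_-$ affinely to the marked leaf and the subsequent leaves in cyclic order. It is reduced if there is no $a$ such that both trees have a caret whose two children are leaves numbered $a,a+1$ (left to right), where $T_+$ is numbered cyclically from the mark. Every element has a unique reduced diagram. Normal form: the right side of a tree consists of the root and all nodes reached from it by right edges. The leaf exponent of a leaf is the length of the maximal path of left edges going up from it which does not reach the right side of the tree. If the reduced diagram $(T_-,T_+)$ of $w$ has $i+1$ carets in each tree, the normal form of $w\notin F$ is $w=p\,c_i^j\,q$, where $p=x_{i_1}^{r_1}\cdots x_{i_n}^{r_n}$, with $i_1<\dots<i_n$ the leaves of $T_+$ (numbered from left to right, ignoring the mark) with positive leaf exponents $r_1,\dots,r_n$; $q=x_{j_m}^{-s_m}\cdots x_{j_1}^{-s_1}$, with $j_1<\dots<j_m$ the leaves of $T_-$ with positive leaf exponents $s_1,\dots,s_m$; and $1\le j<i+2$ is determined by the mark. For $w\in F$ the normal form is $pq$ with no $c$ term. When the $p$, $q$ or $c$ part is absent, the corresponding term $i_n$, $j_m$ or $i$ in $D(w)$ is read as $0$.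
   Formalization: The bound |w| ≤ C·D(w) is claimed for all w in T except w = c_0 (the half turn): its normal form is c_0 with i = 0 and no x terms, so D(c_0) = 0 while |c_0| > 0, and the bound fails there for every C. The other three bounds hold for all w. *)

theory Defs
  imports "HOL-Analysis.Analysis"
begin

section \<open>The circle and Thompson's groups\<close>

text \<open>The circle [0,1]/(0 ~ 1): its points are the reals in [0,1), and its topology is the
  quotient topology along \<open>frac\<close>, which sends 1 to 0 and fixes [0,1).\<close>

definition circle :: "real topology" where
  "circle = topology (\<lambda>U. U \<subseteq> {0..<1} \<and>
     openin (top_of_set {0..1}) {t \<in> {0..1}. frac t \<in> U})"

lemma openin_circle:
  "openin circle U \<longleftrightarrow>
     U \<subseteq> {0..<1} \<and> openin (top_of_set {0..1}) {t \<in> {0..1}. frac t \<in> U}"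
proof -
  let ?P = "\<lambda>U::real set. U \<subseteq> {0..<1} \<and>
     openin (top_of_set {0..1}) {t \<in> {0..1}. frac t \<in> U}"
  have "istopology ?P"
    unfolding istopology_def
  proof (intro conjI allI impI)
    fix S T :: "real set" assume S: "?P S" and T: "?P T"
    have "{t \<in> {0..1}. frac t \<in> S \<inter> T} =
        {t \<in> {0..1}. frac t \<in> S} \<inter> {t \<in> {0..1}. frac t \<in> T}"
      by blast
    then show "openin (top_of_set {0..1}) {t \<in> {0..1}. frac t \<in> S \<inter> T}"
      using openin_Int[OF conjunct2[OF S] conjunct2[OF T]] by (simp only:)
    show "S \<inter> T \<subseteq> {0..<1}" using S by auto
  next
    fix K :: "real set set" assume K: "\<forall>U\<in>K. ?P U"
    have "{t \<in> {0..1}. frac t \<in> \<Union>K} = (\<Union>U\<in>K. {t \<in> {0..1}. frac t \<in> U})"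
      by blast
    then show "openin (top_of_set {0..1}) {t \<in> {0..1}. frac t \<in> \<Union>K}"
      using K by (simp only:) (rule openin_Union, blast)
    show "\<Union>K \<subseteq> {0..<1}" using K by blast
  qed
  then show ?thesis
    by (simp add: circle_def topology_inverse')
qed

lemma topspace_circle: "topspace circle = {0..<1}"
proof
  show "topspace circle \<subseteq> {0..<1}"
    using openin_topspace[of circle] unfolding openin_circle by blast
  have "{t \<in> {0..1::real}. frac t \<in> {0..<1}} = {0..1}"
    by (auto simp: frac_lt_1)
  then have "openin circle {0..<1}"
    by (simp add: openin_circle)
  then show "{0..<1} \<subseteq> topspace circle"
    by (rule openin_subset)
qed

lemma quotient_map_circle: "quotient_map (top_of_set {0..1}) circle frac"
proof -
  have "frac ` {0..1} = {0..<1::real}"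
  proof
    show "frac ` {0..1} \<subseteq> {0..<1::real}" by (auto simp: frac_lt_1)
    show "{0..<1::real} \<subseteq> frac ` {0..1}"
    proof
      fix t :: real assume "t \<in> {0..<1}"
      then have "frac t = t" "t \<in> {0..1}" by (auto simp: frac_eq)
      then show "t \<in> frac ` {0..1}" by (metis image_eqI)
    qed
  qed
  then show ?thesis
    by (auto simp: quotient_map_def topspace_circle openin_circle)
qed

definition dyadic :: "real set" where
  "dyadic = {t. \<exists>(m::int) (n::nat). t = of_int m / 2 ^ n}"

text \<open>A circle map is represented by a function on the reals that is the identity off [0,1), so
  that the group operation is \<open>(\<circ>)\<close>, the unit is \<open>id\<close> and inverses are \<open>inv\<close>.
  "Linear" is meant on the circle, hence modulo 1.  As all slopes
  are positive, such a homeomorphism is automatically orientation preserving.\<close>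

definition pl_dyadic :: "(real \<Rightarrow> real) \<Rightarrow> bool" where
  "pl_dyadic f \<longleftrightarrow>
     (\<exists>B. finite B \<and> B \<subseteq> dyadic \<inter> {0..1} \<and>
        (\<forall>a b. a < b \<and> {a<..<b} \<subseteq> {0..1} - B \<longrightarrow>
           (\<exists>(k::int) c. \<forall>t\<in>{a<..<b}. f t = frac (2 powi k * t + c))))"

definition thompson_T :: "(real \<Rightarrow> real) set" where
  "thompson_T = {f. homeomorphic_map circle circle f \<and> (\<forall>t. t \<notin> {0..<1} \<longrightarrow> f t = t) \<and>
     pl_dyadic f \<and> f ` (dyadic \<inter> {0..<1}) \<subseteq> dyadic}"

definition thompson_F :: "(real \<Rightarrow> real) set" where
  "thompson_F = {f \<in> thompson_T. f 0 = 0}"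

definition x_zero :: "real \<Rightarrow> real" where
  "x_zero t =
     (if t \<in> {0..1/2} then t / 2
      else if t \<in> {1/2..3/4} then t - 1/4
      else if t \<in> {3/4..1} then 2 * t - 1
      else t)"

definition x_gen :: "nat \<Rightarrow> real \<Rightarrow> real" where
  "x_gen n t =
     (if t \<in> {1 - 1 / 2^n..1} then 1 - 1 / 2^n + x_zero (2^n * (t - 1 + 1 / 2^n)) / 2^n
      else t)"

text \<open>The three affine branches are \<open>I\<^sub>0\<close> onto \<open>I\<^sub>n\<^sub>+\<^sub>1\<close>; \<open>I\<^sub>k\<close> onto \<open>I\<^sub>k\<^sub>-\<^sub>1\<close> for
  \<open>1 \<le> k \<le> n\<close> (the same formula \<open>2t - 1\<close> for each k); and \<open>I\<^sub>n\<^sub>+\<^sub>1\<close> onto \<open>I\<^sub>n\<close>, two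
  intervals of equal length.\<close>

definition c_gen :: "nat \<Rightarrow> real \<Rightarrow> real" where
  "c_gen n t =
     (if t \<in> {0..<1/2} then 1 - 1 / 2^(n+1) + t / 2^n
      else if t \<in> {1/2..<1 - 1 / 2^(n+1)} then 2 * t - 1
      else if t \<in> {1 - 1 / 2^(n+1)..<1} then t - 1 / 2^(n+1)
      else t)"

definition word_length :: "('a \<Rightarrow> 'a) set \<Rightarrow> ('a \<Rightarrow> 'a) \<Rightarrow> nat" where
  "word_length S g =
     (LEAST n. \<exists>us. length us = n \<and> set us \<subseteq> S \<union> inv ` S \<and> foldr (\<circ>) us id = g)"


section \<open>Tree pair diagrams\<close>

datatype tree = Leaf | Caret tree tree

datatype edge = Left_Edge | Right_Edge

fun carets :: "tree \<Rightarrow> nat" where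
  "carets Leaf = 0"
| "carets (Caret l r) = carets l + carets r + 1"

text \<open>The subintervals of [a,b] given by the leaves, from left to right.\<close>

fun leaves :: "tree \<Rightarrow> real \<Rightarrow> real \<Rightarrow> (real \<times> real) list" where
  "leaves Leaf a b = [(a, b)]"
| "leaves (Caret l r) a b = leaves l a ((a + b) / 2) @ leaves r ((a + b) / 2) b"

definition num_leaves :: "tree \<Rightarrow> nat" where
  "num_leaves t = length (leaves t 0 1)"

text \<open>The numbers a such that the leaves numbered a and a + 1 (left to right, from 0) are the two
  children of one caret.\<close>

fun exposed :: "tree \<Rightarrow> nat set" where
  "exposed Leaf = {}"
| "exposed (Caret l r) =
     (if l = Leaf \<and> r = Leaf then {0}
      else exposed l \<union> (\<lambda>a. num_leaves l + a) ` exposed r)"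

text \<open>A marked diagram is (source tree, target tree, position m of the marked leaf of the target
  tree).  The leaf of the target tree with cyclic number k, counted from the mark, is then at
  position \<open>(k + m) mod n\<close> from the left, where n is the number of leaves.\<close>

type_synonym diagram = "tree \<times> tree \<times> nat"

definition tree_pair :: "diagram \<Rightarrow> bool" where
  "tree_pair = (\<lambda>(S, T, m). num_leaves S = num_leaves T \<and> m < num_leaves T)"

definition represents :: "diagram \<Rightarrow> (real \<Rightarrow> real) \<Rightarrow> bool" where
  "represents = (\<lambda>(S, T, m) g.
     \<forall>k < num_leaves S.
       (let (a, b) = leaves S 0 1 ! k;
            (c, d) = leaves T 0 1 ! ((k + m) mod num_leaves T)
        in \<forall>t\<in>{a..<b}. g t = c + (t - a) * (d - c) / (b - a)))"

definition reduced :: "diagram \<Rightarrow> bool" where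
  "reduced = (\<lambda>(S, T, m).
     \<not> (\<exists>a. a \<in> exposed S \<and> (a + m) mod num_leaves T \<in> exposed T))"

definition reduced_diagram :: "(real \<Rightarrow> real) \<Rightarrow> diagram" where
  "reduced_diagram w = (THE d. tree_pair d \<and> reduced d \<and> represents d w)"

definition source_tree :: "(real \<Rightarrow> real) \<Rightarrow> tree" where
  "source_tree w = fst (reduced_diagram w)"

definition target_tree :: "(real \<Rightarrow> real) \<Rightarrow> tree" where
  "target_tree w = fst (snd (reduced_diagram w))"

text \<open>The two trees have the same number of leaves, hence of carets.\<close>

definition caret_number :: "(real \<Rightarrow> real) \<Rightarrow> nat" where
  "caret_number w = carets (source_tree w)"


section \<open>Leaf exponents and the normal form\<close>

text \<open>Nodes are addressed by the edges leading to them from the root.\<close>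

fun leaf_paths :: "tree \<Rightarrow> edge list list" where
  "leaf_paths Leaf = [[]]"
| "leaf_paths (Caret l r) =
     map ((#) Left_Edge) (leaf_paths l) @ map ((#) Right_Edge) (leaf_paths r)"

definition on_right_side :: "edge list \<Rightarrow> bool" where
  "on_right_side p \<longleftrightarrow> set p \<subseteq> {Right_Edge}"

text \<open>The alternative \<open>k = 0\<close> covers the rightmost leaf, which itself lies on the right side.\<close>

definition leaf_exponent :: "edge list \<Rightarrow> nat" where
  "leaf_exponent p =
     (GREATEST k. k = 0 \<or> (\<exists>q. p = q @ replicate k Left_Edge \<and> \<not> on_right_side q))"

definition exponents :: "tree \<Rightarrow> (nat \<times> nat) list" where
  "exponents t = filter (\<lambda>(i, r). 0 < r) (List.enumerate 0 (map leaf_exponent (leaf_paths t)))"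

text \<open>\<open>(ps, cp, qs)\<close> with \<open>ps = [(i\<^sub>1,r\<^sub>1),...,(i\<^sub>n,r\<^sub>n)]\<close>,
  \<open>qs = [(j\<^sub>1,s\<^sub>1),...,(j\<^sub>m,s\<^sub>m)]\<close>, both with increasing indices, and \<open>cp\<close> the pair
  \<open>(i, j)\<close> of the factor \<open>c\<^sub>i\<^sup>j\<close>, if present.  The \<open>qs\<close> factor is a word in
  decreasing indices; \<open>fold\<close> composes on the left, so that index \<open>j\<^sub>1\<close> is applied first.\<close>

type_synonym normal_form = "(nat \<times> nat) list \<times> (nat \<times> nat) option \<times> (nat \<times> nat) list"

definition pos_word :: "(nat \<times> nat) list \<Rightarrow> real \<Rightarrow> real" where
  "pos_word ps = foldr (\<lambda>(i, r) f. (x_gen i ^^ r) \<circ> f) ps id"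

definition neg_word :: "(nat \<times> nat) list \<Rightarrow> real \<Rightarrow> real" where
  "neg_word qs = fold (\<lambda>(j, s) f. (inv (x_gen j) ^^ s) \<circ> f) qs id"

definition cyc_word :: "(nat \<times> nat) option \<Rightarrow> real \<Rightarrow> real" where
  "cyc_word cp = (case cp of None \<Rightarrow> id | Some (i, j) \<Rightarrow> c_gen i ^^ j)"

text \<open>The exponent j is pinned down by the equation for w, since \<open>c\<^sub>i\<close> has order \<open>i + 2\<close>.\<close>

definition has_normal_form :: "(real \<Rightarrow> real) \<Rightarrow> normal_form \<Rightarrow> bool" where
  "has_normal_form w = (\<lambda>(ps, cp, qs).
     w = pos_word ps \<circ> cyc_word cp \<circ> neg_word qs \<and>
     ps = exponents (target_tree w) \<and>
     qs = exponents (source_tree w) \<and>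
     (case cp of
        None \<Rightarrow> w \<in> thompson_F
      | Some (i, j) \<Rightarrow> w \<notin> thompson_F \<and> caret_number w = i + 1 \<and> 1 \<le> j \<and> j < i + 2))"

definition normal_form :: "(real \<Rightarrow> real) \<Rightarrow> normal_form" where
  "normal_form w = (THE nf. has_normal_form w nf)"

definition last_index :: "(nat \<times> nat) list \<Rightarrow> nat" where
  "last_index ps = (if ps = [] then 0 else fst (last ps))"

text \<open>\<open>D_est\<close> vanishes at \<open>c_gen 0\<close> (one caret, so \<open>i = 0\<close>, and no \<open>x\<close> factors), which is not
  the identity.\<close>

definition D_est :: "(real \<Rightarrow> real) \<Rightarrow> nat" where
  "D_est w = (case normal_form w of (ps, cp, qs) \<Rightarrow>
     sum_list (map snd ps) + sum_list (map snd qs) + last_index ps + last_index qs +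
     (case cp of None \<Rightarrow> 0 | Some (i, j) \<Rightarrow> i))"

end

theory Submission
  imports Defs
begin

text \<open>
  Write N for the number of carets of the reduced diagram of w. The theorem is a linear comparison of
  the word length with N, together with one of N with D.

  Lower bound for the length. Call a standard dyadic interval good for w if w maps it affinely onto a
  standard dyadic interval. A partition of the circle into good intervals is the same as a tree
  pair diagram: a partition into standard dyadic intervals is the leaf set of a tree
  (\<open>tree_of_dpart\<close>), and continuity on the circle makes w match the leaves in cyclic order
  (\<open>diagram_of_good_part\<close>). The source tree of a reduced diagram has the maximal good
  intervals as its leaves, so the reduced diagram is unique; and a diagram with the fewest leaves is
  reduced, so it exists and is minimal (\<open>reduced_unique\<close>, \<open>reduced_exists\<close>). Composing two maps adds at most the
  numbers of their parts (\<open>good_part_comp\<close>), and each letter needs at most four parts. Hence a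
  word of length n has a partition with 4 n + 1 parts, and N is at most 4 n
  (\<open>caret_number_le\<close>).

  Upper bound for the length. The positive word given by the leaf exponents of a tree T maps the right
  comb to T leaf by leaf (\<open>pos_word_represents\<close>). Since \<open>x_gen (k + 1)\<close> is the conjugate
  of \<open>x_gen 1\<close> by the k-th power of \<open>x_gen 0\<close> and the indices in such a word increase,
  the conjugating powers telescope, and the word has length at most 3 N (\<open>tree_word_len\<close>).
  It remains to rotate leaves. Let the diagram have n leaves and mark m > 0. Take a tree U with n - m
  leaves below the left child of the root and m below the right one, and let V arise from U by
  exchanging the two subtrees. Then the half turn \<open>c_gen 0\<close>, which is
  \<open>x_gen 0 \<circ> c_gen 1\<close>, carries U to V and rotates leaves by m. So w is the product of a
  half turn with four words of trees or their inverses (\<open>thompson_len\<close>).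

  Comparison of N with D. The same description of positive words, with a power of \<open>c_gen\<close> in the
  middle, gives existence and uniqueness of the normal form (\<open>normal_form_eq\<close>), so that D can be
  read off from the reduced diagram. The leaf exponents count the carets off the right side, and the
  indices are smaller than the number of leaves, so D is at most 5 N. Conversely the carets on the
  right side are controlled by the last index in one of the two trees, thanks to reducedness, or by
  the index of the c term; this fails only for \<open>c_gen 0\<close> (\<open>caret_number_le_D_est\<close>).
\<close>

section \<open>Affine maps between intervals\<close>

abbreviation ico :: "real \<times> real \<Rightarrow> real set" where
  "ico I \<equiv> {fst I..<snd I}"

abbreviation unit_ivl :: "real \<times> real" where
  "unit_ivl \<equiv> (0, 1)"

text \<open>Intervals are pairs of endpoints and stand for half-open intervals; the formula is the one by
  which a tree pair diagram acts on a leaf of its source tree.\<close>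

definition affine_onto :: "(real \<Rightarrow> real) \<Rightarrow> real \<times> real \<Rightarrow> real \<times> real \<Rightarrow> bool" where
  "affine_onto g I J \<longleftrightarrow>
     (\<forall>t\<in>ico I. g t = fst J + (t - fst I) * (snd J - fst J) / (snd I - fst I))"

lemma affine_ontoD:
  "affine_onto g I J \<Longrightarrow> t \<in> ico I \<Longrightarrow>
     g t = fst J + (t - fst I) * (snd J - fst J) / (snd I - fst I)"
  by (simp add: affine_onto_def)

lemma affine_onto_mem:
  assumes "affine_onto g I J" "fst J < snd J" "t \<in> ico I"
  shows "g t \<in> ico J"
proof -
  have 1: "0 \<le> (t - fst I) / (snd I - fst I)" "(t - fst I) / (snd I - fst I) < 1"
    using assms(3) by auto
  have "g t = fst J + (t - fst I) / (snd I - fst I) * (snd J - fst J)"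
    using affine_ontoD[OF assms(1,3)] by simp
  moreover have "(t - fst I) / (snd I - fst I) * (snd J - fst J) < 1 * (snd J - fst J)"
    using 1 assms(2) by (intro mult_strict_right_mono) auto
  moreover have "0 \<le> (t - fst I) / (snd I - fst I) * (snd J - fst J)"
    using 1 assms(2) by (intro mult_nonneg_nonneg) auto
  ultimately show ?thesis by auto
qed

lemma affine_onto_surj:
  assumes "affine_onto g I J" "fst I < snd I" "s \<in> ico J"
  shows "\<exists>t\<in>ico I. g t = s \<and> t = fst I + (s - fst J) * (snd I - fst I) / (snd J - fst J)"
proof -
  define t where "t = fst I + (s - fst J) / (snd J - fst J) * (snd I - fst I)"
  have 1: "0 \<le> (s - fst J) / (snd J - fst J)" "(s - fst J) / (snd J - fst J) < 1"
    using assms(3) by auto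
  have "(s - fst J) / (snd J - fst J) * (snd I - fst I) < 1 * (snd I - fst I)"
    using 1 assms(2) by (intro mult_strict_right_mono) auto
  moreover have "0 \<le> (s - fst J) / (snd J - fst J) * (snd I - fst I)"
    using 1 assms(2) by (intro mult_nonneg_nonneg) auto
  ultimately have t: "t \<in> ico I" by (simp add: t_def)
  have "g t = fst J + (t - fst I) * (snd J - fst J) / (snd I - fst I)"
    by (rule affine_ontoD[OF assms(1) t])
  also have "\<dots> = s" using assms by (simp add: t_def)
  finally show ?thesis using t by (intro bexI[of _ t]) (auto simp: t_def)
qed

lemma affine_onto_image:
  assumes "affine_onto g I J" "fst I < snd I" "fst J < snd J"
  shows "g ` ico I = ico J"
  using affine_onto_mem[OF assms(1,3)] affine_onto_surj[OF assms(1,2)] by blast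

lemma affine_onto_comp:
  assumes "affine_onto f I J" "affine_onto g J K" "fst J < snd J"
  shows "affine_onto (g \<circ> f) I K"
  unfolding affine_onto_def
proof
  fix t assume t: "t \<in> ico I"
  have "g (f t) = fst K + (f t - fst J) * (snd K - fst K) / (snd J - fst J)"
    using affine_ontoD[OF assms(2) affine_onto_mem[OF assms(1,3) t]] .
  also have "f t - fst J = (t - fst I) * (snd J - fst J) / (snd I - fst I)"
    using affine_ontoD[OF assms(1) t] by simp
  finally show "(g \<circ> f) t = fst K + (t - fst I) * (snd K - fst K) / (snd I - fst I)"
    using assms(3) by simp
qed

lemma affine_onto_inv:
  assumes "affine_onto g I J" "fst I < snd I" "inj g"
  shows "affine_onto (inv g) J I"
  unfolding affine_onto_def
  using affine_onto_surj[OF assms(1,2)] inv_f_f[OF assms(3)] by metis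

lemma affine_onto_id: "(\<And>t. t \<in> ico I \<Longrightarrow> g t = t) \<Longrightarrow> affine_onto g I I"
  by (auto simp: affine_onto_def)

lemma affine_onto_unique:
  assumes "affine_onto g I J" "affine_onto g I K" "fst I < snd I"
  shows "J = K"
proof -
  let ?m = "(fst I + snd I) / 2"
  have mem: "fst I \<in> ico I" "?m \<in> ico I" using assms(3) by auto
  have 1: "fst J = fst K"
    using affine_ontoD[OF assms(1) mem(1)] affine_ontoD[OF assms(2) mem(1)] by simp
  have 2: "fst J + (?m - fst I) * (snd J - fst J) / (snd I - fst I)
        = fst K + (?m - fst I) * (snd K - fst K) / (snd I - fst I)"
    using affine_ontoD[OF assms(1) mem(2)] affine_ontoD[OF assms(2) mem(2)] by (simp only:)
  have "(?m - fst I) / (snd I - fst I) = 1 / 2" using assms(3) by (simp add: field_simps)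
  then have "(?m - fst I) * x / (snd I - fst I) = x / 2" for x
    by (metis mult.commute mult_1 times_divide_eq_left times_divide_eq_right)
  with 2 have "fst J + (snd J - fst J) / 2 = fst K + (snd K - fst K) / 2" by (simp only:)
  with 1 have "snd J = snd K" by (simp add: field_simps)
  with 1 show ?thesis by (simp add: prod_eq_iff)
qed

lemma affine_onto_halves:
  assumes "affine_onto g (a, b) (c, d)" "a < b"
  shows "affine_onto g (a, (a + b) / 2) (c, (c + d) / 2)"
    and "affine_onto g ((a + b) / 2, b) ((c + d) / 2, d)"
proof -
  have eq: "c + (t - a) * ((c + d) / 2 - c) / ((a + b) / 2 - a) = c + (t - a) * (d - c) / (b - a)"
    "(c + d) / 2 + (t - (a + b) / 2) * (d - (c + d) / 2) / (b - (a + b) / 2)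
      = c + (t - a) * (d - c) / (b - a)" for t
    using assms(2) by (simp_all add: divide_simps) (simp_all add: algebra_simps)
  show "affine_onto g (a, (a + b) / 2) (c, (c + d) / 2)"
    using assms unfolding affine_onto_def by (auto simp: eq)
  show "affine_onto g ((a + b) / 2, b) ((c + d) / 2, d)"
    using assms unfolding affine_onto_def by (auto simp: eq)
qed

text \<open>The step that cancels a matching pair of carets: maps that agree on two sibling leaves combine
  to one affine map of their parent.\<close>

lemma affine_onto_join:
  assumes "affine_onto g (a, (a + b) / 2) (c, (c + d) / 2)"
    and "affine_onto g ((a + b) / 2, b) ((c + d) / 2, d)" "a < b"
  shows "affine_onto g (a, b) (c, d)"
proof -
  have eq: "c + (t - a) * ((c + d) / 2 - c) / ((a + b) / 2 - a) = c + (t - a) * (d - c) / (b - a)"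
    "(c + d) / 2 + (t - (a + b) / 2) * (d - (c + d) / 2) / (b - (a + b) / 2)
      = c + (t - a) * (d - c) / (b - a)" for t
    using assms(3) by (simp_all add: divide_simps) (simp_all add: algebra_simps)
  show ?thesis unfolding affine_onto_def fst_conv snd_conv
  proof
    fix t assume "t \<in> {a..<b}"
    then consider "t \<in> {a..<(a + b) / 2}" | "t \<in> {(a + b) / 2..<b}" by fastforce
    then show "g t = c + (t - a) * (d - c) / (b - a)"
      using assms(1,2) unfolding affine_onto_def fst_conv snd_conv by cases (auto simp: eq)
  qed
qed


section \<open>Dyadic subdivision\<close>

text \<open>The subnodes of an interval are the nodes of the infinite binary tree of its repeated halvings;
  those of [0,1) are the standard dyadic intervals.\<close>

inductive subnode :: "real \<times> real \<Rightarrow> real \<times> real \<Rightarrow> bool" where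
  subnode_refl: "subnode I I"
| subnode_left: "subnode (a, (a + b) / 2) J \<Longrightarrow> subnode (a, b) J"
| subnode_right: "subnode ((a + b) / 2, b) J \<Longrightarrow> subnode (a, b) J"

lemma subnode_bounds:
  "subnode I J \<Longrightarrow> fst I < snd I \<Longrightarrow> fst I \<le> fst J \<and> fst J < snd J \<and> snd J \<le> snd I"
  by (induction rule: subnode.induct) auto

lemma subnode_trans: "subnode I J \<Longrightarrow> subnode J K \<Longrightarrow> subnode I K"
  by (induction rule: subnode.induct) (auto intro: subnode.intros)

lemma subnode_cases:
  assumes "subnode (a, b) J"
  obtains "J = (a, b)" | "subnode (a, (a + b) / 2) J" | "subnode ((a + b) / 2, b) J"
  using assms by (cases rule: subnode.cases) auto

lemma subnode_left_bounds:
  "subnode (a, (a + b) / 2) J \<Longrightarrow> a < b \<Longrightarrow> a \<le> fst J \<and> fst J < snd J \<and> snd J \<le> (a + b) / 2"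
  using subnode_bounds[of "(a, (a + b) / 2)" J] by auto

lemma subnode_right_bounds:
  "subnode ((a + b) / 2, b) J \<Longrightarrow> a < b \<Longrightarrow> (a + b) / 2 \<le> fst J \<and> fst J < snd J \<and> snd J \<le> b"
  using subnode_bounds[of "((a + b) / 2, b)" J] by auto

lemma subnode_subset: "subnode I J \<Longrightarrow> fst I < snd I \<Longrightarrow> ico J \<subseteq> ico I"
  using subnode_bounds[of I J] by auto

lemma subnode_antisym:
  assumes "subnode I J" "subnode J I" "fst I < snd I"
  shows "I = J"
  using subnode_bounds[OF assms(1,3)] subnode_bounds[OF assms(2)] by (auto simp: prod_eq_iff)

text \<open>Two nodes part ways at the first halving that puts them on different sides, and from then on
  they are disjoint; if there is no such halving, one is an ancestor of the other.\<close>

lemma subnode_nested: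
  assumes "subnode K I" "subnode K J" "fst K < snd K"
  shows "subnode I J \<or> subnode J I \<or> ico I \<inter> ico J = {}"
  using assms
proof (induction arbitrary: J rule: subnode.induct)
  case (subnode_refl I)
  then show ?case by blast
next
  case (subnode_left a b I)
  have ab: "a < b" using subnode_left.prems by simp
  from subnode_left.prems(1) show ?case
  proof (cases rule: subnode_cases)
    case 1
    then show ?thesis using subnode_left.hyps by (auto intro: subnode.intros)
  next
    case 2
    then show ?thesis using subnode_left.IH ab by auto
  next
    case 3
    have "ico I \<inter> ico J = {}"
      using subnode_left_bounds[OF subnode_left.hyps ab] subnode_right_bounds[OF 3 ab] by auto
    then show ?thesis by blast
  qed
next
  case (subnode_right a b I)
  have ab: "a < b" using subnode_right.prems by simp
  from subnode_right.prems(1) show ?case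
  proof (cases rule: subnode_cases)
    case 1
    then show ?thesis using subnode_right.hyps by (auto intro: subnode.intros)
  next
    case 2
    have "ico I \<inter> ico J = {}"
      using subnode_right_bounds[OF subnode_right.hyps ab] subnode_left_bounds[OF 2 ab] by auto
    then show ?thesis by blast
  next
    case 3
    then show ?thesis using subnode_right.IH ab by auto
  qed
qed

text \<open>Affine maps commute with halving.\<close>

lemma affine_onto_subnode:
  assumes "subnode I I'" "affine_onto g I J" "fst I < snd I"
  shows "\<exists>J'. subnode J J' \<and> affine_onto g I' J'"
  using assms
proof (induction arbitrary: J rule: subnode.induct)
  case (subnode_refl I)
  then show ?case using subnode.subnode_refl by blast
next
  case (subnode_left a b I')
  obtain c d where J: "J = (c, d)" by fastforce
  from subnode_left.IH[OF affine_onto_halves(1)[of g a b c d]] subnode_left.prems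
  show ?case by (auto simp: J intro: subnode.intros)
next
  case (subnode_right a b I')
  obtain c d where J: "J = (c, d)" by fastforce
  from subnode_right.IH[OF affine_onto_halves(2)[of g a b c d]] subnode_right.prems
  show ?case by (auto simp: J intro: subnode.intros)
qed

lemma subnode_grid:
  assumes "k < 2 ^ n"
  shows "subnode (a, b) (a + real k * (b - a) / 2 ^ n, a + (real k + 1) * (b - a) / 2 ^ n)"
  using assms
proof (induction n arbitrary: a b k)
  case 0
  then show ?case by (simp add: subnode_refl)
next
  case (Suc n)
  show ?case
  proof (cases "k < 2 ^ n")
    case True
    have "subnode (a, (a + b) / 2) (a + real k * ((a + b) / 2 - a) / 2 ^ n,
        a + (real k + 1) * ((a + b) / 2 - a) / 2 ^ n)"
      by (rule Suc.IH[OF True])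
    moreover have "x * ((a + b) / 2 - a) / 2 ^ n = x * (b - a) / 2 ^ Suc n" for x
      by (simp add: field_simps)
    ultimately show ?thesis by - (rule subnode_left, simp only:)
  next
    case False
    define l where "l = k - 2 ^ n"
    have k: "k = l + 2 ^ n" and l: "l < 2 ^ n" using False Suc.prems by (simp_all add: l_def)
    have "subnode ((a + b) / 2, b) ((a + b) / 2 + real l * (b - (a + b) / 2) / 2 ^ n,
        (a + b) / 2 + (real l + 1) * (b - (a + b) / 2) / 2 ^ n)"
      by (rule Suc.IH[OF l])
    moreover have "(a + b) / 2 + real l * (b - (a + b) / 2) / 2 ^ n =
        a + real k * (b - a) / 2 ^ Suc n"
      "(a + b) / 2 + (real l + 1) * (b - (a + b) / 2) / 2 ^ n =
        a + (real k + 1) * (b - a) / 2 ^ Suc n"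
      unfolding k by (simp_all add: divide_simps) (simp_all add: algebra_simps)
    ultimately show ?thesis by - (rule subnode_right, simp only:)
  qed
qed

text \<open>Unique existence says at once that the intervals cover K and that they are disjoint.\<close>

definition dpart :: "real \<times> real \<Rightarrow> (real \<times> real) set \<Rightarrow> bool" where
  "dpart K P \<longleftrightarrow> finite P \<and> (\<forall>I\<in>P. subnode K I) \<and> (\<forall>x\<in>ico K. \<exists>!I. I \<in> P \<and> x \<in> ico I)"

lemma dpart_subnode: "dpart K P \<Longrightarrow> I \<in> P \<Longrightarrow> subnode K I"
  by (simp add: dpart_def)

lemma dpart_eqI:
  assumes "dpart K P" "fst K < snd K" "I \<in> P" "J \<in> P" "x \<in> ico I" "x \<in> ico J"
  shows "I = J"
proof -
  have "x \<in> ico K" using subnode_subset[OF dpart_subnode[OF assms(1,3)] assms(2)] assms(5) by blast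
  then show ?thesis using assms unfolding dpart_def by blast
qed

lemma dpart_cover:
  assumes "dpart K P" "x \<in> ico K"
  obtains I where "I \<in> P" "x \<in> ico I"
  using assms unfolding dpart_def by blast

lemma dpart_subset_eq:
  assumes "dpart K P" "dpart K Q" "P \<subseteq> Q" "fst K < snd K"
  shows "P = Q"
proof
  show "Q \<subseteq> P"
  proof
    fix I assume I: "I \<in> Q"
    have b: "fst I \<in> ico I" "fst I \<in> ico K"
      using subnode_bounds[OF dpart_subnode[OF assms(2) I] assms(4)] by auto
    obtain J where J: "J \<in> P" "fst I \<in> ico J" using dpart_cover[OF assms(1) b(2)] .
    then have "J = I" using dpart_eqI[OF assms(2,4) _ I J(2) b(1)] assms(3) by blast
    with J show "I \<in> P" by simp
  qed
qed (fact assms(3))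

text \<open>No part other than the whole interval crosses the midpoint, so the partition falls apart into
  partitions of the two halves. This is the induction step in rebuilding a tree from its leaves.\<close>

lemma dpart_restrict:
  assumes P: "dpart (a, b) P" and ab: "a < b" and ne: "(a, b) \<notin> P"
  shows "dpart (a, (a + b) / 2) {I \<in> P. snd I \<le> (a + b) / 2}"
    and "dpart ((a + b) / 2, b) {I \<in> P. (a + b) / 2 \<le> fst I}"
    and "{I \<in> P. snd I \<le> (a + b) / 2} \<union> {I \<in> P. (a + b) / 2 \<le> fst I} = P"
    and "{I \<in> P. snd I \<le> (a + b) / 2} \<inter> {I \<in> P. (a + b) / 2 \<le> fst I} = {}"
proof -
  have cs: "subnode (a, (a + b) / 2) I \<and> snd I \<le> (a + b) / 2 \<or>
      subnode ((a + b) / 2, b) I \<and> (a + b) / 2 \<le> fst I" if "I \<in> P" for I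
    using dpart_subnode[OF P that] ne that
    by (cases rule: subnode_cases) (auto dest: subnode_left_bounds[OF _ ab] subnode_right_bounds[OF _ ab])
  have lt: "fst I < snd I" if "I \<in> P" for I
    using subnode_bounds[OF dpart_subnode[OF P that]] ab by auto
  show "{I \<in> P. snd I \<le> (a + b) / 2} \<union> {I \<in> P. (a + b) / 2 \<le> fst I} = P"
    using cs by blast
  show "{I \<in> P. snd I \<le> (a + b) / 2} \<inter> {I \<in> P. (a + b) / 2 \<le> fst I} = {}"
    using lt by fastforce
  have fin: "finite P" using P by (simp add: dpart_def)
  have ex: "\<exists>!I. I \<in> P \<and> x \<in> ico I" if "x \<in> {a..<b}" for x
    using P that unfolding dpart_def by (metis fst_conv snd_conv)
  show "dpart (a, (a + b) / 2) {I \<in> P. snd I \<le> (a + b) / 2}"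
    unfolding dpart_def
  proof (intro conjI ballI)
    fix I assume "I \<in> {I \<in> P. snd I \<le> (a + b) / 2}"
    then have "I \<in> P" "snd I \<le> (a + b) / 2" by auto
    then show "subnode (a, (a + b) / 2) I" using cs[of I] lt[of I] by linarith
  next
    fix x assume x: "x \<in> ico (a, (a + b) / 2)"
    then have "x \<in> {a..<b}" using ab by auto
    from ex[OF this] obtain I where "I \<in> P" "x \<in> ico I" "\<forall>J. J \<in> P \<and> x \<in> ico J \<longrightarrow> J = I" by blast
    moreover have "snd I \<le> (a + b) / 2" using cs[OF \<open>I \<in> P\<close>] \<open>x \<in> ico I\<close> x by auto
    ultimately show "\<exists>!I. I \<in> {I \<in> P. snd I \<le> (a + b) / 2} \<and> x \<in> ico I" by blast
  qed (simp add: fin)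
  show "dpart ((a + b) / 2, b) {I \<in> P. (a + b) / 2 \<le> fst I}"
    unfolding dpart_def
  proof (intro conjI ballI)
    fix I assume "I \<in> {I \<in> P. (a + b) / 2 \<le> fst I}"
    then have "I \<in> P" "(a + b) / 2 \<le> fst I" by auto
    then show "subnode ((a + b) / 2, b) I" using cs[of I] lt[of I] by linarith
  next
    fix x assume x: "x \<in> ico ((a + b) / 2, b)"
    then have "x \<in> {a..<b}" using ab by auto
    from ex[OF this] obtain I where "I \<in> P" "x \<in> ico I" "\<forall>J. J \<in> P \<and> x \<in> ico J \<longrightarrow> J = I" by blast
    moreover have "(a + b) / 2 \<le> fst I" using cs[OF \<open>I \<in> P\<close>] \<open>x \<in> ico I\<close> x by auto
    ultimately show "\<exists>!I. I \<in> {I \<in> P. (a + b) / 2 \<le> fst I} \<and> x \<in> ico I" by blast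
  qed (simp add: fin)
qed

section \<open>Leaves of a tree\<close>

lemma length_leaves: "length (leaves t a b) = carets t + 1"
  by (induction t arbitrary: a b) auto

lemma num_leaves_carets: "num_leaves t = carets t + 1"
  by (simp add: num_leaves_def length_leaves)

lemma length_leaves_num: "length (leaves t a b) = num_leaves t"
  by (simp add: num_leaves_carets length_leaves)

lemma num_leaves_simps [simp]:
  "num_leaves Leaf = 1" "num_leaves (Caret l r) = num_leaves l + num_leaves r"
  by (simp_all add: num_leaves_carets)

lemma num_leaves_pos [simp]: "0 < num_leaves t"
  by (simp add: num_leaves_carets)

lemma leaves_subnode: "I \<in> set (leaves t a b) \<Longrightarrow> subnode (a, b) I"
  by (induction t arbitrary: a b) (auto intro: subnode.intros)

lemma leaves_affine:
  assumes "affine_onto g (a, b) (c, d)" "a < b"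
  shows "list_all2 (affine_onto g) (leaves t a b) (leaves t c d)"
  using assms
  by (induction t arbitrary: a b c d) (auto intro!: list_all2_appendI dest: affine_onto_halves)

lemma leaves_left_bounds:
  "I \<in> set (leaves t a ((a + b) / 2)) \<Longrightarrow> a < b \<Longrightarrow>
     a \<le> fst I \<and> fst I < snd I \<and> snd I \<le> (a + b) / 2"
  by (rule subnode_left_bounds[OF leaves_subnode])

lemma leaves_right_bounds:
  "I \<in> set (leaves t ((a + b) / 2) b) \<Longrightarrow> a < b \<Longrightarrow>
     (a + b) / 2 \<le> fst I \<and> fst I < snd I \<and> snd I \<le> b"
  by (rule subnode_right_bounds[OF leaves_subnode])

lemma leaves_bounds:
  "I \<in> set (leaves t a b) \<Longrightarrow> a < b \<Longrightarrow> a \<le> fst I \<and> fst I < snd I \<and> snd I \<le> b"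
  using subnode_bounds[OF leaves_subnode] by fastforce

lemma leaves_cover: "x \<in> {a..<b} \<Longrightarrow> \<exists>I\<in>set (leaves t a b). x \<in> ico I"
proof (induction t arbitrary: a b)
  case (Caret l r)
  then consider "x \<in> {a..<(a + b) / 2}" | "x \<in> {(a + b) / 2..<b}" by fastforce
  then show ?case using Caret.IH by cases (fastforce simp del: atLeastLessThan_iff)+
qed simp

lemma leaves_disjoint:
  assumes "a < b" "I \<in> set (leaves t a b)" "J \<in> set (leaves t a b)" "x \<in> ico I" "x \<in> ico J"
  shows "I = J"
  using assms
proof (induction t arbitrary: a b)
  case (Caret l r)
  have lr: False if "I' \<in> set (leaves l a ((a + b) / 2))" "J' \<in> set (leaves r ((a + b) / 2) b)"
    "x \<in> ico I'" "x \<in> ico J'" for I' J'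
    using leaves_left_bounds[OF that(1) Caret.prems(1)] leaves_right_bounds[OF that(2) Caret.prems(1)]
      that(3,4) by auto
  have m: "a < (a + b) / 2" "(a + b) / 2 < b" using Caret.prems(1) by auto
  from Caret.prems(2,3) show ?case
    using Caret.IH(1)[OF m(1) _ _ Caret.prems(4,5)] Caret.IH(2)[OF m(2) _ _ Caret.prems(4,5)]
      lr[of I J] lr[of J I] Caret.prems(4,5) by auto
qed simp

lemma dpart_leaves: "a < b \<Longrightarrow> dpart (a, b) (set (leaves t a b))"
  unfolding dpart_def using leaves_subnode leaves_cover leaves_disjoint
  by (metis List.finite_set fst_conv snd_conv)

lemma distinct_leaves: "a < b \<Longrightarrow> distinct (leaves t a b)"
proof (induction t arbitrary: a b)
  case (Caret l r)
  have "set (leaves l a ((a + b) / 2)) \<inter> set (leaves r ((a + b) / 2) b) = {}"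
    using leaves_left_bounds[of _ l, OF _ Caret.prems] leaves_right_bounds[of _ r, OF _ Caret.prems]
    by fastforce
  then show ?case using Caret by simp
qed simp

lemma card_leaves: "card (set (leaves t 0 1)) = num_leaves t"
  using distinct_card[OF distinct_leaves[of 0 1 t]] by (simp add: length_leaves_num)

lemma leaves_nonempty [simp]: "leaves t a b \<noteq> []"
  by (induction t arbitrary: a b) auto

lemma fst_hd_leaves: "fst (hd (leaves t a b)) = a"
  by (induction t arbitrary: a b) auto

lemma snd_last_leaves: "snd (last (leaves t a b)) = b"
  by (induction t arbitrary: a b) auto

lemma leaves_consecutive:
  "Suc k < num_leaves t \<Longrightarrow> snd (leaves t a b ! k) = fst (leaves t a b ! Suc k)"
proof (induction t arbitrary: a b k)
  case (Caret l r)
  consider "Suc k < num_leaves l" | "Suc k = num_leaves l" | "num_leaves l \<le> k" by linarith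
  then show ?case
  proof cases
    case 2
    have "leaves l a ((a + b) / 2) ! k = last (leaves l a ((a + b) / 2))"
      using 2 by (simp add: last_conv_nth length_leaves_num flip: 2)
    moreover have "leaves r ((a + b) / 2) b ! 0 = hd (leaves r ((a + b) / 2) b)"
      by (simp add: hd_conv_nth)
    ultimately show ?thesis
      using 2 by (simp add: nth_append length_leaves_num fst_hd_leaves snd_last_leaves)
  qed (use Caret in \<open>auto simp: nth_append length_leaves_num Suc_diff_le\<close>)
qed simp

lemma leaves_eq_root:
  assumes "(a, b) \<in> set (leaves t a b)" "a < b"
  shows "t = Leaf"
proof (cases t)
  case (Caret l r)
  then show ?thesis
    using assms leaves_left_bounds[of "(a, b)" l a b] leaves_right_bounds[of "(a, b)" r a b] by auto
qed simp

text \<open>By induction on the number of parts: the two halves of a nontrivial partition are smaller and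
  give the two subtrees at the root.\<close>

lemma tree_of_dpart:
  assumes "dpart (a, b) P" "a < b"
  shows "\<exists>t. set (leaves t a b) = P"
  using assms
proof (induction "card P" arbitrary: a b P rule: less_induct)
  case less
  show ?case
  proof (cases "(a, b) \<in> P")
    case True
    have "{(a, b)} = P"
      by (rule dpart_subset_eq[OF _ less.prems(1)])
        (use True less.prems(2) in \<open>auto simp: dpart_def subnode_refl\<close>)
    then show ?thesis by (intro exI[of _ Leaf]) simp
  next
    case False
    define L where "L = {I \<in> P. snd I \<le> (a + b) / 2}"
    define R where "R = {I \<in> P. (a + b) / 2 \<le> fst I}"
    note d = dpart_restrict[OF less.prems False, folded L_def R_def]
    have m: "a < (a + b) / 2" "(a + b) / 2 < b" using less.prems(2) by auto
    have "L \<noteq> {}" using dpart_cover[OF d(1), of a] m by auto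
    moreover have "R \<noteq> {}" using dpart_cover[OF d(2), of "(a + b) / 2"] m by auto
    moreover have fin: "finite L" "finite R" using d(1,2) by (simp_all add: dpart_def)
    ultimately have "card L < card P" "card R < card P"
      using d(3) card_Un_disjoint[OF fin d(4)] by (auto simp: card_gt_0_iff)
    from less.hyps[OF this(1) d(1) m(1)] less.hyps[OF this(2) d(2) m(2)]
    obtain l r where "set (leaves l a ((a + b) / 2)) = L" "set (leaves r ((a + b) / 2) b) = R"
      by blast
    then show ?thesis using d(3) by (intro exI[of _ "Caret l r"]) simp
  qed
qed

text \<open>The leaves on either side of the midpoint are those of the left and of the right subtree.\<close>

lemma leaves_inject:
  assumes "set (leaves t a b) = set (leaves u a b)" "a < b"
  shows "t = u"
  using assms
proof (induction t arbitrary: u a b)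
  case Leaf
  then show ?case using leaves_eq_root[of a b u] by auto
next
  case (Caret l r)
  note ab = Caret.prems(2)
  have m: "a < (a + b) / 2" "(a + b) / 2 < b" using ab by auto
  show ?case
  proof (cases u)
    case Leaf
    then have "(a, b) \<in> set (leaves (Caret l r) a b)" using Caret.prems by simp
    then show ?thesis using leaves_eq_root[OF _ ab] by blast
  next
    case (Caret l' r')
    have left: "set (leaves l' a ((a + b) / 2)) =
        {I \<in> set (leaves (Caret l' r') a b). snd I \<le> (a + b) / 2}" for l' r'
      using leaves_left_bounds[of _ l', OF _ ab] leaves_right_bounds[of _ r', OF _ ab] by fastforce
    have right: "set (leaves r' ((a + b) / 2) b) =
        {I \<in> set (leaves (Caret l' r') a b). (a + b) / 2 \<le> fst I}" for l' r'
      using leaves_left_bounds[of _ l', OF _ ab] leaves_right_bounds[of _ r', OF _ ab] by fastforce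
    have "l = l'"
      by (rule Caret.IH(1)[OF _ m(1)]) (use Caret.prems(1) Caret left in metis)
    moreover have "r = r'"
      by (rule Caret.IH(2)[OF _ m(2)]) (use Caret.prems(1) Caret right in metis)
    ultimately show ?thesis using Caret by simp
  qed
qed


section \<open>Exposed carets\<close>

text \<open>An exposed caret together with the interval [u,v) of its interior node.\<close>

definition exposed_at :: "tree \<Rightarrow> real \<Rightarrow> real \<Rightarrow> nat \<Rightarrow> real \<Rightarrow> real \<Rightarrow> bool" where
  "exposed_at t a b k u v \<longleftrightarrow> k \<in> exposed t \<and> Suc k < num_leaves t \<and>
     leaves t a b ! k = (u, (u + v) / 2) \<and> leaves t a b ! Suc k = ((u + v) / 2, v)"

lemma exposed_at_left:
  "exposed_at l a ((a + b) / 2) k u v \<Longrightarrow> exposed_at (Caret l r) a b k u v"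
  by (auto simp: exposed_at_def nth_append length_leaves_num)

lemma exposed_at_right:
  "exposed_at r ((a + b) / 2) b k u v \<Longrightarrow> exposed_at (Caret l r) a b (num_leaves l + k) u v"
  by (auto simp: exposed_at_def nth_append length_leaves_num)

lemma exposed_atI:
  "k \<in> exposed t \<Longrightarrow> \<exists>u v. exposed_at t a b k u v \<and> subnode (a, b) (u, v)"
proof (induction t arbitrary: a b k)
  case (Caret l r)
  show ?case
  proof (cases "l = Leaf \<and> r = Leaf")
    case True
    then show ?thesis using Caret.prems
      by (intro exI[of _ a] exI[of _ b]) (auto simp: exposed_at_def subnode_refl)
  next
    case False
    then consider "k \<in> exposed l" | k' where "k' \<in> exposed r" "k = num_leaves l + k'"
      using Caret.prems by auto
    then show ?thesis
    proof cases
      case 1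
      then show ?thesis using Caret.IH(1) exposed_at_left subnode_left by blast
    next
      case 2
      then show ?thesis using Caret.IH(2) exposed_at_right subnode_right by blast
    qed
  qed
qed simp

lemma exposed_nonempty: "t \<noteq> Leaf \<Longrightarrow> exposed t \<noteq> {}"
  by (induction t) auto

text \<open>A node of the tree that lies strictly above a leaf has an exposed caret below it, namely any
  deepest caret of the subtree hanging from it.\<close>

lemma exposed_below:
  assumes "subnode (a, b) K" "I \<in> set (leaves t a b)" "subnode K I" "I \<noteq> K" "a < b"
  shows "\<exists>k u v. exposed_at t a b k u v \<and> subnode K (u, v)"
  using assms
proof (induction t arbitrary: a b)
  case Leaf
  then have "I = (a, b)" by simp
  with Leaf have "I = K" using subnode_antisym[of K I] subnode_bounds[OF Leaf.prems(1)] by auto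
  then show ?case using Leaf by blast
next
  case (Caret l r)
  have m: "a < (a + b) / 2" "(a + b) / 2 < b" using Caret.prems(5) by auto
  from Caret.prems(1) show ?case
  proof (cases rule: subnode_cases)
    case 1
    then show ?thesis
      using exposed_nonempty[of "Caret l r"] exposed_atI[of _ "Caret l r" a b] by auto
  next
    case 2
    have "subnode (a, (a + b) / 2) I" using 2 Caret.prems(3) subnode_trans by blast
    then have "I \<in> set (leaves l a ((a + b) / 2))"
      using Caret.prems(2,5) leaves_right_bounds[of I r a b] subnode_left_bounds[of a b I] by auto
    from Caret.IH(1)[OF 2 this Caret.prems(3,4) m(1)] show ?thesis
      using exposed_at_left by blast
  next
    case 3
    have "subnode ((a + b) / 2, b) I" using 3 Caret.prems(3) subnode_trans by blast
    then have "I \<in> set (leaves r ((a + b) / 2) b)"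
      using Caret.prems(2,5) leaves_left_bounds[of I l a b] subnode_right_bounds[of a b I] by auto
    from Caret.IH(2)[OF 3 this Caret.prems(3,4) m(2)] show ?thesis
      using exposed_at_right by blast
  qed
qed

text \<open>The leaves force the tree to contain the node [c,d) and to split it exactly once, so that they
  are the two children of one caret.\<close>

lemma exposed_of_halves:
  assumes "subnode (a, b) (c, d)" "a < b" "i < num_leaves t"
    and "leaves t a b ! i = (c, (c + d) / 2)" "((c + d) / 2, d) \<in> set (leaves t a b)"
  shows "i \<in> exposed t"
  using assms
proof (induction t arbitrary: a b i)
  case Leaf
  then have "a = c" "(c + d) / 2 = c" by auto
  then show ?case using subnode_bounds[OF Leaf.prems(1)] Leaf.prems(2) by auto
next
  case (Caret l r)
  note ab = Caret.prems(2)
  have m: "a < (a + b) / 2" "(a + b) / 2 < b" using ab by auto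
  have cd: "c < d" using subnode_bounds[OF Caret.prems(1)] ab by auto
  have nth: "leaves (Caret l r) a b ! i = (if i < num_leaves l then leaves l a ((a + b) / 2) ! i
      else leaves r ((a + b) / 2) b ! (i - num_leaves l))"
    by (simp add: nth_append length_leaves_num)
  have mem: "leaves l a ((a + b) / 2) ! i \<in> set (leaves l a ((a + b) / 2))" if "i < num_leaves l"
    using that by (simp add: length_leaves_num)
  have mem': "leaves r ((a + b) / 2) b ! (i - num_leaves l) \<in> set (leaves r ((a + b) / 2) b)"
    if "\<not> i < num_leaves l"
    using that Caret.prems(3) by (simp add: length_leaves_num)
  from Caret.prems(1) show ?case
  proof (cases rule: subnode_cases)
    case 1
    then have [simp]: "c = a" "d = b" by auto
    have i: "i < num_leaves l"
      using mem' leaves_right_bounds[of "(a, (a + b) / 2)" r a b] ab nth Caret.prems(4)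
      by (auto split: if_splits)
    then have "(a, (a + b) / 2) \<in> set (leaves l a ((a + b) / 2))"
      using mem nth Caret.prems(4) by simp
    then have l: "l = Leaf" by (rule leaves_eq_root[OF _ m(1)])
    have "((a + b) / 2, b) \<in> set (leaves r ((a + b) / 2) b)"
      using Caret.prems(5) leaves_left_bounds[of "((a + b) / 2, b)" l a b] ab m by auto
    then have "r = Leaf" by (rule leaves_eq_root[OF _ m(2)])
    then show ?thesis using l i by simp
  next
    case 2
    have b: "a \<le> c" "d \<le> (a + b) / 2" using subnode_left_bounds[OF 2 ab] by auto
    have i: "i < num_leaves l"
    proof (rule ccontr)
      assume "\<not> i < num_leaves l"
      then show False
        using leaves_right_bounds[OF mem' ab] nth Caret.prems(4) b cd by (auto simp: field_simps)
    qed
    have "((c + d) / 2, d) \<in> set (leaves l a ((a + b) / 2))"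
      using Caret.prems(5) leaves_right_bounds[of "((c + d) / 2, d)" r a b] ab b cd by auto
    with i have "i \<in> exposed l"
      using Caret.IH(1)[OF 2 m(1)] nth Caret.prems(4) by simp
    then show ?thesis by auto
  next
    case 3
    have b: "(a + b) / 2 \<le> c" "d \<le> b" using subnode_right_bounds[OF 3 ab] by auto
    have i: "\<not> i < num_leaves l"
    proof
      assume "i < num_leaves l"
      then show False
        using leaves_left_bounds[OF mem ab] nth Caret.prems(4) b cd by (auto simp: field_simps)
    qed
    have "((c + d) / 2, d) \<in> set (leaves r ((a + b) / 2) b)"
      using Caret.prems(5) leaves_left_bounds[of "((c + d) / 2, d)" l a b] ab b cd by auto
    with i have "i - num_leaves l \<in> exposed r"
      using Caret.IH(2)[OF 3 m(2)] nth Caret.prems(3,4) by simp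
    then have "i \<in> (\<lambda>a. num_leaves l + a) ` exposed r"
      using i by (intro image_eqI[of _ _ "i - num_leaves l"]) auto
    then show ?thesis by auto
  qed
qed

section \<open>Good partitions\<close>

text \<open>The class of maps in which words in the generators are treated: partitions can be pushed forward
  and pulled back along them.\<close>

definition unit_bij :: "(real \<Rightarrow> real) \<Rightarrow> bool" where
  "unit_bij f \<longleftrightarrow> bij f \<and> f ` {0..<1} = {0..<1}"

text \<open>The good intervals are the candidates for leaves of a source tree, and the partitions into good
  intervals turn out to be the diagrams of the map.\<close>

definition good :: "(real \<Rightarrow> real) \<Rightarrow> real \<times> real \<Rightarrow> bool" where
  "good f I \<longleftrightarrow> subnode unit_ivl I \<and> (\<exists>J. subnode unit_ivl J \<and> affine_onto f I J)"

definition good_part :: "(real \<Rightarrow> real) \<Rightarrow> (real \<times> real) set \<Rightarrow> bool" where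
  "good_part f P \<longleftrightarrow> dpart unit_ivl P \<and> (\<forall>I\<in>P. good f I)"

lemma unit_bij_id: "unit_bij id"
  by (simp add: unit_bij_def)

lemma unit_bij_comp: "unit_bij f \<Longrightarrow> unit_bij g \<Longrightarrow> unit_bij (g \<circ> f)"
  unfolding unit_bij_def by (metis bij_comp image_comp)

lemma unit_bij_inv: "unit_bij f \<Longrightarrow> unit_bij (inv f)"
  unfolding unit_bij_def by (metis bij_imp_bij_inv bij_is_inj inv_f_f image_inv_f_f)

lemma unit_subnode_bounds:
  "subnode unit_ivl I \<Longrightarrow> 0 \<le> fst I \<and> fst I < snd I \<and> snd I \<le> 1"
  using subnode_bounds[of unit_ivl I] by simp

lemma goodI: "subnode unit_ivl I \<Longrightarrow> subnode unit_ivl J \<Longrightarrow> affine_onto f I J \<Longrightarrow> good f I"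
  unfolding good_def by blast

lemma good_subnode: "good f I \<Longrightarrow> subnode I I' \<Longrightarrow> good f I'"
  unfolding good_def
  by (meson affine_onto_subnode subnode_trans unit_subnode_bounds)

text \<open>Since the map is a bijection of the unit interval, the images of the parts again form a
  partition.\<close>

lemma good_part_image:
  assumes f: "unit_bij f" and P: "good_part f P"
  obtains Q where "dpart unit_ivl Q" "card Q = card P"
    "\<And>I. I \<in> P \<Longrightarrow> \<exists>J\<in>Q. affine_onto f I J"
    "\<And>J. J \<in> Q \<Longrightarrow> \<exists>I\<in>P. affine_onto f I J"
proof -
  have inj: "inj f" and im: "f ` {0..<1} = {0..<1}"
    using f by (auto simp: unit_bij_def bij_is_inj)
  define h where "h I = (SOME J. subnode unit_ivl J \<and> affine_onto f I J)" for I
  have h: "subnode unit_ivl (h I) \<and> affine_onto f I (h I)" if "I \<in> P" for I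
    using P that unfolding good_part_def good_def h_def by (metis (no_types, lifting) someI_ex)
  have dP: "dpart unit_ivl P" using P by (simp add: good_part_def)
  have b: "fst I < snd I" if "I \<in> P" for I
    using dpart_subnode[OF dP that] unit_subnode_bounds by blast
  have img: "f ` ico I = ico (h I)" if "I \<in> P" for I
    using affine_onto_image[of f I "h I"] h[OF that] b[OF that] unit_subnode_bounds by blast
  have eq: "I = I'" if I: "I \<in> P" "I' \<in> P" and x: "x \<in> ico (h I)" "x \<in> ico (h I')" for I I' x
  proof -
    obtain y y' where "y \<in> ico I" "f y = x" "y' \<in> ico I'" "f y' = x"
      using x img[OF I(1)] img[OF I(2)] by (metis imageE)
    moreover from this have "y = y'" using inj by (auto dest: injD)
    ultimately show ?thesis using dpart_eqI[OF dP _ I] by simp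
  qed
  have "inj_on h P"
  proof
    fix I I' assume I: "I \<in> P" "I' \<in> P" and "h I = h I'"
    moreover have "fst (h I) \<in> ico (h I)" using h[OF I(1)] unit_subnode_bounds by auto
    ultimately show "I = I'" using eq[OF I, of "fst (h I)"] by simp
  qed
  then have card: "card (h ` P) = card P" by (rule card_image)
  have "dpart unit_ivl (h ` P)"
    unfolding dpart_def
  proof (intro conjI ballI)
    show "finite (h ` P)" using dP by (simp add: dpart_def)
    fix x assume "x \<in> ico unit_ivl"
    then have "x \<in> f ` {0..<1}" using im by simp
    then obtain y where y: "y \<in> {0..<1}" "x = f y" by blast
    obtain I where I: "I \<in> P" "y \<in> ico I" using dpart_cover[OF dP, of y] y by auto
    then have "x \<in> ico (h I)" using img y(2) by blast
    then show "\<exists>!J. J \<in> h ` P \<and> x \<in> ico J" using I(1) eq by blast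
  qed (use h in blast)
  from that[OF this card] show ?thesis using h by blast
qed

text \<open>The image partition, read backwards.\<close>

lemma good_part_inv:
  assumes f: "unit_bij f" and P: "good_part f P"
  obtains Q where "good_part (inv f) Q" "card Q = card P"
proof -
  obtain Q where Q: "dpart unit_ivl Q" "card Q = card P"
    "\<And>J. J \<in> Q \<Longrightarrow> \<exists>I\<in>P. affine_onto f I J"
    using good_part_image[OF f P] by metis
  have "good (inv f) J" if J: "J \<in> Q" for J
  proof -
    obtain I where I: "I \<in> P" "affine_onto f I J" using Q(3)[OF J] by blast
    have s: "subnode unit_ivl I" using P I(1) by (auto simp: good_part_def intro: dpart_subnode)
    have "affine_onto (inv f) J I"
      using affine_onto_inv[OF I(2)] unit_subnode_bounds[OF s] f by (simp add: unit_bij_def bij_is_inj)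
    then show ?thesis by (rule goodI[OF dpart_subnode[OF Q(1) J] s])
  qed
  then have "good_part (inv f) Q" using Q(1) unfolding good_part_def by blast
  then show ?thesis using Q(2) that by blast
qed

text \<open>Two standard dyadic intervals that meet are nested. The common refinement takes the smaller
  one of each such pair, so each of its parts already occurs in one of the two partitions.\<close>

lemma dpart_refine:
  assumes P: "dpart K P" and Q: "dpart K Q" and K: "fst K < snd K"
  obtains R where "dpart K R" "card R \<le> card P + card Q"
    "\<And>I. I \<in> R \<Longrightarrow> (\<exists>J\<in>P. subnode J I) \<and> (\<exists>J\<in>Q. subnode J I)"
proof -
  define A where "A = {I \<in> P. \<exists>J\<in>Q. subnode J I}"
  define B where "B = {J \<in> Q. \<exists>I\<in>P. subnode I J}"
  have fin: "finite P" "finite Q" using P Q by (simp_all add: dpart_def)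
  have "card (A \<union> B) \<le> card A + card B" by (rule card_Un_le)
  also have "\<dots> \<le> card P + card Q"
    using fin by (intro add_mono card_mono) (auto simp: A_def B_def)
  finally have card: "card (A \<union> B) \<le> card P + card Q" .
  have sub: "(\<exists>J\<in>P. subnode J I) \<and> (\<exists>J\<in>Q. subnode J I)" if "I \<in> A \<union> B" for I
    using that subnode_refl[of I] unfolding A_def B_def by blast
  have "dpart K (A \<union> B)"
    unfolding dpart_def
  proof (intro conjI ballI)
    show "finite (A \<union> B)" using fin by (simp add: A_def B_def)
    show "subnode K I" if "I \<in> A \<union> B" for I
      using that dpart_subnode[OF P] dpart_subnode[OF Q] unfolding A_def B_def by blast
    fix x assume x: "x \<in> ico K"
    obtain I where I: "I \<in> P" "x \<in> ico I" using dpart_cover[OF P x] .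
    obtain J where J: "J \<in> Q" "x \<in> ico J" using dpart_cover[OF Q x] .
    have sI: "subnode K I" "subnode K J"
      using dpart_subnode[OF P I(1)] dpart_subnode[OF Q J(1)] .
    then have cmp: "subnode I J \<or> subnode J I" using subnode_nested[OF sI K] I J by blast
    have sI': "fst I < snd I" "fst J < snd J"
      using subnode_bounds[OF sI(1) K] subnode_bounds[OF sI(2) K] by auto
    have c: "L = I \<and> subnode J I \<or> L = J \<and> subnode I J" if L: "L \<in> A \<union> B" "x \<in> ico L" for L
    proof (cases "L \<in> A")
      case True
      then obtain J' where J': "L \<in> P" "J' \<in> Q" "subnode J' L" by (auto simp: A_def)
      have "L = I" using dpart_eqI[OF P K J'(1) I(1) L(2) I(2)] .
      moreover have "x \<in> ico J'"
        using subnode_subset[OF J'(3)] subnode_bounds[OF dpart_subnode[OF Q J'(2)] K] L(2) by blast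
      then have "J' = J" using dpart_eqI[OF Q K J'(2) J(1) _ J(2)] by blast
      ultimately show ?thesis using J'(3) by blast
    next
      case False
      then obtain I' where I': "L \<in> Q" "I' \<in> P" "subnode I' L" using L by (auto simp: B_def)
      have "L = J" using dpart_eqI[OF Q K I'(1) J(1) L(2) J(2)] .
      moreover have "x \<in> ico I'"
        using subnode_subset[OF I'(3)] subnode_bounds[OF dpart_subnode[OF P I'(2)] K] L(2) by blast
      then have "I' = I" using dpart_eqI[OF P K I'(2) I(1) _ I(2)] by blast
      ultimately show ?thesis using I'(3) by blast
    qed
    have ex: "\<exists>L. L \<in> A \<union> B \<and> x \<in> ico L"
      using cmp I J unfolding A_def B_def by blast
    have uniq: "L = L'" if "L \<in> A \<union> B \<and> x \<in> ico L" "L' \<in> A \<union> B \<and> x \<in> ico L'" for L L'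
      using c[of L] c[of L'] that subnode_antisym[of I J] sI' by blast
    show "\<exists>!L. L \<in> A \<union> B \<and> x \<in> ico L" using ex uniq by blast
  qed
  from that[OF this card sub] show ?thesis .
qed

text \<open>The parts for g are refined against the images of the parts for f, and the result is pulled
  back along f. This subadditivity is the source of the lower bound for word length.\<close>

lemma good_part_comp:
  assumes f: "unit_bij f" and P: "good_part f P" and Q: "good_part g Q"
  obtains R where "good_part (g \<circ> f) R" "card R \<le> card P + card Q"
proof -
  obtain P' where P': "dpart unit_ivl P'" "card P' = card P"
    "\<And>J. J \<in> P' \<Longrightarrow> \<exists>I\<in>P. affine_onto f I J"
    using good_part_image[OF f P] by metis
  have Q': "dpart unit_ivl Q" using Q by (simp add: good_part_def)
  have inj: "inj f" and bij: "bij f" using f by (simp_all add: unit_bij_def bij_is_inj)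
  obtain R where R: "dpart unit_ivl R" "card R \<le> card P' + card Q"
    "\<And>I. I \<in> R \<Longrightarrow> (\<exists>J\<in>P'. subnode J I) \<and> (\<exists>J\<in>Q. subnode J I)"
    using dpart_refine[OF P'(1) Q'] by auto
  have gR: "good g K" if "K \<in> R" for K
    using R(3)[OF that] Q good_subnode unfolding good_part_def by blast
  have "good (inv f) K" if K: "K \<in> R" for K
  proof -
    obtain J where J: "J \<in> P'" "subnode J K" using R(3)[OF K] by blast
    obtain I where I: "I \<in> P" "affine_onto f I J" using P'(3)[OF J(1)] by blast
    have s: "subnode unit_ivl I" using P I(1) by (auto simp: good_part_def intro: dpart_subnode)
    have "good (inv f) J"
      using affine_onto_inv[OF I(2) _ inj] unit_subnode_bounds[OF s]
      by (intro goodI[OF dpart_subnode[OF P'(1) J(1)] s]) simp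
    then show ?thesis using J(2) by (rule good_subnode)
  qed
  then have "good_part (inv f) R" using R(1) by (simp add: good_part_def)
  then obtain S where S: "dpart unit_ivl S" "card S = card R"
    "\<And>I. I \<in> S \<Longrightarrow> \<exists>K\<in>R. affine_onto (inv f) K I"
    using good_part_image[OF unit_bij_inv[OF f]] by metis
  have "good (g \<circ> f) I" if I: "I \<in> S" for I
  proof -
    obtain K where K: "K \<in> R" "affine_onto (inv f) K I" using S(3)[OF I] by blast
    have Kb: "fst K < snd K" using unit_subnode_bounds[OF dpart_subnode[OF R(1) K(1)]] by simp
    have "affine_onto (inv (inv f)) I K"
      by (rule affine_onto_inv[OF K(2) Kb]) (use bij in \<open>simp add: bij_imp_bij_inv bij_is_inj\<close>)
    then have fK: "affine_onto f I K" using bij by (simp add: inv_inv_eq)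
    obtain L where L: "subnode unit_ivl L" "affine_onto g K L"
      using gR[OF K(1)] by (auto simp: good_def)
    show ?thesis
      by (rule goodI[OF dpart_subnode[OF S(1) I] L(1) affine_onto_comp[OF fK L(2) Kb]])
  qed
  then have "good_part (g \<circ> f) S" using S(1) by (simp add: good_part_def)
  moreover have "card S \<le> card P + card Q" using S(2) R(2) P'(2) by simp
  ultimately show ?thesis using that by blast
qed

lemma good_part_id: "good_part id {unit_ivl}"
  by (auto simp: good_part_def dpart_def intro: subnode_refl
      intro!: goodI[OF subnode_refl subnode_refl] affine_onto_id)


section \<open>Tree pair diagrams\<close>

lemma represents_iff:
  "represents (S, T, m) g \<longleftrightarrow> (\<forall>k < num_leaves S.
     affine_onto g (leaves S 0 1 ! k) (leaves T 0 1 ! ((k + m) mod num_leaves T)))"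
  by (simp add: represents_def affine_onto_def Let_def case_prod_beta)

lemma mod_shift: "k < n \<Longrightarrow> m < n \<Longrightarrow> (k + m) mod n = (if k + m < n then k + m else k + m - n)"
  for k m n :: nat
  by (auto simp: mod_if)

lemma mod_shift_inject:
  "k < n \<Longrightarrow> k' < n \<Longrightarrow> m < n \<Longrightarrow> (k + m) mod n = (k' + m) mod n \<Longrightarrow> k = k'"
  for k m n :: nat
  by (auto simp: mod_shift split: if_splits)

lemma mod_shift_surj:
  assumes "j < n" "m < n"
  shows "\<exists>k<n. (k + m) mod n = (j::nat)"
proof (cases "m \<le> j")
  case True
  then show ?thesis using assms by (intro exI[of _ "j - m"]) auto
next
  case False
  then show ?thesis using assms by (intro exI[of _ "n + j - m"]) auto
qed

lemma nth_leaves_subnode: "k < num_leaves t \<Longrightarrow> subnode (a, b) (leaves t a b ! k)"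
  by (rule leaves_subnode, rule nth_mem) (simp add: length_leaves_num)

lemma nth_leaves_bounds:
  "k < num_leaves t \<Longrightarrow> fst (leaves t 0 1 ! k) < snd (leaves t 0 1 ! k)"
  using unit_subnode_bounds[OF nth_leaves_subnode] by blast

lemma nth_leaves_cover:
  assumes "x \<in> {0..<1}"
  obtains k where "k < num_leaves t" "x \<in> ico (leaves t 0 1 ! k)"
  using leaves_cover[OF assms, of t] by (metis in_set_conv_nth length_leaves_num)

lemma nth_leaves_eqI:
  assumes "k < num_leaves t" "k' < num_leaves t"
    "x \<in> ico (leaves t 0 1 ! k)" "x \<in> ico (leaves t 0 1 ! k')"
  shows "k = k'"
proof -
  have "leaves t 0 1 ! k = leaves t 0 1 ! k'"
    using leaves_disjoint[of 0 1 _ t, OF _ nth_mem nth_mem] assms by (simp add: length_leaves_num)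
  then show ?thesis using assms distinct_leaves[of 0 1 t]
    by (simp add: nth_eq_iff_index_eq length_leaves_num)
qed

lemma good_part_of_diagram:
  assumes "represents (S, T, m) w" "tree_pair (S, T, m)"
  shows "good_part w (set (leaves S 0 1))"
proof -
  have "good w (leaves S 0 1 ! k)" if "k < num_leaves S" for k
    using that assms
    by (intro goodI[of _ "leaves T 0 1 ! ((k + m) mod num_leaves T)"] nth_leaves_subnode)
      (auto simp: represents_iff)
  then have "\<forall>I\<in>set (leaves S 0 1). good w I"
    by (metis in_set_conv_nth length_leaves_num)
  then show ?thesis using dpart_leaves[of 0 1 S] by (simp add: good_part_def)
qed

text \<open>The leaves of the source tree are permuted onto those of the target tree by a rotation, and each
  is mapped bijectively.\<close>

lemma unit_bij_of_diagram:
  assumes r: "represents (S, T, m) w" and tp: "tree_pair (S, T, m)"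
    and off: "\<And>t. t \<notin> {0..<1} \<Longrightarrow> w t = t"
  shows "unit_bij w"
proof -
  define n where "n = num_leaves T"
  have n: "num_leaves S = n" "m < n" using tp by (auto simp: tree_pair_def n_def)
  have img: "w ` ico (leaves S 0 1 ! k) = ico (leaves T 0 1 ! ((k + m) mod n))" if "k < n" for k
    using that r n by (intro affine_onto_image nth_leaves_bounds)
      (auto simp: represents_iff n_def)
  have sub: "ico (leaves t 0 1 ! k) \<subseteq> {0..<1}" if "k < num_leaves t" for t k
    using unit_subnode_bounds[OF nth_leaves_subnode[OF that]] by auto
  have lt: "(k + m) mod n < num_leaves T" for k using n by (simp add: n_def)
  have into: "w x \<in> {0..<1}" if x: "x \<in> {0..<1}" for x
  proof -
    obtain k where k: "k < num_leaves S" "x \<in> ico (leaves S 0 1 ! k)"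
      using nth_leaves_cover[OF x] .
    then have "w x \<in> ico (leaves T 0 1 ! ((k + m) mod n))" using img n by blast
    then show ?thesis using sub[OF lt] by blast
  qed
  have onto: "y \<in> w ` {0..<1}" if y: "y \<in> {0..<1}" for y
  proof -
    obtain j where j: "j < num_leaves T" "y \<in> ico (leaves T 0 1 ! j)"
      using nth_leaves_cover[OF y] .
    obtain k where k: "k < n" "(k + m) mod n = j"
      using mod_shift_surj[of j n m] j n by (auto simp: n_def)
    then have "y \<in> w ` ico (leaves S 0 1 ! k)" using img[OF k(1)] j by simp
    then show ?thesis using sub[of k S] k n by blast
  qed
  have inj: "x = x'" if x: "x \<in> {0..<1}" "x' \<in> {0..<1}" "w x = w x'" for x x'
  proof -
    obtain k where k: "k < num_leaves S" "x \<in> ico (leaves S 0 1 ! k)"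
      using nth_leaves_cover[OF x(1)] .
    obtain k' where k': "k' < num_leaves S" "x' \<in> ico (leaves S 0 1 ! k')"
      using nth_leaves_cover[OF x(2)] .
    have "w x \<in> ico (leaves T 0 1 ! ((k + m) mod n))" "w x \<in> ico (leaves T 0 1 ! ((k' + m) mod n))"
      using img k k' n x(3) by (metis imageI)+
    then have "(k + m) mod n = (k' + m) mod n" using nth_leaves_eqI[OF lt lt] by blast
    then have "k = k'" using mod_shift_inject[of k n k' m] k k' n by simp
    define I J where "I = leaves S 0 1 ! k" and "J = leaves T 0 1 ! ((k + m) mod n)"
    have a: "affine_onto w I J" using r k by (simp add: represents_iff I_def J_def n_def)
    have b: "fst I < snd I" "fst J < snd J"
      using nth_leaves_bounds[OF k(1)] nth_leaves_bounds[OF lt] by (auto simp: I_def J_def)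
    have "x \<in> ico I" "x' \<in> ico I" using k k' \<open>k = k'\<close> by (simp_all add: I_def)
    from this[THEN affine_ontoD[OF a]] x(3)
    have "(x - fst I) * (snd J - fst J) / (snd I - fst I)
        = (x' - fst I) * (snd J - fst J) / (snd I - fst I)" by linarith
    then have "(x - fst I) * (snd J - fst J) = (x' - fst I) * (snd J - fst J)"
      using b by (simp only: divide_cancel_right) auto
    then show ?thesis using b by (simp only: mult_cancel_right) auto
  qed
  have "inj w"
  proof
    fix x x' assume eq: "w x = w x'"
    show "x = x'"
      by (cases "x \<in> {0..<1}"; cases "x' \<in> {0..<1}") (use eq inj into off in metis)+
  qed
  moreover have "surj w" unfolding surj_def using onto off by (metis imageE)
  moreover have "w ` {0..<1} = {0..<1}" using into onto by blast
  ultimately show ?thesis by (simp add: unit_bij_def bij_def)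
qed

lemma represents_unique:
  assumes "represents (S, T, m) v" "represents (S, T, m) w"
    and "\<And>t. t \<notin> {0..<1} \<Longrightarrow> v t = t" "\<And>t. t \<notin> {0..<1} \<Longrightarrow> w t = t"
  shows "v = w"
proof
  fix t show "v t = w t"
  proof (cases "t \<in> {0..<1}")
    case True
    then obtain k where k: "k < num_leaves S" "t \<in> ico (leaves S 0 1 ! k)"
      using nth_leaves_cover by blast
    then show ?thesis
      using assms(1,2) affine_ontoD[OF _ k(2)] by (metis represents_iff)
  qed (simp add: assms)
qed

lemma represents_comp:
  assumes "represents (S, T, m) f" "represents (T, U, m') g"
    "tree_pair (S, T, m)" "tree_pair (T, U, m')"
  shows "represents (S, U, (m + m') mod num_leaves U) (g \<circ> f)"
  unfolding represents_iff
proof (intro allI impI)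
  fix k assume k: "k < num_leaves S"
  define n where "n = num_leaves U"
  have n: "num_leaves S = n" "num_leaves T = n" "m < n" "m' < n"
    using assms(3,4) by (auto simp: tree_pair_def n_def)
  have "affine_onto f (leaves S 0 1 ! k) (leaves T 0 1 ! ((k + m) mod n))"
    using assms(1) k n by (simp add: represents_iff)
  moreover have "affine_onto g (leaves T 0 1 ! ((k + m) mod n))
      (leaves U 0 1 ! (((k + m) mod n + m') mod n))"
    using assms(2) n by (simp add: represents_iff n_def)
  moreover have "((k + m) mod n + m') mod n = (k + (m + m') mod n) mod n"
    by (simp add: mod_simps add.assoc)
  ultimately show "affine_onto (g \<circ> f) (leaves S 0 1 ! k)
      (leaves U 0 1 ! ((k + (m + m') mod num_leaves U) mod num_leaves U))"
    using affine_onto_comp[OF _ _ nth_leaves_bounds[of "(k + m) mod n" T]] n by (simp add: n_def)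
qed

lemma represents_inv:
  assumes "represents (S, T, 0) f" "tree_pair (S, T, 0)" "inj f"
  shows "represents (T, S, 0) (inv f)"
  using assms nth_leaves_bounds[of _ S] by (auto simp: represents_iff tree_pair_def intro!: affine_onto_inv)

section \<open>Continuity on the circle\<close>

lemma cis_2pi_eq_iff: "cis (2 * pi * x) = cis (2 * pi * y) \<longleftrightarrow> frac x = frac y"
proof -
  have "cis (2 * pi * x) = cis (2 * pi * y) \<longleftrightarrow>
      (\<exists>n::int. 2 * pi * x = 2 * pi * y + 2 * pi * of_int n)"
    unfolding sin_cos_eq_iff[symmetric] by (auto simp: complex_eq_iff)
  also have "\<dots> \<longleftrightarrow> (\<exists>n::int. x = y + of_int n)"
    by (simp add: distrib_left[symmetric])
  also have "\<dots> \<longleftrightarrow> frac x = frac y"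
  proof
    assume "frac x = frac y"
    then have "x = y + of_int (\<lfloor>x\<rfloor> - \<lfloor>y\<rfloor>)" by (simp add: frac_def)
    then show "\<exists>n::int. x = y + of_int n" by blast
  qed (auto simp: frac_def)
  finally show ?thesis .
qed

text \<open>The embedding of the circle into the complex plane by \<open>cis (2 * pi * t)\<close> turns continuity in
  the quotient topology into ordinary continuity on [0,1]. Hence an equation modulo 1 that
  holds inside an interval extends to its end points. This is how continuity enters the proof.\<close>

lemma thompson_frac_eq:
  assumes w: "w \<in> thompson_T" and ab: "0 \<le> a" "a < b" "b \<le> 1"
    and l: "continuous_on {a..b} l" "\<And>t. t \<in> {a<..<b} \<Longrightarrow> w t = frac (l t)"
    and x: "x \<in> {a..b}"
  shows "frac (w (frac x)) = frac (l x)"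
proof -
  let ?e = "\<lambda>t::real. cis (2 * pi * t)"
  have "?e \<circ> frac = ?e" by (auto simp: cis_2pi_eq_iff)
  then have "continuous_map (top_of_set {0..1}) euclidean (?e \<circ> frac)"
    by (auto intro!: continuous_intros)
  then have e: "continuous_map circle euclidean ?e"
    by (rule continuous_compose_quotient_map[OF quotient_map_circle])
  have "continuous_map circle circle w"
    using w by (simp add: thompson_T_def homeomorphic_imp_continuous_map)
  from continuous_map_compose[OF this e]
  have "continuous_map (top_of_set {0..1}) euclidean ((?e \<circ> w) \<circ> frac)"
    by (rule continuous_map_compose[OF quotient_imp_continuous_map[OF quotient_map_circle]])
  then have c: "continuous_on {a..b} (\<lambda>t. ?e (w (frac t)) - ?e (l t))"
  proof (intro continuous_on_diff)
    show "continuous_on {a..b} (\<lambda>t. ?e (w (frac t)))"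
      by (rule continuous_on_subset[of "{0..1}"])
        (use \<open>continuous_map (top_of_set {0..1}) euclidean ((?e \<circ> w) \<circ> frac)\<close> ab
          in \<open>auto simp: o_def\<close>)
    show "continuous_on {a..b} (\<lambda>t. ?e (l t))" using l(1) by (intro continuous_intros)
  qed
  have "?e (w (frac x)) - ?e (l x) = 0"
  proof (rule continuous_constant_on_closure[of "{a<..<b}" "\<lambda>t. ?e (w (frac t)) - ?e (l t)"])
    fix t assume t: "t \<in> {a<..<b}"
    then have "frac t = t" using ab by (simp add: frac_eq)
    then show "?e (w (frac t)) - ?e (l t) = 0" using l(2)[OF t] by (simp add: cis_2pi_eq_iff)
  qed (use c x ab in auto)
  then show ?thesis by (simp add: cis_2pi_eq_iff)
qed

lemma thompson_unit_bij:
  assumes "w \<in> thompson_T"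
  shows "unit_bij w"
proof -
  have off: "w t = t" if "t \<notin> {0..<1}" for t using assms that by (auto simp: thompson_T_def)
  have "homeomorphic_map circle circle w" using assms by (simp add: thompson_T_def)
  then have "bij_betw w {0..<1} {0..<1}"
    using homeomorphic_imp_injective_map[of circle circle w]
      homeomorphic_imp_surjective_map[of circle circle w]
    by (simp add: topspace_circle bij_betw_def)
  moreover from off have "bij_betw w (- {0..<1}) (- {0..<1})"
    using bij_betw_cong[of "- {0..<1}" w id "- {0..<1}"] by simp
  ultimately have "bij_betw w ({0..<1} \<union> - {0..<1}) ({0..<1} \<union> - {0..<1})"
    by (rule bij_betw_combine) simp
  then show ?thesis using \<open>bij_betw w {0..<1} {0..<1}\<close>
    by (simp add: unit_bij_def bij_betw_def)
qed

text \<open>The partition and its image are the leaf sets of two trees. By continuity the image of a leaf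
  begins, modulo 1, where the image of the preceding leaf ends, so the leaves are matched by a
  rotation.\<close>

lemma diagram_of_good_part:
  assumes w: "w \<in> thompson_T" and P: "good_part w P"
  obtains S T m where "tree_pair (S, T, m)" "represents (S, T, m) w" "set (leaves S 0 1) = P"
proof -
  obtain Q where Q: "dpart unit_ivl Q" "card Q = card P"
    "\<And>I. I \<in> P \<Longrightarrow> \<exists>J\<in>Q. affine_onto w I J"
    using good_part_image[OF thompson_unit_bij[OF w] P] by metis
  obtain S where S: "set (leaves S 0 1) = P"
    using tree_of_dpart[of 0 1 P] P by (auto simp: good_part_def)
  obtain T where T: "set (leaves T 0 1) = Q"
    using tree_of_dpart[of 0 1 Q] Q by auto
  define n where "n = num_leaves T"
  have n: "num_leaves S = n" using card_leaves[of S] card_leaves[of T] S T Q(2) by (simp add: n_def)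
  have "\<exists>j<n. affine_onto w (leaves S 0 1 ! k) (leaves T 0 1 ! j)" if k: "k < n" for k
  proof -
    have "leaves S 0 1 ! k \<in> P" using k n S length_leaves_num nth_mem by metis
    from Q(3)[OF this] T show ?thesis by (metis in_set_conv_nth length_leaves_num n_def)
  qed
  then obtain s where s: "\<And>k. k < n \<Longrightarrow> s k < n"
    "\<And>k. k < n \<Longrightarrow> affine_onto w (leaves S 0 1 ! k) (leaves T 0 1 ! s k)"
    by metis
  have npos: "0 < n" by (simp add: n_def)
  have T0: "fst (leaves T 0 1 ! 0) = 0" using fst_hd_leaves[of T 0 1] by (simp add: hd_conv_nth)
  have T1: "snd (leaves T 0 1 ! (n - 1)) = 1"
    using snd_last_leaves[of T 0 1] by (simp add: last_conv_nth length_leaves_num n_def)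
  \<comment> \<open>A leaf is determined by its left end, so it suffices to compare left ends.\<close>
  have step: "s (Suc k) = (s k + 1) mod n" if k: "Suc k < n" for k
  proof -
    obtain a b where I: "leaves S 0 1 ! k = (a, b)" by fastforce
    obtain c d where J: "leaves T 0 1 ! s k = (c, d)" by fastforce
    have kn: "k < n" using k by simp
    have Ib: "0 \<le> a" "a < b" "b \<le> 1"
      using unit_subnode_bounds[OF nth_leaves_subnode[of k S]] kn n I by auto
    have Jb: "0 \<le> c" "c < d" "d \<le> 1"
      using unit_subnode_bounds[OF nth_leaves_subnode[of "s k" T]] s(1)[OF kn] J by (auto simp: n_def)
    have aff: "affine_onto w (a, b) (c, d)" using s(2)[OF kn] I J by simp
    define l where "l t = c + (t - a) * (d - c) / (b - a)" for t
    have "w t = frac (l t)" if "t \<in> {a<..<b}" for t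
    proof -
      have t: "t \<in> ico (a, b)" using that by auto
      have "w t = l t" using affine_ontoD[OF aff t] by (simp add: l_def)
      moreover have "w t \<in> {0..<1}" using affine_onto_mem[OF aff _ t] Jb by auto
      ultimately show ?thesis by (simp add: frac_eq)
    qed
    moreover have "continuous_on {a..b} l" unfolding l_def using Ib by (intro continuous_intros) auto
    ultimately have "frac (w (frac b)) = frac (l b)"
      using thompson_frac_eq[OF w Ib] Ib by auto
    moreover have "l b = d" using Ib by (simp add: l_def)
    moreover have b: "b = fst (leaves S 0 1 ! Suc k)"
      using leaves_consecutive[of k S 0 1] k n I by simp
    have "b < 1" using unit_subnode_bounds[OF nth_leaves_subnode[of "Suc k" S]] k n b by auto
    then have "frac b = b" using Ib by (simp add: frac_eq)
    moreover have "w b = fst (leaves T 0 1 ! s (Suc k))"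
      using affine_ontoD[OF s(2)[OF k], of b] nth_leaves_bounds[of "Suc k" S] k n b by simp
    moreover have fr: "frac (fst (leaves T 0 1 ! j)) = fst (leaves T 0 1 ! j)" if "j < n" for j
      using unit_subnode_bounds[OF nth_leaves_subnode[of j T]] that
      by (auto simp: frac_eq n_def)
    ultimately have d: "fst (leaves T 0 1 ! s (Suc k)) = frac d"
      using fr[OF s(1)[OF k]] by simp
    have "frac d = fst (leaves T 0 1 ! ((s k + 1) mod n))"
    proof (cases "s k + 1 < n")
      case True
      then have "d = fst (leaves T 0 1 ! (s k + 1))"
        using leaves_consecutive[of "s k" T 0 1] J by (simp add: n_def)
      then show ?thesis using fr[OF True] True by simp
    next
      case False
      then have "s k + 1 = n" using s(1)[OF kn] by simp
      then show ?thesis using T1 J T0 by (metis add_diff_cancel_right' frac_1_eq frac_of_int mod_self of_int_1 snd_conv)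
    qed
    with d have eq: "fst (leaves T 0 1 ! s (Suc k)) = fst (leaves T 0 1 ! ((s k + 1) mod n))"
      by simp
    have lt: "s (Suc k) < num_leaves T" "(s k + 1) mod n < num_leaves T"
      using s(1)[OF k] npos by (auto simp: n_def)
    show ?thesis
      by (rule nth_leaves_eqI[OF lt, of "fst (leaves T 0 1 ! s (Suc k))"])
        (use eq nth_leaves_bounds[OF lt(1)] nth_leaves_bounds[OF lt(2)] in auto)
  qed
  have s_eq: "s k = (k + s 0) mod n" if "k < n" for k
    using that
  proof (induction k)
    case 0
    then show ?case using s(1)[OF npos] by simp
  next
    case (Suc k)
    then show ?case using step[of k] by (simp add: mod_simps)
  qed
  have "represents (S, T, s 0) w"
    unfolding represents_iff
  proof (intro allI impI)
    fix k assume "k < num_leaves S"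
    then show "affine_onto w (leaves S 0 1 ! k) (leaves T 0 1 ! ((k + s 0) mod num_leaves T))"
      using s(2)[of k] s_eq[of k] n by (simp add: n_def)
  qed
  moreover have "tree_pair (S, T, s 0)" using n s(1)[OF npos] by (simp add: tree_pair_def n_def)
  ultimately show ?thesis using that S by blast
qed


section \<open>Reduced diagrams\<close>

text \<open>If a leaf of the source tree lay strictly inside a good interval, an exposed caret below that
  interval would be carried affinely onto a node of the target tree with two leaves below it,
  and the diagram could be reduced. So the leaves are exactly the maximal good intervals, which
  depend only on the map.\<close>

lemma reduced_leaves:
  assumes tp: "tree_pair (S, T, m)" and red: "reduced (S, T, m)" and rep: "represents (S, T, m) w"
  shows "set (leaves S 0 1) = {I. good w I \<and> (\<forall>J. good w J \<and> subnode J I \<longrightarrow> J = I)}"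
proof -
  define n where "n = num_leaves T"
  have n: "num_leaves S = n" "m < n" using tp by (auto simp: tree_pair_def n_def)
  have gp: "good_part w (set (leaves S 0 1))" by (rule good_part_of_diagram[OF rep tp])
  have max: "J = I" if I: "I \<in> set (leaves S 0 1)" and J: "good w J" "subnode J I" for I J
  proof (rule ccontr)
    assume "J \<noteq> I"
    then obtain k u v where k: "exposed_at S 0 1 k u v" "subnode J (u, v)"
      using exposed_below[of 0 1 J I S] I J by (auto simp: good_def)
    have kn: "Suc k < n" using k(1) n by (simp add: exposed_at_def)
    have "good w (u, v)" using good_subnode[OF J(1) k(2)] .
    then obtain c d where cd: "subnode unit_ivl (c, d)" "affine_onto w (u, v) (c, d)"
      and uv: "subnode unit_ivl (u, v)"
      unfolding good_def by auto
    have b: "u < v" "c < d" using unit_subnode_bounds[OF uv] unit_subnode_bounds[OF cd(1)] by auto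
    note h = affine_onto_halves[OF cd(2) b(1)]
    have S: "leaves S 0 1 ! k = (u, (u + v) / 2)" "leaves S 0 1 ! Suc k = ((u + v) / 2, v)"
      using k(1) by (simp_all add: exposed_at_def)
    have "affine_onto w (u, (u + v) / 2) (leaves T 0 1 ! ((k + m) mod n))"
      "affine_onto w ((u + v) / 2, v) (leaves T 0 1 ! ((Suc k + m) mod n))"
      using rep kn n S unfolding represents_iff n_def by (metis Suc_lessD)+
    then have T: "leaves T 0 1 ! ((k + m) mod n) = (c, (c + d) / 2)"
      "leaves T 0 1 ! ((Suc k + m) mod n) = ((c + d) / 2, d)"
      using affine_onto_unique[OF _ h(1)] affine_onto_unique[OF _ h(2)] b by simp_all
    have lt: "(k + m) mod n < n" "(Suc k + m) mod n < n" using n by auto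
    have "((c + d) / 2, d) \<in> set (leaves T 0 1)"
      using T(2) lt(2) by (metis length_leaves_num n_def nth_mem)
    then have "(k + m) mod n \<in> exposed T"
      using exposed_of_halves[OF cd(1)] T(1) lt(1) by (simp add: n_def)
    then show False using red k(1) by (auto simp: reduced_def exposed_at_def n_def)
  qed
  have leafI: "I \<in> set (leaves S 0 1)"
    if I: "good w I" "\<forall>J. good w J \<and> subnode J I \<longrightarrow> J = I" for I
  proof -
    have sI: "subnode unit_ivl I" using I by (simp add: good_def)
    note b = unit_subnode_bounds[OF sI]
    then obtain L where L: "L \<in> set (leaves S 0 1)" "fst I \<in> ico L"
      using leaves_cover[of "fst I" 0 1 S] by auto
    have gL: "good w L" using gp L(1) by (simp add: good_part_def)
    have "subnode I L \<or> subnode L I"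
      using subnode_nested[OF sI, of L] gL L(2) b by (auto simp: good_def)
    then have "L = I" using I max[OF L(1)] gL by blast
    then show ?thesis using L(1) by simp
  qed
  show ?thesis
  proof (intro set_eqI iffI CollectI conjI allI impI)
    fix I assume I: "I \<in> set (leaves S 0 1)"
    show "good w I" using gp I by (simp add: good_part_def)
    show "J = I" if "good w J \<and> subnode J I" for J using max[OF I] that by blast
  qed (use leafI in blast)
qed

text \<open>The maximal good intervals determine the source tree, their images the target tree, and the
  image of the first leaf the mark.\<close>

lemma reduced_unique:
  assumes d: "tree_pair (S, T, m)" "reduced (S, T, m)" "represents (S, T, m) w"
    and d': "tree_pair (S', T', m')" "reduced (S', T', m')" "represents (S', T', m') w"
  shows "(S, T, m) = (S', T', m')"
proof -
  have S: "S = S'"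
    by (rule leaves_inject[of _ 0 1]) (simp_all add: reduced_leaves[OF d] reduced_leaves[OF d'])
  define n where "n = num_leaves S"
  have n: "num_leaves T = n" "num_leaves T' = n" "m < n" "m' < n"
    using d(1) d'(1) S by (auto simp: tree_pair_def n_def)
  have eq: "leaves T 0 1 ! ((k + m) mod n) = leaves T' 0 1 ! ((k + m') mod n)" if "k < n" for k
    by (rule affine_onto_unique[of w "leaves S 0 1 ! k"])
      (use that d(3) d'(3) n nth_leaves_bounds[of k S] S in \<open>auto simp: represents_iff n_def\<close>)
  have T: "T = T'"
  proof (rule leaves_inject[of _ 0 1])
    have "set (leaves T 0 1) \<subseteq> set (leaves T' 0 1)"
    proof
      fix J assume "J \<in> set (leaves T 0 1)"
      then obtain j where j: "j < n" "J = leaves T 0 1 ! j"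
        using n by (metis in_set_conv_nth length_leaves_num)
      then obtain k where k: "k < n" "(k + m) mod n = j" using mod_shift_surj n by blast
      then have "J = leaves T' 0 1 ! ((k + m') mod n)" using eq j by metis
      moreover have "(k + m') mod n < n" using j by simp
      ultimately show "J \<in> set (leaves T' 0 1)" using n by (metis length_leaves_num nth_mem)
    qed
    then show "set (leaves T 0 1) = set (leaves T' 0 1)"
      by (intro dpart_subset_eq[of unit_ivl] dpart_leaves) auto
  qed simp
  have "leaves T 0 1 ! m = leaves T 0 1 ! m'" using eq[of 0] n T by simp
  then have "m = m'" using distinct_leaves[of 0 1 T] n
    by (simp add: nth_eq_iff_index_eq length_leaves_num)
  then show ?thesis using S T by simp
qed

lemma dpart_merge:
  assumes P: "dpart K P" and K: "subnode K (u, v)" "fst K < snd K"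
    and h: "(u, (u + v) / 2) \<in> P" "((u + v) / 2, v) \<in> P"
  shows "dpart K (insert (u, v) (P - {(u, (u + v) / 2), ((u + v) / 2, v)}))" (is "dpart K ?Q")
    and "card (insert (u, v) (P - {(u, (u + v) / 2), ((u + v) / 2, v)})) < card P"
proof -
  have fin: "finite P" using P by (simp add: dpart_def)
  have uv: "u < v" using subnode_bounds[OF K] by simp
  have "card (insert (u, v) (P - {(u, (u + v) / 2), ((u + v) / 2, v)})) \<le>
      Suc (card (P - {(u, (u + v) / 2), ((u + v) / 2, v)}))"
    by (rule card_insert_le_m1) (use fin in auto)
  also have "\<dots> < card P"
  proof -
    have "card {(u, (u + v) / 2), ((u + v) / 2, v)} = 2" using uv by auto
    moreover have "{(u, (u + v) / 2), ((u + v) / 2, v)} \<subseteq> P" using h by simp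
    ultimately show ?thesis
      using card_mono[OF fin, of "{(u, (u + v) / 2), ((u + v) / 2, v)}"]
        card_Diff_subset[of "{(u, (u + v) / 2), ((u + v) / 2, v)}" P] by simp
  qed
  finally show "card (insert (u, v) (P - {(u, (u + v) / 2), ((u + v) / 2, v)})) < card P" .
  show "dpart K ?Q"
    unfolding dpart_def
  proof (intro conjI ballI)
    show "finite ?Q" using fin by simp
    show "subnode K I" if "I \<in> ?Q" for I using that K dpart_subnode[OF P] by blast
    fix x assume x: "x \<in> ico K"
    show "\<exists>!I. I \<in> ?Q \<and> x \<in> ico I"
    proof (cases "x \<in> ico (u, v)")
      case True
      then have "x \<in> ico (u, (u + v) / 2) \<or> x \<in> ico ((u + v) / 2, v)" by auto
      then have "\<not> (I \<in> P - {(u, (u + v) / 2), ((u + v) / 2, v)} \<and> x \<in> ico I)" for I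
        using dpart_eqI[OF P K(2) h(1), of I x] dpart_eqI[OF P K(2) h(2), of I x] by blast
      then show ?thesis using True by blast
    next
      case False
      obtain L where L: "L \<in> P" "x \<in> ico L" using dpart_cover[OF P x] .
      have "L \<noteq> (u, (u + v) / 2)" "L \<noteq> ((u + v) / 2, v)" using False L(2) uv by auto
      then show ?thesis using False L dpart_eqI[OF P K(2) _ L(1) _ L(2)] by blast
    qed
  qed
qed

text \<open>A diagram with the least number of leaves is reduced, because a pair of matching exposed carets
  can be removed from both trees.\<close>

lemma reduced_exists:
  assumes w: "w \<in> thompson_T" and P0: "good_part w P0"
  obtains S T m where "tree_pair (S, T, m)" "reduced (S, T, m)" "represents (S, T, m) w"
    "\<And>P. good_part w P \<Longrightarrow> num_leaves S \<le> card P"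
proof -
  obtain P where P: "good_part w P" "\<And>Q. good_part w Q \<Longrightarrow> card P \<le> card Q"
    using ex_has_least_nat[of "good_part w" P0 card] P0 by blast
  obtain S T m where d: "tree_pair (S, T, m)" "represents (S, T, m) w" "set (leaves S 0 1) = P"
    using diagram_of_good_part[OF w P(1)] .
  define n where "n = num_leaves T"
  have n: "num_leaves S = n" "m < n" using d(1) by (auto simp: tree_pair_def n_def)
  have "reduced (S, T, m)"
  proof (rule ccontr)
    assume "\<not> reduced (S, T, m)"
    then obtain k where k: "k \<in> exposed S" "(k + m) mod n \<in> exposed T"
      by (auto simp: reduced_def n_def)
    obtain u v where uv: "exposed_at S 0 1 k u v" "subnode unit_ivl (u, v)"
      using exposed_atI[OF k(1)] by blast
    obtain c e where ce: "exposed_at T 0 1 ((k + m) mod n) c e" "subnode unit_ivl (c, e)"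
      using exposed_atI[OF k(2)] by blast
    have lt: "Suc k < n" "Suc ((k + m) mod n) < n"
      using uv(1) ce(1) n by (simp_all add: exposed_at_def n_def)
    have suc: "(Suc k + m) mod n = Suc ((k + m) mod n)"
      using lt(2) by (metis add_Suc mod_Suc nat_neq_iff)
    have "affine_onto w (leaves S 0 1 ! k) (leaves T 0 1 ! ((k + m) mod n))"
      "affine_onto w (leaves S 0 1 ! Suc k) (leaves T 0 1 ! ((Suc k + m) mod n))"
      using d(2) lt n unfolding represents_iff n_def by (metis Suc_lessD)+
    then have "affine_onto w (u, (u + v) / 2) (c, (c + e) / 2)"
      "affine_onto w ((u + v) / 2, v) ((c + e) / 2, e)"
      using uv(1) ce(1) unfolding suc exposed_at_def by simp_all
    then have "affine_onto w (u, v) (c, e)"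
      by (rule affine_onto_join) (use unit_subnode_bounds[OF uv(2)] in simp)
    then have g: "good w (u, v)" by (rule goodI[OF uv(2) ce(2)])
    have "leaves S 0 1 ! k \<in> P" "leaves S 0 1 ! Suc k \<in> P"
      using d(3) lt n by (metis Suc_lessD length_leaves_num nth_mem)+
    then have h: "(u, (u + v) / 2) \<in> P" "((u + v) / 2, v) \<in> P"
      using uv(1) by (simp_all add: exposed_at_def)
    have dP: "dpart unit_ivl P" using P(1) by (simp add: good_part_def)
    note mg = dpart_merge[OF dP uv(2) _ h]
    have "good_part w (insert (u, v) (P - {(u, (u + v) / 2), ((u + v) / 2, v)}))"
      using mg(1) g P(1) by (simp add: good_part_def)
    from P(2)[OF this] mg(2) show False by simp
  qed
  moreover have "num_leaves S = card P"
    using card_leaves[of S] d(3) by simp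
  ultimately show ?thesis using that d(1,2) P(2) by simp
qed

section \<open>Elements of T have good partitions\<close>

lemma dyadic_diff: "x \<in> dyadic \<Longrightarrow> y \<in> dyadic \<Longrightarrow> x - y \<in> dyadic"
proof -
  assume "x \<in> dyadic" "y \<in> dyadic"
  then obtain m n m' n' where "x = of_int m / 2 ^ n" "y = of_int m' / 2 ^ n'"
    unfolding dyadic_def by blast
  then have "x - y = of_int (m * 2 ^ n' - m' * 2 ^ n) / 2 ^ (n + n')"
    by (simp add: diff_divide_distrib power_add)
  then show ?thesis unfolding dyadic_def by blast
qed

lemma dyadic_of_int: "of_int z \<in> dyadic"
  unfolding dyadic_def by (rule CollectI, rule exI[of _ z], rule exI[of _ 0]) simp

lemma dyadic_powi_mult: "x \<in> dyadic \<Longrightarrow> 2 powi k * x \<in> dyadic"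
proof -
  assume "x \<in> dyadic"
  then obtain m n where x: "x = of_int m / 2 ^ n" unfolding dyadic_def by blast
  show ?thesis
  proof (cases "0 \<le> k")
    case True
    then have "2 powi k * x = of_int (2 ^ nat k * m) / 2 ^ n"
      by (simp add: x power_int_def)
    then show ?thesis unfolding dyadic_def by blast
  next
    case False
    then have "2 powi k * x = of_int m / 2 ^ (nat (- k) + n)"
      by (simp add: x power_int_def power_add power_inverse divide_simps)
    then show ?thesis unfolding dyadic_def by blast
  qed
qed

lemma dyadic_frac_iff: "frac x \<in> dyadic \<Longrightarrow> x \<in> dyadic"
  using dyadic_diff[of "frac x" "of_int (- \<lfloor>x\<rfloor>)"] dyadic_of_int[of "- \<lfloor>x\<rfloor>"]
  by (simp add: frac_def)

definition grid_ivl :: "nat \<Rightarrow> nat \<Rightarrow> real \<times> real" where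
  "grid_ivl M i = (real i / 2 ^ M, (real i + 1) / 2 ^ M)"

lemma subnode_grid_ivl: "i < 2 ^ M \<Longrightarrow> subnode unit_ivl (grid_ivl M i)"
  using subnode_grid[of i M 0 1] by (simp add: grid_ivl_def)

lemma dpart_grid: "dpart unit_ivl (grid_ivl M ` {..<2 ^ M})"
  unfolding dpart_def
proof (intro conjI ballI)
  show "subnode unit_ivl I" if "I \<in> grid_ivl M ` {..<2 ^ M}" for I
    using that subnode_grid_ivl by auto
  fix x :: real assume x: "x \<in> ico unit_ivl"
  have iff: "x \<in> ico (grid_ivl M i) \<longleftrightarrow> i = nat \<lfloor>x * 2 ^ M\<rfloor>" for i
  proof -
    have "x \<in> ico (grid_ivl M i) \<longleftrightarrow> real i \<le> x * 2 ^ M \<and> x * 2 ^ M < real i + 1"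
      by (simp add: grid_ivl_def field_simps)
    also have "\<dots> \<longleftrightarrow> \<lfloor>x * 2 ^ M\<rfloor> = int i" by (simp add: floor_eq_iff)
    also have "\<dots> \<longleftrightarrow> i = nat \<lfloor>x * 2 ^ M\<rfloor>" using x by auto
    finally show ?thesis .
  qed
  have "x * 2 ^ M < 2 ^ M" using x by simp
  then have "\<lfloor>x * 2 ^ M\<rfloor> < 2 ^ M" by (simp add: floor_less_iff)
  then have "nat \<lfloor>x * 2 ^ M\<rfloor> < 2 ^ M" by (simp add: nat_less_iff)
  then show "\<exists>!I. I \<in> grid_ivl M ` {..<2 ^ M} \<and> x \<in> ico I"
  proof (intro ex1I[of _ "grid_ivl M (nat \<lfloor>x * 2 ^ M\<rfloor>)"])
    fix I assume "I \<in> grid_ivl M ` {..<2 ^ M} \<and> x \<in> ico I"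
    then obtain i where "I = grid_ivl M i" "x \<in> ico (grid_ivl M i)" by blast
    then show "I = grid_ivl M (nat \<lfloor>x * 2 ^ M\<rfloor>)" unfolding iff by simp
  qed (use iff in blast)
qed simp

text \<open>The image of a sufficiently fine grid interval under an affine piece is an arc of dyadic length
  starting at a multiple of its own length; hence it does not wrap around 0.\<close>

lemma thompson_good_piece:
  assumes w: "w \<in> thompson_T" and AB: "0 \<le> A" "A < B" "B \<le> 1" "A \<in> dyadic" "B \<in> dyadic"
    and lin: "\<And>t. t \<in> {A<..<B} \<Longrightarrow> w t = frac (2 powi k * t + c)"
  shows "\<exists>M0. \<forall>M\<ge>M0. \<forall>i. A \<le> real i / 2 ^ M \<and> (real i + 1) / 2 ^ M \<le> B \<longrightarrow> good w (grid_ivl M i)"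
proof -
  define t0 where "t0 = (A + B) / 2"
  have t0: "t0 \<in> {A<..<B}" using AB by (simp add: t0_def)
  have "B - (0 - A) \<in> dyadic" using AB dyadic_of_int[of 0] by (intro dyadic_diff) auto
  from dyadic_powi_mult[OF this, of "- 1"] have t0d: "t0 \<in> dyadic"
    by (simp add: t0_def power_int_def field_simps)
  have "w t0 \<in> dyadic"
    using w t0 t0d AB by (auto simp: thompson_T_def)
  then have "2 powi k * t0 + c \<in> dyadic" using lin[OF t0] dyadic_frac_iff by simp
  from dyadic_diff[OF this dyadic_powi_mult[OF t0d, of k]] have "c \<in> dyadic" by simp
  then obtain p q where c: "c = of_int p / 2 ^ q" unfolding dyadic_def by blast
  \<comment> \<open>Level M is fine enough once the image length \<open>1 / 2 ^ (M - k)\<close> divides the offset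
    \<open>c = p / 2 ^ q\<close>.\<close>
  show ?thesis
  proof (intro exI[of _ "nat \<bar>k\<bar> + q"] allI impI)
    fix M i assume M: "nat \<bar>k\<bar> + q \<le> M"
      and i: "A \<le> real i / 2 ^ M \<and> (real i + 1) / 2 ^ M \<le> B"
    define e where "e = nat (int M - k)"
    have e: "int M - k = int e" "q \<le> e" using M by (simp_all add: e_def)
    have k: "k = int M - int e" using e(1) by simp
    have powi: "2 powi k = 2 ^ M / (2 ^ e :: real)"
      by (simp add: k power_int_diff)
    define z where "z = p * 2 ^ (e - q)"
    have "(2::real) ^ e = 2 ^ (e - q) * 2 ^ q" using e(2) by (simp flip: power_add)
    then have cz: "c = of_int z / 2 ^ e" by (simp add: c z_def)
    \<comment> \<open>The image arc is the L-th interval of the grid of level e; D counts full turns.\<close>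
    define L where "L = (int i + z) mod 2 ^ e"
    define D where "D = (int i + z) div 2 ^ e"
    have LD: "int i + z = L + 2 ^ e * D" by (simp add: L_def D_def)
    have L: "0 \<le> L" "L < 2 ^ e" by (simp_all add: L_def)
    define a b where "a = real i / 2 ^ M" and "b = (real i + 1) / 2 ^ M"
    have ab: "0 \<le> a" "a < b" "b \<le> 1" "A \<le> a" "b \<le> B"
      using order_trans[OF conjunct2[OF i] AB(3)] i
      unfolding a_def b_def by (simp_all add: divide_strict_right_mono)
    define l where "l t = (2 ^ M * t - real i + of_int L) / 2 ^ e" for t
    have lin': "2 powi k * t + c = l t + of_int D" for t
    proof -
      have "of_int z = of_int L + 2 ^ e * of_int D - real i"
        using arg_cong[OF LD, of real_of_int] by simp
      then show ?thesis by (simp add: powi cz l_def field_simps)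
    qed
    have wl: "w t = frac (l t)" if "t \<in> {a<..<b}" for t
      using lin[of t] that ab by (simp add: lin')
    have "continuous_on {a..b} l" unfolding l_def by (intro continuous_intros) auto
    note fr = thompson_frac_eq[OF w ab(1-3) this wl]
    have "affine_onto w (a, b) (of_int L / 2 ^ e, (of_int L + 1) / 2 ^ e)"
      unfolding affine_onto_def fst_conv snd_conv
    proof
      fix t assume t: "t \<in> {a..<b}"
      then have t': "real i \<le> 2 ^ M * t" "2 ^ M * t < real i + 1"
        by (simp_all add: a_def b_def field_simps)
      have L': "of_int L + 1 \<le> (2 ^ e :: real)" 
      proof -
        have "real_of_int (L + 1) \<le> real_of_int (2 ^ e)" using L(2) by (subst of_int_le_iff) simp
        then show ?thesis by simp
      qed
      have lt: "0 \<le> l t" "l t < 1" using t' L(1) L' by (simp_all add: l_def)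
      have ft: "t \<in> {0..<1}" using t ab by auto
      then have "w t \<in> {0..<1}" using thompson_unit_bij[OF w] by (auto simp: unit_bij_def)
      then have "w t = l t" using fr[of t] t lt ft by (simp add: frac_eq_id)
      moreover have "l t = of_int L / 2 ^ e + (t - a) * ((of_int L + 1) / 2 ^ e - of_int L / 2 ^ e) / (b - a)"
        by (simp add: l_def a_def b_def field_simps)
      ultimately show "w t = of_int L / 2 ^ e +
          (t - a) * ((of_int L + 1) / 2 ^ e - of_int L / 2 ^ e) / (b - a)" by simp
    qed
    moreover have "(of_int L / 2 ^ e, (of_int L + 1) / 2 ^ e) = grid_ivl e (nat L)"
      using L by (simp add: grid_ivl_def)
    moreover have "(a, b) = grid_ivl M i" by (simp add: grid_ivl_def a_def b_def)
    ultimately have aff: "affine_onto w (grid_ivl M i) (grid_ivl e (nat L))" by (simp only:)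
    have Le: "nat L < 2 ^ e" using L by (simp add: nat_less_iff)
    have iM: "i < 2 ^ M"
    proof -
      have "real i + 1 \<le> 2 ^ M" using ab(3) by (simp add: b_def)
      then have "real i < real (2 ^ M)" by (simp only: of_nat_power of_nat_numeral)
      then show ?thesis by (simp only: of_nat_less_iff)
    qed
    show "good w (grid_ivl M i)"
      by (rule goodI[OF subnode_grid_ivl[OF iM] subnode_grid_ivl[OF Le] aff])
  qed
qed

lemma dyadic_common_denominator:
  assumes "finite B" "B \<subseteq> dyadic"
  shows "\<exists>N. \<forall>x\<in>B. \<exists>j::int. x = of_int j / 2 ^ N"
  using assms
proof induction
  case (insert y B)
  obtain N where N: "\<forall>x\<in>B. \<exists>j::int. x = of_int j / 2 ^ N" using insert by auto
  obtain m n where y: "y = of_int m / 2 ^ n" using insert.prems unfolding dyadic_def by blast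
  have "\<exists>j::int. x = of_int j / 2 ^ (N + n)" if "x \<in> insert y B" for x
  proof (cases "x = y")
    case True
    then have "x = of_int (m * 2 ^ N) / 2 ^ (N + n)" by (simp add: y power_add)
    then show ?thesis by blast
  next
    case False
    then have "x \<in> B" using that by simp
    then obtain j :: int where "x = of_int j / 2 ^ N" using N by blast
    then have "x = of_int (j * 2 ^ n) / 2 ^ (N + n)" by (simp add: power_add)
    then show ?thesis by blast
  qed
  then show ?case by blast
qed simp

text \<open>Inside the intervals of a grid that contains all breakpoints the map is affine modulo 1. Each of
  these finitely many intervals asks for a sufficiently fine grid, so some grid serves all.\<close>

lemma thompson_good_part:
  assumes w: "w \<in> thompson_T"
  obtains P where "good_part w P"
proof -
  have "pl_dyadic w" using w by (simp add: thompson_T_def)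
  then obtain B where B: "finite B" "B \<subseteq> dyadic \<inter> {0..1}"
    and lin: "\<forall>a b. a < b \<and> {a<..<b} \<subseteq> {0..1} - B \<longrightarrow>
        (\<exists>(k::int) c. \<forall>t\<in>{a<..<b}. w t = frac (2 powi k * t + c))"
    unfolding pl_dyadic_def by (elim exE conjE)
  obtain N where N: "\<And>x. x \<in> B \<Longrightarrow> \<exists>j::int. x = of_int j / 2 ^ N"
    using dyadic_common_denominator[OF B(1)] B(2) by blast
  define lo hi :: "nat \<Rightarrow> real" where "lo j = real j / 2 ^ N" and "hi j = (real j + 1) / 2 ^ N" for j
  have piece: "\<exists>M0. \<forall>M\<ge>M0. \<forall>i. lo j \<le> real i / 2 ^ M \<and> (real i + 1) / 2 ^ M \<le> hi j
      \<longrightarrow> good w (grid_ivl M i)" if j: "j \<in> {..<2 ^ N}" for j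
  proof -
    have b: "0 \<le> lo j" "lo j < hi j" by (simp_all add: lo_def hi_def divide_strict_right_mono)
    have "real (j + 1) \<le> real (2 ^ N)" using j by (subst of_nat_le_iff) auto
    then have hi1: "hi j \<le> 1" by (simp add: hi_def add.commute)
    have "lo j = of_int (int j) / 2 ^ N" "hi j = of_int (int j + 1) / 2 ^ N"
      by (simp_all add: lo_def hi_def)
    then have d: "lo j \<in> dyadic" "hi j \<in> dyadic" unfolding dyadic_def by blast+
    have "{lo j<..<hi j} \<subseteq> {0..1} - B"
    proof
      fix x assume x: "x \<in> {lo j<..<hi j}"
      have "x \<notin> B"
      proof
        assume "x \<in> B"
        then obtain i :: int where "x = of_int i / 2 ^ N" using N by blast
        with x have "real j < of_int i" "of_int i < real j + 1"
          by (auto simp: lo_def hi_def divide_less_cancel)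
        then have "int j < i" "i < int j + 1" by linarith+
        then show False by simp
      qed
      then show "x \<in> {0..1} - B" using x b hi1 by auto
    qed
    from lin[rule_format, OF conjI[OF b(2) this]]
    obtain k c where "\<forall>t\<in>{lo j<..<hi j}. w t = frac (2 powi k * t + c)"
      by (elim exE)
    then show ?thesis using thompson_good_piece[OF w b hi1 d] by blast
  qed
  have "eventually (\<lambda>M. \<forall>j\<in>{..<2 ^ N}. \<forall>i. lo j \<le> real i / 2 ^ M \<and> (real i + 1) / 2 ^ M \<le> hi j
      \<longrightarrow> good w (grid_ivl M i)) sequentially"
    by (rule eventually_ball_finite) (use piece in \<open>auto simp: eventually_sequentially\<close>)
  then obtain M0 where M0: "\<And>M j i. M \<ge> M0 \<Longrightarrow> j < 2 ^ N \<Longrightarrow>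
      lo j \<le> real i / 2 ^ M \<Longrightarrow> (real i + 1) / 2 ^ M \<le> hi j \<Longrightarrow> good w (grid_ivl M i)"
    unfolding eventually_sequentially by (metis lessThan_iff)
  define r M where "r = (2::nat) ^ M0" and "M = N + M0"
  have r: "0 < r" "(2::nat) ^ M = 2 ^ N * r" "(2::real) ^ M = 2 ^ N * real r"
    by (simp_all add: r_def M_def power_add)
  have "good w (grid_ivl M i)" if i: "i < 2 ^ M" for i
  proof (rule M0)
    define j where "j = i div r"
    show "j < 2 ^ N" using i r by (simp add: j_def less_mult_imp_div_less)
    have "i = j * r + i mod r" "i mod r < r" using r(1) by (simp_all add: j_def)
    then have "j * r \<le> i" "i + 1 \<le> (j + 1) * r" unfolding distrib_right by linarith+
    then have "real (j * r) \<le> real i" "real (i + 1) \<le> real ((j + 1) * r)"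
      by (simp_all only: of_nat_le_iff)
    then have h: "real j * real r \<le> real i" "real i + 1 \<le> (real j + 1) * real r"
      by (simp_all add: algebra_simps)
    have "lo j = real j * real r / 2 ^ M" "hi j = (real j + 1) * real r / 2 ^ M"
      using r(1) by (simp_all add: lo_def hi_def r(3))
    then show "lo j \<le> real i / 2 ^ M" "(real i + 1) / 2 ^ M \<le> hi j"
      using h by (simp_all add: divide_right_mono)
  qed (simp add: M_def)
  then have "good_part w (grid_ivl M ` {..<2 ^ M})"
    using dpart_grid by (auto simp: good_part_def)
  then show ?thesis by (rule that)
qed

lemma reduced_diagram_props:
  assumes w: "w \<in> thompson_T"
  obtains S T m where "reduced_diagram w = (S, T, m)"
    "tree_pair (S, T, m)" "reduced (S, T, m)" "represents (S, T, m) w"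
    "\<And>P. good_part w P \<Longrightarrow> num_leaves S \<le> card P"
proof -
  obtain P0 where "good_part w P0" using thompson_good_part[OF w] .
  then obtain S T m where d: "tree_pair (S, T, m)" "reduced (S, T, m)" "represents (S, T, m) w"
    "\<And>P. good_part w P \<Longrightarrow> num_leaves S \<le> card P"
    using reduced_exists[OF w] by metis
  have "reduced_diagram w = (S, T, m)"
    unfolding reduced_diagram_def
  proof (rule the_equality)
    fix d' assume d': "tree_pair d' \<and> reduced d' \<and> represents d' w"
    obtain S' T' m' where "d' = (S', T', m')" by (cases d')
    then show "d' = (S, T, m)" using reduced_unique[of S' T' m' w S T m] d d' by blast
  qed (use d in blast)
  then show ?thesis using that d by blast
qed

section \<open>Leaf exponents by recursion on the tree\<close>

definition trailing_lefts :: "edge list \<Rightarrow> nat" where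
  "trailing_lefts p = length (takeWhile (\<lambda>e. e = Left_Edge) (rev p))"

lemma trailing_lefts_iff: "(\<exists>q. p = q @ replicate k Left_Edge) \<longleftrightarrow> k \<le> trailing_lefts p"
proof
  assume "\<exists>q. p = q @ replicate k Left_Edge"
  then obtain q where "p = q @ replicate k Left_Edge" by blast
  then have "rev p = replicate k Left_Edge @ rev q" by simp
  then show "k \<le> trailing_lefts p"
    by (simp add: trailing_lefts_def takeWhile_append)
next
  assume k: "k \<le> trailing_lefts p"
  let ?w = "takeWhile (\<lambda>e. e = Left_Edge) (rev p)"
  have "take k ?w = replicate k Left_Edge"
    using k by (intro replicate_eqI) (auto simp: trailing_lefts_def dest: in_set_takeD set_takeWhileD)
  then have "rev p = replicate k Left_Edge @ drop k ?w @ dropWhile (\<lambda>e. e = Left_Edge) (rev p)"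
    by (metis append.assoc append_take_drop_id takeWhile_dropWhile_id)
  then have "p = rev (drop k ?w @ dropWhile (\<lambda>e. e = Left_Edge) (rev p)) @ replicate k Left_Edge"
    by (metis rev_append rev_replicate rev_rev_ident)
  then show "\<exists>q. p = q @ replicate k Left_Edge" by blast
qed

lemma leaf_exponent_Nil: "leaf_exponent [] = 0"
  unfolding leaf_exponent_def by (rule Greatest_equality) (auto simp: on_right_side_def)

lemma leaf_exponent_Right: "leaf_exponent (Right_Edge # p) = leaf_exponent p"
proof -
  have "(\<exists>q. Right_Edge # p = q @ replicate k Left_Edge \<and> \<not> on_right_side q) \<longleftrightarrow>
      (\<exists>q. p = q @ replicate k Left_Edge \<and> \<not> on_right_side q)" (is "?L \<longleftrightarrow> ?R") for k
  proof
    assume ?L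
    then show ?R by (auto simp: on_right_side_def Cons_eq_append_conv)
  next
    assume ?R
    then obtain q where "p = q @ replicate k Left_Edge" "\<not> on_right_side q" by blast
    then show ?L by (intro exI[of _ "Right_Edge # q"]) (auto simp: on_right_side_def)
  qed
  then show ?thesis by (simp add: leaf_exponent_def)
qed

lemma leaf_exponent_Left: "leaf_exponent (Left_Edge # p) = trailing_lefts p"
proof -
  have "(\<exists>q. Left_Edge # p = q @ replicate k Left_Edge \<and> \<not> on_right_side q) \<longleftrightarrow>
      (\<exists>q. p = q @ replicate k Left_Edge)" (is "?L \<longleftrightarrow> ?R") for k
  proof
    assume ?L
    then show ?R by (auto simp: on_right_side_def Cons_eq_append_conv)
  next
    assume ?R
    then obtain q where "p = q @ replicate k Left_Edge" by blast
    then show ?L by (intro exI[of _ "Left_Edge # q"]) (auto simp: on_right_side_def)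
  qed
  then have "leaf_exponent (Left_Edge # p) = (GREATEST k. k = 0 \<or> k \<le> trailing_lefts p)"
    by (simp add: leaf_exponent_def trailing_lefts_iff)
  also have "\<dots> = trailing_lefts p" by (rule Greatest_equality) auto
  finally show ?thesis .
qed

text \<open>The exponents of the leaves of a tree that hangs by a left edge from the right side of a larger
  tree. Left edges inside it never reach the right side, so each caret adds one to the exponent
  of its leftmost leaf.\<close>

fun inner_exps :: "tree \<Rightarrow> nat list" where
  "inner_exps Leaf = [0]"
| "inner_exps (Caret l r) = (Suc (hd (inner_exps l)) # tl (inner_exps l)) @ inner_exps r"

text \<open>The exponents for a whole tree, whose left subtrees along the right side are of the above kind.\<close>

fun outer_exps :: "tree \<Rightarrow> nat list" where
  "outer_exps Leaf = [0]"
| "outer_exps (Caret l r) = inner_exps l @ outer_exps r"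

lemma inner_exps_nonempty [simp]: "inner_exps t \<noteq> []"
  by (induction t) auto

lemma leaf_paths_leftmost:
  "\<exists>p ps. leaf_paths t = p # ps \<and> set p \<subseteq> {Left_Edge} \<and> (\<forall>p'\<in>set ps. Right_Edge \<in> set p')"
proof (induction t)
  case (Caret l r)
  then obtain p ps where "leaf_paths l = p # ps" "set p \<subseteq> {Left_Edge}"
    "\<forall>p'\<in>set ps. Right_Edge \<in> set p'" by blast
  then show ?case by auto
qed simp

lemma trailing_lefts_Right: "trailing_lefts (Right_Edge # p) = trailing_lefts p"
  by (simp add: trailing_lefts_def takeWhile_tail)

lemma trailing_lefts_Left:
  "trailing_lefts (Left_Edge # p) =
     (if set p \<subseteq> {Left_Edge} then Suc (trailing_lefts p) else trailing_lefts p)"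
proof (cases "set p \<subseteq> {Left_Edge}")
  case True
  then have "\<forall>e\<in>set (rev p). e = Left_Edge" by auto
  then show ?thesis using True by (auto simp: trailing_lefts_def takeWhile_append2 takeWhile_eq_all_conv[THEN iffD2])
next
  case False
  then obtain e where "e \<in> set (rev p)" "e \<noteq> Left_Edge" by auto
  then show ?thesis using False by (auto simp: trailing_lefts_def takeWhile_append1)
qed

lemma map_trailing_lefts: "map trailing_lefts (leaf_paths t) = inner_exps t"
proof (induction t)
  case (Caret l r)
  obtain p ps where l: "leaf_paths l = p # ps" "set p \<subseteq> {Left_Edge}"
    "\<forall>p'\<in>set ps. Right_Edge \<in> set p'" using leaf_paths_leftmost by blast
  then have "map (trailing_lefts \<circ> (#) Left_Edge) ps = map trailing_lefts ps"
    by (auto simp: trailing_lefts_Left)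
  moreover have "trailing_lefts (Left_Edge # p) = Suc (trailing_lefts p)"
    using l(2) by (simp add: trailing_lefts_Left)
  moreover have "map (trailing_lefts \<circ> (#) Right_Edge) (leaf_paths r) = inner_exps r"
    using Caret.IH(2) by (simp add: o_def trailing_lefts_Right)
  ultimately show ?case using Caret.IH(1)[symmetric] l(1) by simp
qed (simp add: trailing_lefts_def)

lemma map_leaf_exponent: "map leaf_exponent (leaf_paths t) = outer_exps t"
proof (induction t)
  case (Caret l r)
  then show ?case
    by (simp add: o_def leaf_exponent_Left leaf_exponent_Right map_trailing_lefts)
qed (simp add: leaf_exponent_Nil)

lemma length_inner_exps: "length (inner_exps t) = num_leaves t"
  by (simp flip: map_trailing_lefts) (induction t, auto)

lemma length_outer_exps: "length (outer_exps t) = num_leaves t"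
  by (induction t) (auto simp: length_inner_exps)

lemma sum_inner_exps: "sum_list (inner_exps t) = carets t"
proof (induction t)
  case (Caret l r)
  have "sum_list (inner_exps l) = hd (inner_exps l) + sum_list (tl (inner_exps l))"
    by (metis inner_exps_nonempty list.collapse sum_list.Cons)
  then show ?case using Caret by simp
qed simp

fun right_carets :: "tree \<Rightarrow> nat" where
  "right_carets Leaf = 0"
| "right_carets (Caret l r) = Suc (right_carets r)"

text \<open>Each caret off the right side adds one to exactly one leaf exponent.\<close>

lemma sum_outer_exps: "sum_list (outer_exps t) + right_carets t = carets t"
  by (induction t) (auto simp: sum_inner_exps)

lemma exponents_eq: "exponents t = filter (\<lambda>(i, r). 0 < r) (List.enumerate 0 (outer_exps t))"
  by (simp add: exponents_def map_leaf_exponent)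


section \<open>Positive words\<close>

text \<open>The points that cut off the leaves of a right comb. Its leaves are \<open>spine_ivl 0\<close>,
  \<open>spine_ivl 1\<close>, ... and a last \<open>tail_ivl\<close>.\<close>

definition lft :: "nat \<Rightarrow> real" where
  "lft a = 1 - 1 / 2 ^ a"

abbreviation spine_ivl :: "nat \<Rightarrow> real \<times> real" where
  "spine_ivl a \<equiv> (lft a, lft (Suc a))"

abbreviation tail_ivl :: "nat \<Rightarrow> real \<times> real" where
  "tail_ivl a \<equiv> (lft a, 1)"

lemma lft_0 [simp]: "lft 0 = 0"
  by (simp add: lft_def)

lemma lft_1: "lft 1 = 1 / 2"
  by (simp add: lft_def)

lemma lft_half: "(lft a + 1) / 2 = lft (Suc a)"
  by (simp add: lft_def field_simps)

lemma lft_mono: "a \<le> b \<Longrightarrow> lft a \<le> lft b"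
  unfolding lft_def by (intro diff_left_mono divide_left_mono power_increasing) auto

lemma lft_less_1 [simp]: "lft a < 1"
  by (simp add: lft_def)

lemma lft_less_Suc [simp]: "lft a < lft (Suc a)"
  by (simp add: lft_def field_simps)

lemma lft_nonneg [simp]: "0 \<le> lft a"
  using lft_mono[of 0 a] by simp

lemma x_gen_outside: "t < lft a \<or> 1 \<le> t \<Longrightarrow> x_gen a t = t"
  by (cases "t = 1") (auto simp: x_gen_def x_zero_def lft_def)

lemma x_gen_branches:
  shows "lft a \<le> t \<Longrightarrow> t < lft (Suc a) \<Longrightarrow> x_gen a t = lft a + (t - lft a) / 2"
    and "lft (Suc a) \<le> t \<Longrightarrow> t < lft (Suc (Suc a)) \<Longrightarrow> x_gen a t = t - 1 / 2 ^ a / 4"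
    and "lft (Suc (Suc a)) \<le> t \<Longrightarrow> t < 1 \<Longrightarrow> x_gen a t = 2 * t - 1"
proof -
  define s :: real where "s = 1 / 2 ^ a"
  have s: "0 < s" "2 ^ a = 1 / s" by (simp_all add: s_def)
  have l: "lft a = 1 - s" "lft (Suc a) = 1 - s / 2" "lft (Suc (Suc a)) = 1 - s / 4"
    by (simp_all add: lft_def s_def)
  define u where "u = 2 ^ a * (t - 1 + 1 / 2 ^ a)"
  have u: "u = (t - 1 + s) / s" using s by (simp add: u_def)
  have us: "u * s = t - 1 + s" using s by (simp add: u)
  have x: "x_gen a t = 1 - s + x_zero u * s" if "1 - s \<le> t" "t \<le> 1"
    using that by (simp add: x_gen_def s_def u_def)
  show "x_gen a t = lft a + (t - lft a) / 2" if "lft a \<le> t" "t < lft (Suc a)"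
  proof -
    have "0 \<le> u" "u \<le> 1 / 2" using that s by (simp_all add: u l field_simps)
    then have "x_zero u = u / 2" by (simp add: x_zero_def)
    then have "x_gen a t = 1 - s + u * s / 2" using x that s by (simp add: l)
    then show ?thesis using us by (simp add: l)
  qed
  show "x_gen a t = t - 1 / 2 ^ a / 4" if "lft (Suc a) \<le> t" "t < lft (Suc (Suc a))"
  proof -
    have "1 / 2 \<le> u" "u \<le> 3 / 4" using that s by (simp_all add: u l field_simps)
    then have "x_zero u = u - 1 / 4" by (auto simp: x_zero_def)
    then have "x_gen a t = 1 - s + (u - 1 / 4) * s" using x that s by (simp add: l)
    then show ?thesis using us unfolding s_def[symmetric] by (simp add: left_diff_distrib)
  qed
  show "x_gen a t = 2 * t - 1" if "lft (Suc (Suc a)) \<le> t" "t < 1"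
  proof -
    have "3 / 4 \<le> u" "u \<le> 1" using that s by (simp_all add: u l field_simps)
    then have "x_zero u = 2 * u - 1" by (auto simp: x_zero_def)
    then have "x_gen a t = 1 - s + (2 * u - 1) * s" using x that s by (simp add: l)
    then show ?thesis using us by (simp add: left_diff_distrib)
  qed
qed

lemma x_gen_affine:
  "affine_onto (x_gen a) (spine_ivl a) (lft a, (lft a + lft (Suc a)) / 2)"
  "affine_onto (x_gen a) (spine_ivl (Suc a)) ((lft a + lft (Suc a)) / 2, lft (Suc a))"
  "affine_onto (x_gen a) (tail_ivl (Suc (Suc a))) (tail_ivl (Suc a))"
  unfolding affine_onto_def
  by (auto simp: x_gen_branches) (simp_all add: lft_def field_simps)

text \<open>The factors have consecutive indices and vanishing exponents are allowed, so that the product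
  over all leaves of a tree splits into the products over its subtrees.\<close>

fun xprod :: "nat \<Rightarrow> nat list \<Rightarrow> real \<Rightarrow> real" where
  "xprod a [] = id"
| "xprod a (e # es) = (x_gen a ^^ e) \<circ> xprod (Suc a) es"

lemma xprod_append: "xprod a (es @ fs) = xprod a es \<circ> xprod (a + length es) fs"
  by (induction es arbitrary: a) (auto simp: o_assoc)

lemma xprod_replicate_0: "xprod a (replicate n 0) = id"
  by (induction n arbitrary: a) auto

lemma pos_word_enumerate:
  "pos_word (filter (\<lambda>(i, r). 0 < r) (List.enumerate a es)) = xprod a es"
  by (induction es arbitrary: a) (auto simp: pos_word_def)

lemma pos_word_exponents: "pos_word (exponents t) = xprod 0 (outer_exps t)"
  by (simp add: exponents_eq pos_word_enumerate)

lemma xprod_outside: "t < lft a \<or> 1 \<le> t \<Longrightarrow> xprod a es t = t"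
proof (induction es arbitrary: a)
  case (Cons e es)
  have "(x_gen a ^^ e) t = t"
    by (induction e) (use Cons.prems in \<open>auto simp: x_gen_outside\<close>)
  moreover have "xprod (Suc a) es t = t"
    using Cons.prems lft_less_Suc[of a] by (intro Cons.IH) linarith
  ultimately show ?case by simp
qed simp

lemma list_all2_affine_comp:
  assumes "list_all2 (affine_onto f) xs ys" "list_all2 (affine_onto g) ys zs"
    and "\<And>I. I \<in> set ys \<Longrightarrow> fst I < snd I"
  shows "list_all2 (affine_onto (g \<circ> f)) xs zs"
  using assms by (auto simp: list_all2_conv_all_nth intro!: affine_onto_comp)

lemma leaves_nondeg: "I \<in> set (leaves t a b) \<Longrightarrow> a < b \<Longrightarrow> fst I < snd I"
  using leaves_bounds by blast

fun comb :: "nat \<Rightarrow> tree" where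
  "comb 0 = Leaf"
| "comb (Suc n) = Caret Leaf (comb n)"

lemma carets_comb [simp]: "carets (comb n) = n"
  by (induction n) auto

lemma num_leaves_comb [simp]: "num_leaves (comb n) = Suc n"
  by (simp add: num_leaves_carets)

lemma leaves_comb: "leaves (comb n) (lft a) 1 = map spine_ivl [a..<a + n] @ [tail_ivl (a + n)]"
proof (induction n arbitrary: a)
  case (Suc n)
  have "[a..<a + Suc n] = a # [Suc a..<Suc a + n]" by (simp add: upt_conv_Cons)
  then show ?case using Suc[of "Suc a"] by (simp add: lft_half)
qed simp

lemma spine_fixed_affine:
  assumes "\<And>t. t < lft b \<Longrightarrow> g t = t" "n \<le> b"
  shows "list_all2 (affine_onto g) (map spine_ivl [a..<n]) (map spine_ivl [a..<n])"
proof -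
  have "affine_onto g (spine_ivl k) (spine_ivl k)" if "k < n" for k
  proof (rule affine_onto_id)
    fix t assume "t \<in> ico (spine_ivl k)"
    then have "t < lft b" using lft_mono[of "Suc k" b] that assms(2) by auto
    then show "g t = t" by (rule assms(1))
  qed
  then show ?thesis by (auto simp: list_all2_conv_all_nth)
qed

text \<open>For a caret with subtrees l and r the word of r acts first and shrinks its spine intervals into
  a single one, the word of l does the same to the left of it and pulls the interval of r to its
  own right neighbour, and the additional letter \<open>x_gen a\<close> places the two
  resulting neighbours in the two halves of \<open>spine_ivl a\<close>.\<close>

lemma inner_word_affine:
  "list_all2 (affine_onto (xprod a (inner_exps t)))
      (map spine_ivl [a..<a + num_leaves t]) (leaves t (lft a) (lft (Suc a))) \<and>
   affine_onto (xprod a (inner_exps t)) (tail_ivl (a + num_leaves t)) (tail_ivl (Suc a))"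
proof (induction t arbitrary: a)
  case Leaf
  then show ?case by (auto intro: affine_onto_id)
next
  case (Caret l r)
  define b where "b = a + num_leaves l"
  define f where "f = xprod a (inner_exps l)"
  define g where "g = xprod b (inner_exps r)"
  define m where "m = (lft a + lft (Suc a)) / 2"
  have m: "lft a < m" "m < lft (Suc a)" using lft_less_Suc[of a] by (auto simp: m_def)
  have xp: "xprod a (inner_exps (Caret l r)) = x_gen a \<circ> (f \<circ> g)"
  proof -
    have "inner_exps l = hd (inner_exps l) # tl (inner_exps l)" by simp
    then have "f = (x_gen a ^^ hd (inner_exps l)) \<circ> xprod (Suc a) (tl (inner_exps l))"
      unfolding f_def by (metis xprod.simps(2))
    moreover have "Suc (a + length (tl (inner_exps l))) = b"
      using length_inner_exps[of l] num_leaves_pos[of l] by (simp add: b_def)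
    ultimately show ?thesis by (simp add: xprod_append g_def o_assoc)
  qed
  have tail: "affine_onto f (tail_ivl b) (tail_ivl (Suc a))"
    using Caret.IH(1) by (simp add: f_def b_def)
  note tail_halves = affine_onto_halves[OF tail lft_less_1, unfolded lft_half]
  have gfix: "g t = t" if "t < lft b" for t
    using that by (simp add: g_def xprod_outside)
  show ?case
  proof
    have "list_all2 (affine_onto g) (map spine_ivl [a..<b]) (map spine_ivl [a..<b])"
      by (rule spine_fixed_affine[OF gfix]) auto
    moreover have "list_all2 (affine_onto f) (map spine_ivl [a..<b]) (leaves l (lft a) (lft (Suc a)))"
      using Caret.IH(1) by (simp add: f_def b_def)
    ultimately have "list_all2 (affine_onto (f \<circ> g)) (map spine_ivl [a..<b]) (leaves l (lft a) (lft (Suc a)))"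
      by (rule list_all2_affine_comp) auto
    moreover have "list_all2 (affine_onto (x_gen a)) (leaves l (lft a) (lft (Suc a))) (leaves l (lft a) m)"
      unfolding m_def by (rule leaves_affine[OF x_gen_affine(1)]) simp
    ultimately have L: "list_all2 (affine_onto (x_gen a \<circ> (f \<circ> g))) (map spine_ivl [a..<b]) (leaves l (lft a) m)"
      by (rule list_all2_affine_comp) (auto intro: leaves_nondeg)
    have "list_all2 (affine_onto g) (map spine_ivl [b..<b + num_leaves r]) (leaves r (lft b) (lft (Suc b)))"
      using Caret.IH(2) by (simp add: g_def)
    moreover have "list_all2 (affine_onto f) (leaves r (lft b) (lft (Suc b)))
        (leaves r (lft (Suc a)) (lft (Suc (Suc a))))"
      by (rule leaves_affine[OF tail_halves(1)]) simp
    ultimately have "list_all2 (affine_onto (f \<circ> g)) (map spine_ivl [b..<b + num_leaves r])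
        (leaves r (lft (Suc a)) (lft (Suc (Suc a))))"
      by (rule list_all2_affine_comp) (auto intro: leaves_nondeg)
    moreover have "list_all2 (affine_onto (x_gen a)) (leaves r (lft (Suc a)) (lft (Suc (Suc a))))
        (leaves r m (lft (Suc a)))"
      unfolding m_def by (rule leaves_affine[OF x_gen_affine(2)]) simp
    ultimately have R: "list_all2 (affine_onto (x_gen a \<circ> (f \<circ> g)))
        (map spine_ivl [b..<b + num_leaves r]) (leaves r m (lft (Suc a)))"
      by (rule list_all2_affine_comp) (auto intro: leaves_nondeg)
    have "[a..<a + num_leaves (Caret l r)] = [a..<b] @ [b..<b + num_leaves r]"
      using upt_add_eq_append[of a b "num_leaves r"] by (simp add: b_def add.assoc)
    moreover have "leaves (Caret l r) (lft a) (lft (Suc a)) =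
        leaves l (lft a) m @ leaves r m (lft (Suc a))" by (simp add: m_def)
    ultimately show "list_all2 (affine_onto (xprod a (inner_exps (Caret l r))))
        (map spine_ivl [a..<a + num_leaves (Caret l r)])
        (leaves (Caret l r) (lft a) (lft (Suc a)))"
      unfolding xp using list_all2_appendI[OF L R] by (simp only: map_append)
    have "affine_onto g (tail_ivl (b + num_leaves r)) (tail_ivl (Suc b))"
      using Caret.IH(2) by (simp add: g_def)
    from affine_onto_comp[OF affine_onto_comp[OF this tail_halves(2)] x_gen_affine(3)]
    show "affine_onto (xprod a (inner_exps (Caret l r)))
        (tail_ivl (a + num_leaves (Caret l r))) (tail_ivl (Suc a))"
      unfolding xp by (simp add: b_def add.assoc)
  qed
qed

text \<open>Along the right side the words of the left subtrees act one after the other, from bottom to top,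
  each pulling the part of the tree already built up to the right child of its own caret.\<close>

lemma outer_word_affine:
  "list_all2 (affine_onto (xprod a (outer_exps t)))
     (leaves (comb (carets t)) (lft a) 1) (leaves t (lft a) 1)"
proof (induction t arbitrary: a)
  case Leaf
  then show ?case by (auto intro: affine_onto_id)
next
  case (Caret l r)
  define b where "b = a + num_leaves l"
  define f where "f = xprod a (inner_exps l)"
  define g where "g = xprod b (outer_exps r)"
  have xp: "xprod a (outer_exps (Caret l r)) = f \<circ> g"
    by (simp add: xprod_append f_def g_def b_def length_inner_exps)
  have gfix: "g t = t" if "t < lft b" for t
    using that by (simp add: g_def xprod_outside)
  have "list_all2 (affine_onto g) (map spine_ivl [a..<b]) (map spine_ivl [a..<b])"
    by (rule spine_fixed_affine[OF gfix]) auto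
  moreover have "list_all2 (affine_onto f) (map spine_ivl [a..<b]) (leaves l (lft a) (lft (Suc a)))"
    using inner_word_affine[of a l] by (simp add: f_def b_def)
  ultimately have L: "list_all2 (affine_onto (f \<circ> g)) (map spine_ivl [a..<b]) (leaves l (lft a) (lft (Suc a)))"
    by (rule list_all2_affine_comp) auto
  have "list_all2 (affine_onto g) (leaves (comb (carets r)) (lft b) 1) (leaves r (lft b) 1)"
    using Caret.IH(2) by (simp add: g_def)
  moreover have "list_all2 (affine_onto f) (leaves r (lft b) 1) (leaves r (lft (Suc a)) 1)"
    using inner_word_affine[of a l] by (intro leaves_affine) (simp_all add: f_def b_def)
  ultimately have R: "list_all2 (affine_onto (f \<circ> g)) (leaves (comb (carets r)) (lft b) 1)
      (leaves r (lft (Suc a)) 1)"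
    by (rule list_all2_affine_comp) (auto intro: leaves_nondeg)
  have "leaves (comb (carets (Caret l r))) (lft a) 1 =
      map spine_ivl [a..<b] @ leaves (comb (carets r)) (lft b) 1"
    using upt_add_eq_append[of a b "carets r"]
    by (simp add: leaves_comb b_def num_leaves_carets add.assoc add.commute add.left_commute del: comb.simps)
  moreover have "leaves (Caret l r) (lft a) 1 =
      leaves l (lft a) (lft (Suc a)) @ leaves r (lft (Suc a)) 1"
    by (simp add: lft_half)
  ultimately show ?case unfolding xp using list_all2_appendI[OF L R] by (simp only:)
qed

lemma represents_0_iff:
  "represents (S, T, 0) g \<longleftrightarrow> list_all2 (affine_onto g) (leaves S 0 1) (leaves T 0 1)"
  if "num_leaves S = num_leaves T"
  using that by (auto simp: represents_iff list_all2_conv_all_nth length_leaves_num)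

lemma tree_pair_comb: "tree_pair (comb (carets t), t, 0)"
  by (simp add: tree_pair_def num_leaves_carets)

lemma pos_word_represents: "represents (comb (carets t), t, 0) (pos_word (exponents t))"
  using outer_word_affine[of 0 t]
  by (simp add: represents_0_iff num_leaves_carets pos_word_exponents)

lemma pos_word_outside: "t \<notin> {0..<1} \<Longrightarrow> pos_word (exponents T) t = t"
  by (auto simp: pos_word_exponents intro: xprod_outside)

lemma pos_word_unit_bij: "unit_bij (pos_word (exponents t))"
  by (rule unit_bij_of_diagram[OF pos_word_represents tree_pair_comb pos_word_outside])

lemma pos_word_inv_represents: "represents (t, comb (carets t), 0) (inv (pos_word (exponents t)))"
  by (rule represents_inv[OF pos_word_represents tree_pair_comb])
    (use pos_word_unit_bij in \<open>simp add: unit_bij_def bij_is_inj\<close>)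

lemma inv_outside:
  assumes "bij f" "\<And>t. t \<notin> {0..<1} \<Longrightarrow> f t = t" "t \<notin> {0..<1::real}"
  shows "inv f t = t"
  using assms by (metis bij_is_inj inv_f_f)

section \<open>Rotations of the right comb\<close>

lemma nth_leaves_comb:
  "k < n \<Longrightarrow> leaves (comb n) 0 1 ! k = spine_ivl k"
  "leaves (comb n) 0 1 ! n = tail_ivl n"
  using leaves_comb[of n 0] by (simp_all add: nth_append)

lemma c_gen_represents: "represents (comb (Suc n), comb (Suc n), Suc n) (c_gen n)"
  unfolding represents_iff
proof (intro allI impI)
  fix k assume "k < num_leaves (comb (Suc n))"
  then consider "k = 0" | k' where "k = Suc k'" "k' < n" | "k = Suc n"
    by (cases k) (auto simp: less_Suc_eq)
  then show "affine_onto (c_gen n) (leaves (comb (Suc n)) 0 1 ! k)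
      (leaves (comb (Suc n)) 0 1 ! ((k + Suc n) mod num_leaves (comb (Suc n))))"
  proof cases
    case 1
    have "affine_onto (c_gen n) (spine_ivl 0) (tail_ivl (Suc n))"
      by (auto simp: affine_onto_def c_gen_def lft_def field_simps)
    then show ?thesis using 1 by (simp add: nth_leaves_comb del: comb.simps)
  next
    case 2
    have "c_gen n t = 2 * t - 1" if t: "t \<in> {lft (Suc k')..<lft (Suc (Suc k'))}" for t
    proof -
      have "1 / 2 \<le> t" using t lft_mono[of 1 "Suc k'"] lft_1 by auto
      moreover have "lft (Suc (Suc k')) \<le> lft (Suc n)" using 2 by (intro lft_mono) simp
      then have "t < 1 - 1 / 2 ^ (n + 1)" using t by (simp add: lft_def)
      ultimately show ?thesis by (simp add: c_gen_def)
    qed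
    moreover have "lft k' + (t - lft (Suc k')) * (lft (Suc k') - lft k') /
        (lft (Suc (Suc k')) - lft (Suc k')) = 2 * t - 1" for t
      by (simp add: lft_def field_simps)
    ultimately have "affine_onto (c_gen n) (spine_ivl (Suc k')) (spine_ivl k')"
      by (simp add: affine_onto_def)
    moreover have "(k + Suc n) mod Suc (Suc n) = k'" using 2 by (simp add: mod_if)
    ultimately show ?thesis using 2 by (simp add: nth_leaves_comb del: comb.simps)
  next
    case 3
    have "c_gen n t = t - 1 / 2 ^ (n + 1)" if t: "t \<in> {lft (Suc n)..<1}" for t
    proof -
      have "1 / 2 \<le> t" using t lft_mono[of 1 "Suc n"] lft_1 by auto
      then show ?thesis using t by (simp add: c_gen_def lft_def)
    qed
    moreover have "lft n + (t - lft (Suc n)) * (lft (Suc n) - lft n) / (1 - lft (Suc n)) =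
        t - 1 / 2 ^ (n + 1)" for t
      by (simp add: lft_def field_simps)
    ultimately have "affine_onto (c_gen n) (tail_ivl (Suc n)) (spine_ivl n)"
      by (simp add: affine_onto_def)
    moreover have "(k + Suc n) mod Suc (Suc n) = n" using 3 by (simp add: mod_if)
    ultimately show ?thesis using 3 by (simp add: nth_leaves_comb del: comb.simps)
  qed
qed

lemma c_gen_outside: "t \<notin> {0..<1} \<Longrightarrow> c_gen n t = t"
proof -
  assume t: "t \<notin> {0..<1}"
  define z :: real where "z = 1 - 1 / 2 ^ (n + 1)"
  have "0 \<le> z" "z < 1" using lft_nonneg[of "n + 1"] lft_less_1[of "n + 1"] by (simp_all add: lft_def z_def)
  then show ?thesis using t unfolding c_gen_def z_def[symmetric] by auto
qed

lemma tree_pair_c_gen: "tree_pair (comb (Suc n), comb (Suc n), Suc n)"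
  by (simp add: tree_pair_def del: comb.simps)

lemma c_gen_unit_bij: "unit_bij (c_gen n)"
  by (rule unit_bij_of_diagram[OF c_gen_represents tree_pair_c_gen c_gen_outside])

text \<open>One application moves the mark by \<open>Suc n\<close>, that is by -1 modulo the number of leaves.\<close>

lemma c_gen_power_represents:
  "represents (comb (Suc n), comb (Suc n), (j * Suc n) mod Suc (Suc n)) (c_gen n ^^ j)"
proof (induction j)
  case 0
  then show ?case by (auto simp: represents_iff intro: affine_onto_id)
next
  case (Suc j)
  have "tree_pair (comb (Suc n), comb (Suc n), (j * Suc n) mod Suc (Suc n))"
    by (simp add: tree_pair_def del: comb.simps)
  from represents_comp[OF Suc c_gen_represents this tree_pair_c_gen]
  have "represents (comb (Suc n), comb (Suc n),
      ((j * Suc n) mod Suc (Suc n) + Suc n) mod Suc (Suc n)) (c_gen n \<circ> c_gen n ^^ j)"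
    unfolding num_leaves_comb .
  moreover have "((j * Suc n) mod Suc (Suc n) + Suc n) mod Suc (Suc n) = (Suc j * Suc n) mod Suc (Suc n)"
    unfolding mod_add_left_eq by (simp add: algebra_simps)
  ultimately show ?case by (simp only: funpow.simps)
qed

lemma c_gen_power_outside: "t \<notin> {0..<1} \<Longrightarrow> (c_gen n ^^ j) t = t"
  by (induction j) (auto simp: c_gen_outside)

section \<open>The normal form\<close>

fun hook :: "nat \<Rightarrow> tree" where
  "hook 0 = Caret (Caret Leaf Leaf) Leaf"
| "hook (Suc n) = Caret Leaf (hook n)"

lemma carets_hook: "carets (hook n) = n + 2"
  by (induction n) auto

text \<open>The tree \<open>hook n\<close> has a single positive leaf exponent, at leaf n. So the generators are
  instances of positive words, and their bijectivity and small diagrams come from these.\<close>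

lemma x_gen_eq_pos_word: "x_gen n = pos_word (exponents (hook n))"
proof -
  have "outer_exps (hook n) = replicate n 0 @ [1, 0, 0]" by (induction n) auto
  then show ?thesis by (simp add: pos_word_exponents xprod_append xprod_replicate_0)
qed

lemma x_gen_unit_bij: "unit_bij (x_gen n)"
  unfolding x_gen_eq_pos_word by (rule pos_word_unit_bij)

lemma bij_x_gen: "bij (x_gen n)"
  using x_gen_unit_bij by (simp add: unit_bij_def)

lemma inv_funpow: fixes f :: "'a \<Rightarrow> 'a" shows "bij f \<Longrightarrow> inv (f ^^ n) = inv f ^^ n"
proof (induction n)
  case (Suc n)
  then have "inv (f \<circ> f ^^ n) = inv f ^^ n \<circ> inv f"
    by (simp add: o_inv_distrib bij_betw_funpow)
  then show ?case by (simp only: funpow.simps funpow_Suc_right[symmetric])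
qed (simp add: inv_id[unfolded id_def] id_def)

lemma pos_word_Cons: "pos_word ((j, s) # qs) = (x_gen j ^^ s) \<circ> pos_word qs"
  by (simp add: pos_word_def)

lemma bij_pos_word: "bij (pos_word ps)"
proof (induction ps)
  case (Cons p ps)
  obtain j s where p: "p = (j, s)" by fastforce
  show ?case unfolding p pos_word_Cons
    by (rule bij_comp[OF Cons bij_betw_funpow[OF bij_x_gen]])
qed (simp add: pos_word_def flip: id_def)

lemma neg_word_eq_inv: "neg_word qs = inv (pos_word qs)"
proof -
  have "fold (\<lambda>(j, s) f. (inv (x_gen j) ^^ s) \<circ> f) qs h = inv (pos_word qs) \<circ> h" for h
  proof (induction qs arbitrary: h)
    case (Cons q qs)
    obtain j s where q: "q = (j, s)" by fastforce
    have "inv (pos_word (q # qs)) = inv (pos_word qs) \<circ> inv (x_gen j) ^^ s"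
      unfolding q pos_word_Cons
      by (subst o_inv_distrib) (auto simp: inv_funpow bij_x_gen bij_pos_word intro!: bij_betw_funpow)
    then show ?case using Cons by (simp add: q o_assoc)
  qed (simp add: pos_word_def)
  from this[of id] show ?thesis unfolding neg_word_def by (simp only: comp_id)
qed

text \<open>Positive words carry S to U and V to T without rotating leaves, and g supplies the rotation. For
  right combs U and V this is the normal form; another choice of U and V gives the short word
  for the upper bound.\<close>

lemma diagram_factorization:
  assumes "represents (S, T, m) w" "tree_pair (S, T, m)" "\<And>t. t \<notin> {0..<1} \<Longrightarrow> w t = t"
    and "represents (U, V, m) g" "tree_pair (U, V, m)" "\<And>t. t \<notin> {0..<1} \<Longrightarrow> g t = t"
    and "num_leaves U = num_leaves S"
  shows "w = pos_word (exponents T) \<circ> inv (pos_word (exponents V)) \<circ> g \<circ>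
      pos_word (exponents U) \<circ> inv (pos_word (exponents S))"
proof -
  let ?R = "comb (carets S)"
  have c: "carets T = carets S" "carets U = carets S" "carets V = carets S" and m: "m < num_leaves S"
    using assms(2,5,7) by (auto simp: tree_pair_def num_leaves_carets)
  then have n: "num_leaves T = num_leaves S" "num_leaves V = num_leaves S" "num_leaves ?R = num_leaves S"
    by (simp_all add: num_leaves_carets)
  have tp: "tree_pair (X, Y, k)" if "carets X = carets S" "carets Y = carets S" "k < num_leaves S" for X Y k
    using that by (simp add: tree_pair_def num_leaves_carets)
  have "represents (S, U, (0 + 0) mod num_leaves U) (pos_word (exponents U) \<circ> inv (pos_word (exponents S)))"
    by (rule represents_comp[OF pos_word_inv_represents]) (use pos_word_represents[of U] c tp in auto)
  then have 1: "represents (S, U, 0) (pos_word (exponents U) \<circ> inv (pos_word (exponents S)))" by simp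
  have "represents (V, T, (0 + 0) mod num_leaves T) (pos_word (exponents T) \<circ> inv (pos_word (exponents V)))"
    by (rule represents_comp[OF pos_word_inv_represents]) (use pos_word_represents[of T] c tp in auto)
  then have 2: "represents (V, T, 0) (pos_word (exponents T) \<circ> inv (pos_word (exponents V)))" by simp
  have "represents (S, V, (0 + m) mod num_leaves V)
      (g \<circ> (pos_word (exponents U) \<circ> inv (pos_word (exponents S))))"
    by (rule represents_comp[OF 1 assms(4)]) (use c m tp in auto)
  then have 3: "represents (S, V, m) (g \<circ> (pos_word (exponents U) \<circ> inv (pos_word (exponents S))))"
    using m n by simp
  have "represents (S, T, (m + 0) mod num_leaves T) (pos_word (exponents T) \<circ> inv (pos_word (exponents V)) \<circ>
      (g \<circ> (pos_word (exponents U) \<circ> inv (pos_word (exponents S)))))"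
    by (rule represents_comp[OF 3 2]) (use c m tp in auto)
  then have 4: "represents (S, T, m) (pos_word (exponents T) \<circ> inv (pos_word (exponents V)) \<circ> g \<circ>
      pos_word (exponents U) \<circ> inv (pos_word (exponents S)))"
    using m n by (simp add: o_assoc)
  have inv: "inv (pos_word (exponents X)) t = t" if "t \<notin> {0..<1}" for X t
    by (rule inv_outside[OF bij_pos_word pos_word_outside that])
  show ?thesis
  proof (rule represents_unique[OF assms(1) 4 assms(3)])
    fix t :: real assume t: "t \<notin> {0..<1}"
    show "(pos_word (exponents T) \<circ> inv (pos_word (exponents V)) \<circ> g \<circ>
        pos_word (exponents U) \<circ> inv (pos_word (exponents S))) t = t"
      by (simp only: o_apply inv[OF t] pos_word_outside[OF t] assms(6)[OF t])
  qed
qed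

lemma represents_at_0:
  assumes "represents (S, T, m) w" "tree_pair (S, T, m)"
  shows "w 0 = fst (leaves T 0 1 ! m)"
proof -
  have "0 < num_leaves S" by simp
  then have a: "affine_onto w (leaves S 0 1 ! 0) (leaves T 0 1 ! m)"
    using assms unfolding represents_iff tree_pair_def by (metis (mono_tags, lifting) add_0 case_prod_conv mod_less)
  have "fst (leaves S 0 1 ! 0) = 0" using fst_hd_leaves[of S 0 1] by (simp add: hd_conv_nth)
  then show ?thesis using affine_ontoD[OF a, of 0] nth_leaves_bounds[of 0 S] by simp
qed

lemma nth_leaves_fst_inject:
  assumes "k < num_leaves t" "k' < num_leaves t" "fst (leaves t 0 1 ! k) = fst (leaves t 0 1 ! k')"
  shows "k = k'"
  by (rule nth_leaves_eqI[OF assms(1,2), of "fst (leaves t 0 1 ! k)"])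
    (use assms(3) nth_leaves_bounds[OF assms(1)] nth_leaves_bounds[OF assms(2)] in auto)

lemma thompson_F_iff_mark:
  assumes "w \<in> thompson_T" "represents (S, T, m) w" "tree_pair (S, T, m)"
  shows "w \<in> thompson_F \<longleftrightarrow> m = 0"
proof -
  have 0: "fst (leaves T 0 1 ! 0) = 0" using fst_hd_leaves[of T 0 1] by (simp add: hd_conv_nth)
  have "w \<in> thompson_F \<longleftrightarrow> fst (leaves T 0 1 ! m) = fst (leaves T 0 1 ! 0)"
    using represents_at_0[OF assms(2,3)] assms(1) 0 by (simp add: thompson_F_def)
  also have "\<dots> \<longleftrightarrow> m = 0"
    using nth_leaves_fst_inject[of m T 0] assms(3) by (auto simp: tree_pair_def)
  finally show ?thesis .
qed

text \<open>Each factor lowers the position of a leaf by one, so leaf 0 reaches position n + 2 - j.\<close>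

lemma c_gen_power_mark:
  assumes "1 \<le> j" "j < n + 2"
  shows "represents (comb (Suc n), comb (Suc n), n + 2 - j) (c_gen n ^^ j)"
proof -
  obtain j' where j: "j = Suc j'" using assms(1) by (cases j) auto
  have "j * Suc n = (n + 2 - j) + j' * Suc (Suc n)"
    using assms(2) by (simp add: j algebra_simps)
  then have "(j * Suc n) mod Suc (Suc n) = (n + 2 - j) mod Suc (Suc n)" by (simp only: mod_mult_self1)
  also have "\<dots> = n + 2 - j" using j by simp
  finally show ?thesis using c_gen_power_represents[of n j] by (simp only:)
qed

lemma c_gen_power_inject:
  assumes "1 \<le> j" "j < n + 2" "1 \<le> j'" "j' < n + 2" "c_gen n ^^ j = c_gen n ^^ j'"
  shows "j = j'"
proof -
  have tp: "tree_pair (comb (Suc n), comb (Suc n), n + 2 - j)" if "1 \<le> j" for j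
    using that by (simp add: tree_pair_def del: comb.simps)
  have "n + 2 - j = n + 2 - j'"
    by (rule nth_leaves_fst_inject[of _ "comb (Suc n)"])
      (use assms represents_at_0[OF c_gen_power_mark[OF assms(1,2)] tp]
        represents_at_0[OF c_gen_power_mark[OF assms(3,4)] tp] in \<open>auto simp del: comb.simps\<close>)
  then show ?thesis using assms by simp
qed

lemma thompson_outside: "w \<in> thompson_T \<Longrightarrow> t \<notin> {0..<1} \<Longrightarrow> w t = t"
  by (simp add: thompson_T_def)

lemma bij_comp_cancel:
  assumes "bij p" "bij q" "p \<circ> f \<circ> q = p \<circ> g \<circ> q"
  shows "f = g"
proof
  fix x
  obtain y where y: "x = q y" using bij_is_surj[OF assms(2)] by (auto simp: surj_def)
  have "p (f (q y)) = p (g (q y))" using fun_cong[OF assms(3), of y] by simp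
  then show "f x = g x" using bij_is_inj[OF assms(1)] y by (auto dest: injD)
qed

text \<open>The trees prescribe the two positive words, and what lies between them is the rotation of a right
  comb by the mark, a power of \<open>c_gen\<close>. After cancelling the positive words, its exponent
  can be read off from the image of 0.\<close>

lemma normal_form_eq:
  assumes w: "w \<in> thompson_T" and rd: "reduced_diagram w = (S, T, m)"
    and tp: "tree_pair (S, T, m)" and rep: "represents (S, T, m) w"
  shows "normal_form w = (exponents T,
    if m = 0 then None else Some (carets S - 1, num_leaves S - m), exponents S)"
proof -
  have n: "carets T = carets S" "m < num_leaves S" using tp by (auto simp: tree_pair_def num_leaves_carets)
  have st: "source_tree w = S" "target_tree w = T" "caret_number w = carets S"
    using rd by (simp_all add: source_tree_def target_tree_def caret_number_def)
  define cp where "cp = (if m = 0 then None else Some (carets S - 1, num_leaves S - m))"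
  let ?R = "comb (carets S)"
  have tpR: "tree_pair (?R, ?R, m)" using n by (simp add: tree_pair_def num_leaves_carets)
  have c: "represents (?R, ?R, m) (cyc_word cp)"
  proof (cases "m = 0")
    case True
    then show ?thesis by (auto simp: cp_def cyc_word_def represents_iff intro: affine_onto_id)
  next
    case False
    then obtain i where i: "carets S = Suc i" using n by (cases "carets S") (auto simp: num_leaves_carets)
    have "represents (comb (Suc i), comb (Suc i), i + 2 - (i + 2 - m)) (c_gen i ^^ (i + 2 - m))"
      by (rule c_gen_power_mark) (use False n i in \<open>auto simp: num_leaves_carets\<close>)
    then show ?thesis using False n i
      by (simp add: cp_def cyc_word_def num_leaves_carets del: comb.simps)
  qed
  have off: "cyc_word cp t = t" if "t \<notin> {0..<1}" for t
    using that by (auto simp: cyc_word_def c_gen_power_outside split: option.split)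
  have R1: "pos_word (exponents ?R) = id"
  proof -
    have "outer_exps (comb k) = replicate (Suc k) 0" for k by (induction k) auto
    then show ?thesis by (simp add: pos_word_exponents xprod_replicate_0 del: replicate_Suc)
  qed
  have weq: "w = pos_word (exponents T) \<circ> cyc_word cp \<circ> neg_word (exponents S)"
    using diagram_factorization[OF rep tp thompson_outside[OF w] c tpR off]
    by (simp add: R1 neg_word_eq_inv num_leaves_carets)
  have nf: "has_normal_form w (exponents T, cp, exponents S)"
    unfolding has_normal_form_def prod.case st
    using weq thompson_F_iff_mark[OF w rep tp] n
    by (intro conjI refl) (auto simp: cp_def num_leaves_carets)
  have "nf' = (exponents T, cp, exponents S)" if nf': "has_normal_form w nf'" for nf'
  proof -
    obtain ps cp' qs where e: "nf' = (ps, cp', qs)" by (cases nf')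
    have nf'_eq: "w = pos_word ps \<circ> cyc_word cp' \<circ> neg_word qs"
      and ps: "ps = exponents T" "qs = exponents S"
      and cp': "case cp' of None \<Rightarrow> w \<in> thompson_F
        | Some (i, j) \<Rightarrow> w \<notin> thompson_F \<and> carets S = i + 1 \<and> 1 \<le> j \<and> j < i + 2"
      using nf' unfolding e has_normal_form_def prod.case st by blast+
    have "cp' = cp"
    proof (cases "m = 0")
      case True
      then show ?thesis using cp' thompson_F_iff_mark[OF w rep tp]
        by (auto simp: cp_def split: option.splits)
    next
      case False
      then have F: "w \<notin> thompson_F" using thompson_F_iff_mark[OF w rep tp] by simp
      obtain j where j: "cp' = Some (carets S - 1, j)" "1 \<le> j" "j < carets S - 1 + 2"
        using cp' F by (auto split: option.splits)
      define j0 where "j0 = num_leaves S - m"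
      have j0: "cp = Some (carets S - 1, j0)" "1 \<le> j0" "j0 < carets S - 1 + 2"
        using False n by (auto simp: cp_def j0_def num_leaves_carets)
      have "pos_word (exponents T) \<circ> cyc_word cp' \<circ> neg_word (exponents S) =
          pos_word (exponents T) \<circ> cyc_word cp \<circ> neg_word (exponents S)"
        using nf'_eq weq unfolding ps by (rule trans[OF sym])
      then have "cyc_word cp' = cyc_word cp"
        by (rule bij_comp_cancel[rotated 2])
          (simp_all add: bij_pos_word bij_imp_bij_inv neg_word_eq_inv)
      then have "c_gen (carets S - 1) ^^ j = c_gen (carets S - 1) ^^ j0"
        by (simp add: j j0 cyc_word_def)
      then have "j = j0" by (rule c_gen_power_inject[OF j(2,3) j0(2,3)])
      then show ?thesis by (simp add: j j0)
    qed
    then show ?thesis using e ps by simp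
  qed
  then show ?thesis unfolding normal_form_def cp_def[symmetric]
    using nf by (intro the_equality) blast+
qed

section \<open>Comparing D with the number of carets\<close>

lemma sum_exponents: "sum_list (map snd (exponents t)) = sum_list (outer_exps t)"
proof -
  have "sum_list (map snd (filter (\<lambda>(i, r). 0 < r) (List.enumerate a es))) = sum_list es"
    for a and es :: "nat list"
    by (induction es arbitrary: a) auto
  then show ?thesis by (simp add: exponents_eq)
qed

lemma exponents_iff: "(i, r) \<in> set (exponents t) \<longleftrightarrow> i < num_leaves t \<and> r = outer_exps t ! i \<and> 0 < r"
  by (auto simp: exponents_eq in_set_enumerate_eq length_outer_exps)

lemma sorted_exponents: "sorted_wrt (<) (map fst (exponents t))"
proof -
  have "sorted_wrt (<) (map fst (List.enumerate 0 (outer_exps t)))"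
    by (simp add: sorted_wrt_iff_nth_less)
  then show ?thesis unfolding exponents_eq
    by (metis sorted_wrt_filter sorted_wrt_map)
qed

lemma last_index_ge:
  assumes "(i, r) \<in> set (exponents t)"
  shows "i \<le> last_index (exponents t)"
proof -
  have ne: "exponents t \<noteq> []" using assms by auto
  have eq: "map fst (exponents t) = map fst (butlast (exponents t)) @ [fst (last (exponents t))]"
    by (metis append_butlast_last_id list.simps(8,9) map_append ne)
  have "i \<in> set (map fst (exponents t))" using assms by force
  then have "i = fst (last (exponents t)) \<or> i \<in> set (map fst (butlast (exponents t)))"
    unfolding eq by auto
  moreover have "sorted_wrt (<) (map fst (butlast (exponents t)) @ [fst (last (exponents t))])"
    using sorted_exponents[of t] by (simp only: eq)
  ultimately have "i \<le> fst (last (exponents t))"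
    by (auto simp: sorted_wrt_append)
  then show ?thesis using ne by (simp add: last_index_def)
qed

lemma last_index_le: "last_index (exponents t) \<le> carets t"
proof (cases "exponents t = []")
  case False
  then have "(fst (last (exponents t)), snd (last (exponents t))) \<in> set (exponents t)" by simp
  then show ?thesis using False unfolding exponents_iff
    by (simp add: last_index_def num_leaves_carets)
qed (simp add: last_index_def)

text \<open>If the lowest caret of the right side is not exposed, its left child carries a leaf with positive
  exponent, and each caret of the right side above it has a leaf further left.\<close>

lemma right_carets_bound:
  assumes "t \<noteq> Leaf" "num_leaves t - 2 \<notin> exposed t"
  shows "\<exists>i < num_leaves t. 0 < outer_exps t ! i \<and> right_carets t \<le> i + 1"
  using assms
proof (induction t)
  case (Caret l r)
  show ?case
  proof (cases "r = Leaf")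
    case True
    then have "l \<noteq> Leaf" using Caret.prems by auto
    then obtain l1 l2 where "l = Caret l1 l2" by (cases l) auto
    then show ?thesis using True by (intro exI[of _ 0]) auto
  next
    case False
    then have "2 \<le> num_leaves r" by (cases r) (auto simp: num_leaves_carets)
    then have "num_leaves (Caret l r) - 2 = num_leaves l + (num_leaves r - 2)" by simp
    then have "num_leaves r - 2 \<notin> exposed r" using Caret.prems(2) False by auto
    then obtain i where i: "i < num_leaves r" "0 < outer_exps r ! i" "right_carets r \<le> i + 1"
      using Caret.IH(2) False by blast
    have "num_leaves l + i < num_leaves (Caret l r)" using i by simp
    moreover have "outer_exps (Caret l r) ! (num_leaves l + i) = outer_exps r ! i"
      by (simp add: nth_append length_inner_exps)
    moreover have "right_carets (Caret l r) \<le> num_leaves l + i + 1"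
      using i(3) num_leaves_pos[of l] by (simp del: num_leaves_pos)
    ultimately show ?thesis using i(2) by metis
  qed
qed simp

lemma carets_bound:
  assumes "t \<noteq> Leaf" "num_leaves t - 2 \<notin> exposed t"
  shows "carets t \<le> 2 * (sum_list (map snd (exponents t)) + last_index (exponents t))"
proof -
  obtain i where i: "i < num_leaves t" "0 < outer_exps t ! i" "right_carets t \<le> i + 1"
    using right_carets_bound[OF assms] by blast
  have "i \<le> last_index (exponents t)"
    by (rule last_index_ge[of i "outer_exps t ! i"]) (simp add: exponents_iff i)
  moreover have "1 \<le> sum_list (outer_exps t)"
    using member_le_sum_list[of "outer_exps t ! i" "outer_exps t"] i
    by (simp add: length_outer_exps)
  ultimately show ?thesis
    using sum_outer_exps[of t] i(3) by (simp add: sum_exponents)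
qed

lemma D_est_eq:
  assumes "w \<in> thompson_T" "reduced_diagram w = (S, T, m)" "tree_pair (S, T, m)"
    "represents (S, T, m) w"
  shows "D_est w = sum_list (map snd (exponents T)) + sum_list (map snd (exponents S)) +
      last_index (exponents T) + last_index (exponents S) + (if m = 0 then 0 else carets S - 1)"
  by (simp add: D_est_def normal_form_eq[OF assms])

lemma D_est_le:
  assumes w: "w \<in> thompson_T"
  shows "D_est w \<le> 5 * caret_number w"
proof -
  obtain S T m where d: "reduced_diagram w = (S, T, m)"
    "tree_pair (S, T, m)" "represents (S, T, m) w"
    using reduced_diagram_props[OF w] .
  have c: "caret_number w = carets S" "carets T = carets S"
    using d by (simp_all add: caret_number_def source_tree_def tree_pair_def num_leaves_carets)
  show ?thesis
    unfolding D_est_eq[OF w d] sum_exponents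
    using sum_outer_exps[of T] sum_outer_exps[of S] last_index_le[of T] last_index_le[of S] c
    by (cases "m = 0") simp_all
qed

text \<open>For elements of F the mark is 0, and a reduced diagram cannot have both of its right sides ending
  in an exposed caret, as these two would cancel. The tree whose right side ends differently
  bounds the number of carets by its exponents and its last index. Outside F the index of the c
  term is one less than the number of carets; it vanishes only for a single caret, that is for
  \<open>c_gen 0\<close>.\<close>

lemma caret_number_le_D_est:
  assumes w: "w \<in> thompson_T" and ne: "w \<noteq> c_gen 0"
  shows "caret_number w \<le> 2 * D_est w"
proof -
  obtain S T m where d: "reduced_diagram w = (S, T, m)"
    "tree_pair (S, T, m)" "represents (S, T, m) w" and red: "reduced (S, T, m)"
    using reduced_diagram_props[OF w] .
  have c: "caret_number w = carets S" "carets T = carets S" and m: "m < num_leaves S"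
    using d by (simp_all add: caret_number_def source_tree_def tree_pair_def num_leaves_carets)
  note D = D_est_eq[OF w d]
  consider "m = 0" "S = Leaf" | "m = 0" "S \<noteq> Leaf" | "m \<noteq> 0" "2 \<le> carets S" | "m \<noteq> 0" "carets S \<le> 1"
    by linarith
  then show ?thesis
  proof cases
    case 1
    then show ?thesis using c by simp
  next
    case 2
    then have "T \<noteq> Leaf" using c(2) by (cases S) auto
    have "num_leaves S = num_leaves T" using c by (simp add: num_leaves_carets)
    moreover have "\<not> (num_leaves S - 2 \<in> exposed S \<and> (num_leaves S - 2 + m) mod num_leaves T \<in> exposed T)"
      using red by (auto simp: reduced_def)
    moreover have "(num_leaves S - 2) mod num_leaves T = num_leaves S - 2"
      using c by (simp add: num_leaves_carets)
    ultimately have "num_leaves S - 2 \<notin> exposed S \<or> num_leaves T - 2 \<notin> exposed T"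
      using 2 by simp
    then have "carets S \<le> 2 * (sum_list (map snd (exponents S)) + last_index (exponents S)) \<or>
        carets S \<le> 2 * (sum_list (map snd (exponents T)) + last_index (exponents T))"
      using carets_bound[of S] carets_bound[of T] 2 \<open>T \<noteq> Leaf\<close> c by auto
    then show ?thesis using c D by auto
  next
    case 3
    then show ?thesis using c D by simp
  next
    case 4
    with m have "carets S = 1" "m = 1" by (auto simp: num_leaves_carets)
    have *: "t = Caret Leaf Leaf" if t: "carets t = 1" for t
    proof -
      obtain l r where t': "t = Caret l r" using t by (cases t) auto
      with t have "carets l = 0" "carets r = 0" by auto
      then show ?thesis using t' by (cases l; cases r) auto
    qed
    have "S = Caret Leaf Leaf" "T = Caret Leaf Leaf" using \<open>carets S = 1\<close> c * by auto
    then have "represents (comb (Suc 0), comb (Suc 0), Suc 0) w" using d \<open>m = 1\<close> by simp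
    then have "w = c_gen 0"
      using represents_unique[OF _ c_gen_represents thompson_outside[OF w] c_gen_outside] by blast
    with ne show ?thesis by simp
  qed
qed


section \<open>Word length\<close>

text \<open>Unlike a bound on \<open>word_length\<close>, which is a least number and unspecified for maps that are
  not words, this asserts that a word exists.\<close>

definition len_le :: "('a \<Rightarrow> 'a) set \<Rightarrow> nat \<Rightarrow> ('a \<Rightarrow> 'a) \<Rightarrow> bool" where
  "len_le A n g \<longleftrightarrow> (\<exists>us. length us \<le> n \<and> set us \<subseteq> A \<union> inv ` A \<and> foldr (\<circ>) us id = g)"

lemma foldr_comp_append: "foldr (\<circ>) (us @ vs) id = foldr (\<circ>) us id \<circ> foldr (\<circ>) vs id"
  by (induction us) (auto simp: o_assoc)

lemma len_le_comp: "len_le A n f \<Longrightarrow> len_le A m g \<Longrightarrow> len_le A (n + m) (f \<circ> g)"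
proof -
  assume "len_le A n f" "len_le A m g"
  then obtain us vs where "length us \<le> n" "set us \<subseteq> A \<union> inv ` A" "foldr (\<circ>) us id = f"
    "length vs \<le> m" "set vs \<subseteq> A \<union> inv ` A" "foldr (\<circ>) vs id = g"
    unfolding len_le_def by blast
  then show ?thesis unfolding len_le_def
    by (intro exI[of _ "us @ vs"]) (simp add: foldr_comp_append del: foldr_append)
qed

lemma len_le_id: "len_le A n id"
  unfolding len_le_def by (rule exI[of _ "[]"]) simp

lemma len_le_gen: "f \<in> A \<union> inv ` A \<Longrightarrow> len_le A 1 f"
  unfolding len_le_def by (rule exI[of _ "[f]"]) simp

lemma len_le_mono: "len_le A n f \<Longrightarrow> n \<le> m \<Longrightarrow> len_le A m f"
  unfolding len_le_def using order_trans by blast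

lemma len_le_funpow: "len_le A 1 f \<Longrightarrow> len_le A k (f ^^ k)"
proof (induction k)
  case (Suc k)
  then show ?case using len_le_comp[OF Suc.prems Suc.IH[OF Suc.prems]] by (simp del: o_apply)
qed (simp add: len_le_id flip: id_def)

lemma len_le_inv:
  assumes "len_le A n f" "\<And>g. g \<in> A \<Longrightarrow> bij g"
  shows "len_le A n (inv f)"
proof -
  obtain us where us: "length us \<le> n" "set us \<subseteq> A \<union> inv ` A" "foldr (\<circ>) us id = f"
    using assms(1) unfolding len_le_def by blast
  have b: "bij g" if "g \<in> A \<union> inv ` A" for g
    using that assms(2) bij_imp_bij_inv by auto
  have "bij (foldr (\<circ>) us id) \<and> inv (foldr (\<circ>) us id) = foldr (\<circ>) (rev (map inv us)) id"
    using us(2)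
  proof (induction us)
    case (Cons u us)
    then have IH: "bij (foldr (\<circ>) us id)" "inv (foldr (\<circ>) us id) = foldr (\<circ>) (rev (map inv us)) id"
      by (meson set_subset_Cons subset_trans)+
    have u: "bij u" using b Cons.prems by simp
    have "bij (u \<circ> foldr (\<circ>) us id)" by (rule bij_comp[OF IH(1) u])
    moreover have "inv (u \<circ> foldr (\<circ>) us id) = inv (foldr (\<circ>) us id) \<circ> inv u"
      by (rule o_inv_distrib[OF u IH(1)])
    moreover have "foldr (\<circ>) (rev (map inv (u # us))) id = foldr (\<circ>) (rev (map inv us)) id \<circ> inv u"
      by (simp only: list.map rev.simps foldr_comp_append) simp
    moreover have "foldr (\<circ>) (u # us) id = u \<circ> foldr (\<circ>) us id" by simp
    ultimately show ?case by (simp only: IH(2))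
  qed simp
  moreover have "inv g \<in> A \<union> inv ` A" if "g \<in> A \<union> inv ` A" for g
    using that assms(2) by (auto simp: inv_inv_eq)
  then have "inv ` set us \<subseteq> A \<union> inv ` A" using us(2) by blast
  ultimately show ?thesis unfolding len_le_def using us(1,3)
    by (intro exI[of _ "rev (map inv us)"]) simp
qed

lemma word_length_le: "len_le A n g \<Longrightarrow> word_length A g \<le> n"
  unfolding len_le_def word_length_def using Least_le order_trans by (metis (mono_tags, lifting))

lemma word_length_attained:
  assumes "len_le A n g"
  obtains us where "length us = word_length A g" "set us \<subseteq> A \<union> inv ` A" "foldr (\<circ>) us id = g"
proof -
  have "\<exists>k us. length us = k \<and> set us \<subseteq> A \<union> inv ` A \<and> foldr (\<circ>) us id = g"
    using assms unfolding len_le_def by blast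
  from LeastI_ex[OF this] show ?thesis using that unfolding word_length_def by blast
qed

section \<open>The lower bound for word length\<close>

abbreviation gens :: "(real \<Rightarrow> real) set" where
  "gens \<equiv> {x_gen 0, x_gen 1, c_gen 1}"

lemma gens_unit_bij: "g \<in> gens \<Longrightarrow> unit_bij g"
  using x_gen_unit_bij c_gen_unit_bij by blast

lemma gens_bij: "g \<in> gens \<Longrightarrow> bij g"
  using gens_unit_bij by (auto simp: unit_bij_def)

lemma letter_unit_bij: "g \<in> gens \<union> inv ` gens \<Longrightarrow> unit_bij g"
  using gens_unit_bij unit_bij_inv by blast

text \<open>The largest diagram of a letter is that of \<open>x_gen 1\<close>, with three carets and four leaves.\<close>

lemma letter_good_part:
  assumes "g \<in> gens \<union> inv ` gens"
  obtains P where "good_part g P" "card P \<le> 4"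
proof -
  have gen: "\<exists>P. good_part g P \<and> card P \<le> 4" if "g \<in> gens" for g
  proof -
    have x: "\<exists>P. good_part (x_gen n) P \<and> card P = n + 3" for n
    proof (intro exI conjI)
      show "good_part (x_gen n) (set (leaves (comb (carets (hook n))) 0 1))"
        unfolding x_gen_eq_pos_word by (rule good_part_of_diagram[OF pos_word_represents tree_pair_comb])
      show "card (set (leaves (comb (carets (hook n))) 0 1)) = n + 3"
        unfolding card_leaves num_leaves_comb carets_hook by simp
    qed
    have c: "good_part (c_gen 1) (set (leaves (comb (Suc 1)) 0 1))"
      by (rule good_part_of_diagram[OF c_gen_represents tree_pair_c_gen])
    have "card (set (leaves (comb (Suc 1)) 0 1)) = 3" by (simp only: card_leaves num_leaves_comb)
    then show ?thesis using that x[of 0] x[of 1] c by fastforce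
  qed
  show ?thesis
  proof (cases "g \<in> gens")
    case True
    then show ?thesis using gen that by blast
  next
    case False
    then obtain h where h: "h \<in> gens" "g = inv h" using assms by blast
    obtain P where P: "good_part h P" "card P \<le> 4" using gen[OF h(1)] by blast
    obtain Q where "good_part (inv h) Q" "card Q = card P"
      using good_part_inv[OF gens_unit_bij[OF h(1)] P(1)] .
    then show ?thesis using that P h by simp
  qed
qed

lemma word_good_part:
  "set us \<subseteq> gens \<union> inv ` gens \<Longrightarrow>
     unit_bij (foldr (\<circ>) us id) \<and> (\<exists>P. good_part (foldr (\<circ>) us id) P \<and> card P \<le> 4 * length us + 1)"
proof (induction us)
  case Nil
  have "card {unit_ivl} \<le> 4 * length [] + 1" by simp
  then have "\<exists>P. good_part id P \<and> card P \<le> 4 * length [] + 1" using good_part_id by blast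
  moreover have "foldr (\<circ>) [] id = (id :: real \<Rightarrow> real)" by simp
  ultimately show ?case using unit_bij_id by (simp only: list.size)
next
  case (Cons u us)
  obtain P where IH: "unit_bij (foldr (\<circ>) us id)" "good_part (foldr (\<circ>) us id) P"
    "card P \<le> 4 * length us + 1" using Cons.IH Cons.prems by (meson set_subset_Cons subset_trans)
  have u: "u \<in> gens \<union> inv ` gens" using Cons.prems by simp
  obtain Q where Q: "good_part u Q" "card Q \<le> 4" using letter_good_part[OF u] .
  obtain R where R: "good_part (u \<circ> foldr (\<circ>) us id) R" "card R \<le> card P + card Q"
    using good_part_comp[OF IH(1,2) Q(1)] .
  have "card R \<le> 4 * length (u # us) + 1" using R(2) IH(3) Q(2) by simp
  moreover have "foldr (\<circ>) (u # us) id = u \<circ> foldr (\<circ>) us id" by simp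
  ultimately show ?case using R(1) unit_bij_comp[OF IH(1) letter_unit_bij[OF u]] by metis
qed

lemma caret_number_le:
  assumes w: "w \<in> thompson_T" and "len_le gens n w"
  shows "caret_number w \<le> 4 * word_length gens w"
proof -
  obtain us where us: "length us = word_length gens w" "set us \<subseteq> gens \<union> inv ` gens"
    "foldr (\<circ>) us id = w" using word_length_attained[OF assms(2)] .
  obtain P where P: "good_part w P" "card P \<le> 4 * word_length gens w + 1"
    using word_good_part[OF us(2)] us(1,3) by auto
  obtain S T m where "reduced_diagram w = (S, T, m)" "num_leaves S \<le> card P"
    using reduced_diagram_props[OF w] P(1) by metis
  then show ?thesis using P(2) by (simp add: caret_number_def source_tree_def num_leaves_carets)
qed


section \<open>The upper bound for word length\<close>

text \<open>Each generator is the previous one, scaled down to the right half of the interval.\<close>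

lemma x_gen_Suc: "x_gen (Suc n) t = (if t \<in> {1/2..1} then (1 + x_gen n (2 * t - 1)) / 2 else t)"
proof -
  define s :: real where "s = 1 / 2 ^ n"
  have s: "0 < s" "s \<le> 1" "2 ^ n = 1 / s" by (simp_all add: s_def)
  have s': "2 ^ Suc n = 2 / s" using s(3) by simp
  have arg: "2 ^ Suc n * (t - 1 + 1 / 2 ^ Suc n) = 2 ^ n * (2 * t - 1 - 1 + 1 / 2 ^ n)"
    using s(1) unfolding s' s(3) by (simp add: field_simps)
  show ?thesis
  proof (cases "t \<in> {1 - s / 2..1}")
    case True
    define z where "z = x_zero (2 ^ n * (2 * t - 1 - 1 + 1 / 2 ^ n))"
    have "t \<in> {1 - 1 / 2 ^ Suc n..1}" using True by (simp add: s_def)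
    then have "x_gen (Suc n) t = 1 - 1 / 2 ^ Suc n + z / 2 ^ Suc n"
      unfolding x_gen_def arg z_def[symmetric] by simp
    moreover have "2 * t - 1 \<in> {1 - 1 / 2 ^ n..1}" using True by (simp add: s_def)
    then have "x_gen n (2 * t - 1) = 1 - 1 / 2 ^ n + z / 2 ^ n"
      unfolding x_gen_def z_def[symmetric] by simp
    moreover have "t \<in> {1/2..1}" using True s(2) by simp
    moreover have "(1 + (1 - 1 / 2 ^ n + z / 2 ^ n)) / 2 = 1 - 1 / 2 ^ Suc n + z / 2 ^ Suc n"
      by (simp add: field_simps)
    ultimately show ?thesis by simp
  next
    case False
    then have "t \<notin> {1 - 1 / 2 ^ Suc n..1}" "2 * t - 1 \<notin> {1 - 1 / 2 ^ n..1}" by (simp_all add: s_def)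
    then have "x_gen (Suc n) t = t" "x_gen n (2 * t - 1) = 2 * t - 1"
      unfolding x_gen_def by (simp_all only: if_False)
    then show ?thesis by simp
  qed
qed

text \<open>From index 2 on, conjugation by \<open>x_gen 0\<close> lowers the index of a generator by one, because
  \<open>x_gen 0\<close> stretches the interval on which it acts by the factor 2.\<close>

lemma x_gen_shift: "x_gen 0 \<circ> x_gen (Suc (Suc n)) = x_gen (Suc n) \<circ> x_gen 0"
proof
  fix t :: real
  have l: "lft (Suc (Suc 0)) = 3 / 4" by (simp add: lft_def)
  consider "t < 3 / 4" | "3 / 4 \<le> t" "t < 1" | "1 \<le> t" by linarith
  then show "(x_gen 0 \<circ> x_gen (Suc (Suc n))) t = (x_gen (Suc n) \<circ> x_gen 0) t"
  proof cases
    case 1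
    have "lft (Suc (Suc 0)) \<le> lft (Suc (Suc n))" "lft 1 \<le> lft (Suc n)" by (rule lft_mono, simp)+
    then have b: "t < lft (Suc (Suc n))" "1 / 2 \<le> lft (Suc n)" using 1 unfolding l lft_1 by simp_all
    have "x_gen 0 t < 1 / 2"
      using 1 x_gen_outside[of t 0] x_gen_branches(1)[of 0 t] x_gen_branches(2)[of 0 t] l lft_1
      by (cases "t < 0"; cases "t < 1 / 2") auto
    then show ?thesis using b by (simp add: x_gen_outside)
  next
    case 2
    have h: "x_gen (Suc (Suc n)) t = (1 + x_gen (Suc n) (2 * t - 1)) / 2" using 2 by (simp add: x_gen_Suc)
    have u: "2 * t - 1 \<in> {1 / 2..<1}" using 2 by auto
    have "x_gen (Suc n) (2 * t - 1) \<in> {1 / 2..<1}"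
    proof -
      have "x_gen n (4 * t - 3) \<in> {0..<1}"
        using x_gen_unit_bij[of n] 2 by (auto simp: unit_bij_def)
      then show ?thesis using u 2 x_gen_Suc[of n "2 * t - 1"] by auto
    qed
    then have "x_gen 0 (x_gen (Suc (Suc n)) t) = x_gen (Suc n) (2 * t - 1)"
      using x_gen_branches(3)[of 0 "x_gen (Suc (Suc n)) t"] by (simp add: h l field_simps)
    then show ?thesis using x_gen_branches(3)[of 0 t] 2 by (simp add: l)
  qed (simp add: x_gen_outside)
qed

lemma c_gen_0_eq: "c_gen 0 = x_gen 0 \<circ> c_gen 1"
proof
  fix t :: real
  show "c_gen 0 t = (x_gen 0 \<circ> c_gen 1) t"
    by (auto simp: c_gen_def x_gen_def x_zero_def field_simps)
qed

lemma len_le_letters: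
  "len_le gens 1 (x_gen 0)" "len_le gens 1 (x_gen 1)" "len_le gens 1 (inv (x_gen 0))"
  by (rule len_le_gen, blast)+

lemma x_gen_0_shift: "x_gen 0 ^^ k \<circ> x_gen (Suc (k + n)) = x_gen (Suc n) \<circ> x_gen 0 ^^ k"
proof (induction k arbitrary: n)
  case (Suc k)
  have "x_gen 0 ^^ Suc k \<circ> x_gen (Suc (Suc k + n)) = x_gen 0 \<circ> (x_gen 0 ^^ k \<circ> x_gen (Suc (k + Suc n)))"
    by (simp add: o_assoc)
  also have "\<dots> = (x_gen 0 \<circ> x_gen (Suc (Suc n))) \<circ> x_gen 0 ^^ k" by (simp only: Suc o_assoc)
  also have "\<dots> = x_gen (Suc n) \<circ> x_gen 0 ^^ Suc k" by (simp only: x_gen_shift funpow.simps o_assoc)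
  finally show ?case .
qed simp

lemma x_gen_0_power_shift: "x_gen 0 ^^ k \<circ> x_gen (Suc k) ^^ r = x_gen 1 ^^ r \<circ> x_gen 0 ^^ k"
proof (induction r)
  case (Suc r)
  have "x_gen 0 ^^ k \<circ> x_gen (Suc k) ^^ Suc r = (x_gen 0 ^^ k \<circ> x_gen (Suc k)) \<circ> x_gen (Suc k) ^^ r"
    by (simp only: funpow.simps o_assoc)
  also have "\<dots> = x_gen 1 \<circ> (x_gen 0 ^^ k \<circ> x_gen (Suc k) ^^ r)"
    using x_gen_0_shift[of k 0] by (simp only: add_0_right One_nat_def o_assoc)
  also have "\<dots> = x_gen 1 ^^ Suc r \<circ> x_gen 0 ^^ k" by (simp only: Suc funpow.simps o_assoc)
  finally show ?case .
qed simp

text \<open>Write each letter as a conjugate of \<open>x_gen 1\<close> by a power of \<open>x_gen 0\<close>. As the indices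
  increase, neighbouring powers cancel up to the difference of the indices. So the total cost of
  conjugation is at most M - a for climbing from a to M, plus M for the power that
  remains at the end.\<close>

lemma telescoping_word:
  assumes "sorted_wrt (<) (map fst ps)" "\<And>i r. (i, r) \<in> set ps \<Longrightarrow> a < i \<and> i \<le> M + 1" "a \<le> M"
  shows "len_le gens (sum_list (map snd ps) + 2 * M - a) (x_gen 0 ^^ a \<circ> pos_word ps)"
  using assms
proof (induction ps arbitrary: a)
  case Nil
  have "len_le gens a (x_gen 0 ^^ a)" by (rule len_le_funpow[OF len_le_letters(1)])
  then show ?case using Nil.prems(3) by (auto simp: pos_word_def intro: len_le_mono)
next
  case (Cons p ps)
  obtain i r where p: "p = (i, r)" by fastforce
  have i: "a < i" "i \<le> M + 1" using Cons.prems(2) p by auto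
  then obtain k where k: "i = Suc k" "a \<le> k" "k \<le> M" by (cases i) auto
  have IH: "len_le gens (sum_list (map snd ps) + 2 * M - k) (x_gen 0 ^^ k \<circ> pos_word ps)"
  proof (rule Cons.IH)
    show "k < i' \<and> i' \<le> M + 1" if "(i', r') \<in> set ps" for i' r'
    proof -
      have "i < i'" using Cons.prems(1) that by (force simp: p)
      then show ?thesis using Cons.prems(2)[of i' r'] that k by auto
    qed
  qed (use Cons.prems k in auto)
  define y where "y = inv (x_gen 0)"
  have y: "y ^^ d \<circ> x_gen 0 ^^ (d + a) = x_gen 0 ^^ a" for d
  proof (induction d)
    case (Suc d)
    have "y \<circ> x_gen 0 = id" using bij_is_inj[OF bij_x_gen] by (simp add: y_def)
    have "y ^^ Suc d \<circ> x_gen 0 ^^ (Suc d + a) = y ^^ d \<circ> (y \<circ> x_gen 0) \<circ> x_gen 0 ^^ (d + a)"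
      by (simp only: funpow_Suc_right[of d y] funpow.simps(2)[of "d + a"] o_assoc add_Suc)
    also have "\<dots> = x_gen 0 ^^ a" by (simp only: \<open>y \<circ> x_gen 0 = id\<close> comp_id Suc)
    finally show ?case .
  qed simp
  have "x_gen 0 ^^ a \<circ> pos_word (p # ps) =
      (y ^^ (k - a) \<circ> x_gen 0 ^^ ((k - a) + a)) \<circ> (x_gen i ^^ r \<circ> pos_word ps)"
    unfolding p pos_word_Cons y ..
  also have "\<dots> = y ^^ (k - a) \<circ> (x_gen 0 ^^ k \<circ> x_gen (Suc k) ^^ r) \<circ> pos_word ps"
    using k by (simp add: o_assoc)
  also have "\<dots> = y ^^ (k - a) \<circ> (x_gen 1 ^^ r \<circ> (x_gen 0 ^^ k \<circ> pos_word ps))"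
    unfolding x_gen_0_power_shift by (simp only: o_assoc)
  finally have eq: "x_gen 0 ^^ a \<circ> pos_word (p # ps) =
      y ^^ (k - a) \<circ> (x_gen 1 ^^ r \<circ> (x_gen 0 ^^ k \<circ> pos_word ps))" .
  have "len_le gens ((k - a) + (r + (sum_list (map snd ps) + 2 * M - k)))
      (x_gen 0 ^^ a \<circ> pos_word (p # ps))"
    unfolding eq y_def
    by (intro len_le_comp len_le_funpow len_le_letters IH)
  then show ?case by (rule len_le_mono) (use k in \<open>simp add: p\<close>)
qed

text \<open>A leading power of \<open>x_gen 0\<close> already consists of generators; the other letters telescope.\<close>

lemma pos_word_len:
  assumes "sorted_wrt (<) (map fst ps)" "\<And>i r. (i, r) \<in> set ps \<Longrightarrow> i \<le> M + 1"
  shows "len_le gens (sum_list (map snd ps) + 2 * M) (pos_word ps)"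
proof (cases "\<exists>r qs. ps = (0, r) # qs")
  case True
  then obtain r qs where ps: "ps = (0, r) # qs" by blast
  have pos: "0 < i" if "(i, r') \<in> set qs" for i r' using assms(1) that by (force simp: ps)
  have "len_le gens (sum_list (map snd qs) + 2 * M - 0) (x_gen 0 ^^ 0 \<circ> pos_word qs)"
    by (rule telescoping_word) (use assms pos ps in auto)
  then have "len_le gens (sum_list (map snd qs) + 2 * M) (pos_word qs)" by (simp flip: id_def)
  from len_le_comp[OF len_le_funpow[OF len_le_letters(1), of r] this]
  show ?thesis by (simp add: ps pos_word_Cons add.assoc)
next
  case False
  have pos: "0 < i" if i: "(i, r) \<in> set ps" for i r
  proof (cases ps)
    case (Cons p qs)
    have "fst p \<noteq> 0" using False Cons by (cases p) auto
    moreover have "i = fst p \<or> fst p < i" using assms(1) i by (force simp: Cons)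
    ultimately show ?thesis by auto
  qed (use i in simp)
  have "len_le gens (sum_list (map snd ps) + 2 * M - 0) (x_gen 0 ^^ 0 \<circ> pos_word ps)"
    by (rule telescoping_word) (use assms pos in auto)
  then show ?thesis by (simp flip: id_def)
qed

lemma tree_word_len: "len_le gens (3 * carets t) (pos_word (exponents t))"
proof -
  have "len_le gens (sum_list (map snd (exponents t)) + 2 * carets t) (pos_word (exponents t))"
    by (rule pos_word_len[OF sorted_exponents]) (simp add: exponents_iff num_leaves_carets)
  moreover have "sum_list (map snd (exponents t)) \<le> carets t"
    using sum_outer_exps[of t] by (simp add: sum_exponents)
  ultimately show ?thesis by (auto intro: len_le_mono)
qed

lemma tree_word_inv_len: "len_le gens (3 * carets t) (inv (pos_word (exponents t)))"
  by (rule len_le_inv[OF tree_word_len gens_bij])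

text \<open>The half turn \<open>c_gen 0\<close> exchanges the two trees below the root. By the choice of these trees it
  realises any nontrivial rotation of the leaves.\<close>

lemma c_gen_0_represents:
  "represents (Caret U V, Caret V U, num_leaves V) (c_gen 0)"
  unfolding represents_iff
proof (intro allI impI)
  fix k assume k: "k < num_leaves (Caret U V)"
  have l: "leaves (comb (Suc 0)) 0 1 = [(0, 1/2), (1/2, 1)]" by simp
  have "affine_onto (c_gen 0) (leaves (comb (Suc 0)) 0 1 ! k)
      (leaves (comb (Suc 0)) 0 1 ! ((k + Suc 0) mod 2))" if "k < 2" for k
    using c_gen_represents[of 0] that
    unfolding represents_iff num_leaves_comb numeral_2_eq_2 by blast
  from this[of 0] this[of 1]
  have "affine_onto (c_gen 0) (0, 1/2) (1/2, 1)" "affine_onto (c_gen 0) (1/2, 1) (0, 1/2)"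
    by simp_all
  then have UV: "list_all2 (affine_onto (c_gen 0)) (leaves U 0 (1/2)) (leaves U (1/2) 1)"
    "list_all2 (affine_onto (c_gen 0)) (leaves V (1/2) 1) (leaves V 0 (1/2))"
    by (simp_all add: leaves_affine)
  have U: "affine_onto (c_gen 0) (leaves U 0 (1/2) ! i) (leaves U (1/2) 1 ! i)"
    if "i < num_leaves U" for i
    using UV(1) that by (simp add: list_all2_conv_all_nth length_leaves_num)
  have V: "affine_onto (c_gen 0) (leaves V (1/2) 1 ! j) (leaves V 0 (1/2) ! j)"
    if "j < num_leaves V" for j
    using UV(2) that by (simp add: list_all2_conv_all_nth length_leaves_num)
  show "affine_onto (c_gen 0) (leaves (Caret U V) 0 1 ! k)
      (leaves (Caret V U) 0 1 ! ((k + num_leaves V) mod num_leaves (Caret V U)))"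
  proof (cases "k < num_leaves U")
    case True
    then show ?thesis using U by (simp add: nth_append length_leaves_num)
  next
    case False
    then have "(k + num_leaves V) mod num_leaves (Caret V U) = k - num_leaves U"
      using k by (simp add: mod_if)
    moreover have "k - num_leaves U < num_leaves V" using k False by simp
    ultimately show ?thesis using V[of "k - num_leaves U"] False
      by (simp add: nth_append length_leaves_num)
  qed
qed

text \<open>Instead of a power of \<open>c_gen\<close>, whose length would need a separate estimate, the half turn does
  the rotation, between trees with a suitable number of leaves on either side of the root. This
  costs four positive or inverse positive words and two letters for the half turn.\<close>

lemma thompson_len:
  assumes w: "w \<in> thompson_T"
  shows "len_le gens (14 * caret_number w) w"
proof -
  obtain S T m where d: "reduced_diagram w = (S, T, m)"
    "tree_pair (S, T, m)" "represents (S, T, m) w"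
    using reduced_diagram_props[OF w] .
  have c: "caret_number w = carets S" "carets T = carets S" and m: "m < num_leaves S"
    using d by (simp_all add: caret_number_def source_tree_def tree_pair_def num_leaves_carets)
  have off: "w t = t" if "t \<notin> {0..<1}" for t by (rule thompson_outside[OF w that])
  show ?thesis
  proof (cases "m = 0")
    case True
    have "represents (S, S, m) id" "tree_pair (S, S, m)"
      using True by (auto simp: represents_iff tree_pair_def intro: affine_onto_id)
    from diagram_factorization[OF d(3,2) off this]
    have "w = pos_word (exponents T) \<circ> inv (pos_word (exponents S)) \<circ> id \<circ>
        pos_word (exponents S) \<circ> inv (pos_word (exponents S))" by simp
    also have "\<dots> = pos_word (exponents T) \<circ>
        (inv (pos_word (exponents S)) \<circ> pos_word (exponents S)) \<circ> inv (pos_word (exponents S))"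
      by (simp add: o_assoc)
    also have "\<dots> = pos_word (exponents T) \<circ> inv (pos_word (exponents S))"
      using bij_is_inj[OF bij_pos_word] by simp
    finally have "len_le gens (3 * carets T + 3 * carets S) w"
      using len_le_comp[OF tree_word_len tree_word_inv_len] by simp
    then show ?thesis using c by (auto intro: len_le_mono)
  next
    case False
    define U V where "U = comb (num_leaves S - m - 1)" and "V = comb (m - 1)"
    have n: "num_leaves U = num_leaves S - m" "num_leaves V = m"
      using False m by (simp_all add: U_def V_def)
    have tp: "tree_pair (Caret U V, Caret V U, m)" using n m by (simp add: tree_pair_def)
    have "num_leaves (Caret U V) = num_leaves S" using n m by simp
    from diagram_factorization[OF d(3,2) off c_gen_0_represents[of U V, unfolded n] tp c_gen_outside this]
    have weq: "w = pos_word (exponents T) \<circ> inv (pos_word (exponents (Caret V U))) \<circ> c_gen 0 \<circ>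
        pos_word (exponents (Caret U V)) \<circ> inv (pos_word (exponents S))" by simp
    have c0: "len_le gens (1 + 1) (c_gen 0)"
      unfolding c_gen_0_eq by (intro len_le_comp len_le_gen) auto
    have "len_le gens (3 * carets T + 3 * carets (Caret V U) + (1 + 1) + 3 * carets (Caret U V) + 3 * carets S) w"
      by (subst weq) (intro len_le_comp tree_word_len tree_word_inv_len c0)
    moreover have "carets (Caret U V) = carets S" "carets (Caret V U) = carets S" "1 \<le> carets S"
      using n m False by (simp_all add: num_leaves_carets)
    ultimately show ?thesis using c by (auto intro: len_le_mono)
  qed
qed

theorem theorem5p1:
  shows "\<exists>C::real. C > 0 \<and>
    (\<forall>w\<in>thompson_T.
       real (D_est w) / C \<le> real (word_length {x_gen 0, x_gen 1, c_gen 1} w) \<and>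
       (w \<noteq> c_gen 0 \<longrightarrow>
          real (word_length {x_gen 0, x_gen 1, c_gen 1} w) \<le> C * real (D_est w)) \<and>
       real (caret_number w) / C \<le> real (word_length {x_gen 0, x_gen 1, c_gen 1} w) \<and>
       real (word_length {x_gen 0, x_gen 1, c_gen 1} w) \<le> C * real (caret_number w))"
\<comment> \<open>\<open>D \<le> 5 N\<close> and \<open>N \<le> 4 |w|\<close> combine to the factor 20, \<open>|w| \<le> 14 N\<close> and
  \<open>N \<le> 2 D\<close> to the factor 28.\<close>
proof (intro exI[of _ 28] conjI ballI impI)
  fix w assume w: "w \<in> thompson_T"
  have lo: "caret_number w \<le> 4 * word_length gens w" by (rule caret_number_le[OF w thompson_len[OF w]])
  have hi: "word_length gens w \<le> 14 * caret_number w" by (rule word_length_le[OF thompson_len[OF w]])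
  have D: "D_est w \<le> 5 * caret_number w" by (rule D_est_le[OF w])
  show "real (D_est w) / 28 \<le> real (word_length gens w)" using lo D by simp
  show "real (caret_number w) / 28 \<le> real (word_length gens w)" using lo by simp
  show "real (word_length gens w) \<le> 28 * real (caret_number w)" using hi by simp
  show "real (word_length gens w) \<le> 28 * real (D_est w)" if "w \<noteq> c_gen 0"
    using hi caret_number_le_D_est[OF w that] by simp
qed simp

end
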